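(* Fix $\Delta>0$, $g>0$, and let $\delta_n^\pm=n^{1/4}\big(E_n^\pm-(n-g^2)\big)$. For any subinterval $[\alpha,\beta]\subset\left[-\frac{\Delta}{\sqrt{2\pi g}},\frac{\Delta}{\sqrt{2\pi g}}\right]$ and for each choice of sign, $$\lim_{N\to\infty}\frac1N\#\{n\le N:\ \delta_n^\pm\in[\alpha,\beta]\}=\int_\alpha^\beta\frac{dy}{\pi\sqrt{\frac{2\pi g}{\Delta^2}-y^2}}.$$
   Context: The quantum Rabi model is the Hamiltonian $H=a^\dagger a+\Delta\sigma_z+g\sigma_x(a+a^\dagger)$ acting on $L^2(\mathbb R)\otimes\mathbb C^2$, where $a^\dagger,a$ are the creation and annihilation operators of the harmonic oscillator (frequency $1$), $\sigma_x,\sigma_z$ are the Pauli matrices, $\Delta>0$, $g>0$. $H$ commutes with the parity operator $P=(-1)^{a^\dagger a}\sigma_z$, and on each of the $\pm1$-eigenspaces of $P$ it is unitarily equivalent to the Jacobi matrix (indices $k\ge0$) with diagonal entries $d_\pm(k)=k\pm(-1)^k\Delta$ and off-diagonal entries $a(k)=g\sqrt k$. The spectrum in each parity class is discrete and simple; its eigenvalues are labeled in increasing order $E^\pm_n$, with indexing normalized so that $E^\pm_n=n-g^2+o(1)$. (Known background: Boutet de Monvel and Zielinski proved $E_n^\pm=n-g^2\mp\frac{\Delta}{\sqrt{2\pi g}}\frac{(-1)^n\cos(4g\sqrt n-\pi/4)}{n^{1/4}}+O(n^{-1/2+o(1)})$.)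
   Formalization: The printed density has 2πg/Δ² under the root, which is false (e.g. Δ=1, g=2/π on the full interval gives about 0.16 instead of 1); the formal theorem uses the corrected density 1/(π√(Δ²/(2πg) − y²)). *)

theory Defs
  imports "HOL-Analysis.Analysis"
begin

text \<open>Jacobi matrix of the quantum Rabi model in the parity class with sign s (s = 1 or s = -1):
  diagonal d(k) = k + s (-1)^k Delta, off-diagonal a(k) = g sqrt k (entries (k-1,k) and (k,k-1)).\<close>

definition rabi_diag :: "real \<Rightarrow> real \<Rightarrow> nat \<Rightarrow> real" where
  "rabi_diag s \<Delta> k = real k + s * (-1) ^ k * \<Delta>"

definition rabi_offdiag :: "real \<Rightarrow> nat \<Rightarrow> real" where
  "rabi_offdiag g k = g * sqrt (real k)"

definition rabi_jacobi :: "real \<Rightarrow> real \<Rightarrow> real \<Rightarrow> (nat \<Rightarrow> real) \<Rightarrow> nat \<Rightarrow> real" where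
  "rabi_jacobi s \<Delta> g u k =
     (if k = 0 then 0 else rabi_offdiag g k * u (k - 1))
     + rabi_diag s \<Delta> k * u k + rabi_offdiag g (Suc k) * u (Suc k)"

definition rabi_eigenvalues :: "real \<Rightarrow> real \<Rightarrow> real \<Rightarrow> real set" where
  "rabi_eigenvalues s \<Delta> g =
     {ev. \<exists>u :: nat \<Rightarrow> real. summable (\<lambda>k. (u k)\<^sup>2) \<and> (\<exists>k. u k \<noteq> 0) \<and>
           (\<forall>k. rabi_jacobi s \<Delta> g u k = ev * u k)}"

end

(*
  At Delta = 0 the Jacobi matrix is diagonalised by displaced oscillator states, whose coefficients
  are Charlier functions. In this eigenbasis the perturbation becomes s Delta T with T orthogonal
  and symmetric, T(m,j) being the Charlier function with displacement 2g. A conserved quadratic form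
  of the three-term recurrence shows that T(m,j) = O(n^(-1/4)) for m, j near n. Since T is
  orthogonal, this is enough to justify first-order perturbation theory up to o(n^(-1/4)):
  E_n = n - g^2 + s Delta T(n,n) + o(n^(-1/4)).

  The diagonal entry is T(n,n) = (-1)^n exp(-x/2) L_n(x) with x = 4 g^2 and L_n the Laguerre
  polynomial. Writing L_n as an average of even Hermite polynomials, for which WKB is elementary, and
  applying stationary phase gives Fejer's formula, so n^(1/4) T(n,n) behaves like
  (-1)^n cos(4 g sqrt n - pi/4) / sqrt(2 pi g). Finally the moments of (-1)^n cos(4 g sqrt n - pi/4)
  converge to those of cos theta with theta uniform in [0, pi], which yields the arcsine law.
*)
theory Submission
  imports Defs "HOL-Complex_Analysis.Complex_Analysis" "HOL-Real_Asymp.Real_Asymp"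
    "HOL-Probability.Distributions"
begin

section \<open>Symmetric orthonormal matrices and first-order perturbation\<close>

text \<open>The obstacle is that the perturbation is not small: its norm \<open>\<Delta>\<close> may
  exceed the gap 1 between unperturbed levels. Two facts replace smallness. As E_n stays within 1/2
  of its level, the eigenvalue equation bounds c_m, for m other than n, by 2 \<Delta> |(T c)_m| / |n
  - m|, where T c is a unit vector. And in a window of half-width L around n all entries of T are
  O(n^(-1/4)), while outside it orthogonality is enough. The error is of order n^(-1/2) sqrt L +
  1/L, which is o(n^(-1/4)) exactly for n^(1/4) << L << n^(1/2). The doubling of g has an operator
  reason: with displacement D(b) and parity P, the Charlier matrix is C = D(b) P. Since P D(b) P =
  D(-b), C is an involution and C P C = D(2b) P. Hermite functions are preferred to Laguerre
  functions because their equation q'' = (y^2 - mu^2) q is regular at 0, where the initial data are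
  explicit. The sample points 4 g sqrt n have spacing tending to 0, so Cesaro means can be found by
  telescoping, without exponential sums.\<close>

abbreviation square_summable :: "(nat \<Rightarrow> real) \<Rightarrow> bool" where
  "square_summable f \<equiv> summable (\<lambda>k. (f k)\<^sup>2)"

lemma square_summable_mult:
  assumes "square_summable f" "square_summable g"
  shows "summable (\<lambda>k. f k * g k)"
proof (rule summable_comparison_test')
  show "summable (\<lambda>k. (f k)\<^sup>2 + (g k)\<^sup>2)"
    using assms by (rule summable_add)
  fix k :: nat
  have "0 \<le> (\<bar>f k\<bar> - \<bar>g k\<bar>)\<^sup>2" "0 \<le> \<bar>f k\<bar> * \<bar>g k\<bar>" by simp_all
  then show "norm (f k * g k) \<le> (f k)\<^sup>2 + (g k)\<^sup>2"
    by (simp only: power2_diff real_norm_def abs_mult power2_abs)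
qed

lemma Cauchy_Schwarz_suminf:
  assumes f: "square_summable f" and g: "square_summable g"
  shows "(\<Sum>k. f k * g k)\<^sup>2 \<le> (\<Sum>k. (f k)\<^sup>2) * (\<Sum>k. (g k)\<^sup>2)"
proof (rule LIMSEQ_le)
  show "(\<lambda>n. (\<Sum>k<n. f k * g k)\<^sup>2) \<longlonglongrightarrow> (\<Sum>k. f k * g k)\<^sup>2"
    by (intro tendsto_power summable_LIMSEQ square_summable_mult f g)
  show "(\<lambda>n. (\<Sum>k<n. (f k)\<^sup>2) * (\<Sum>k<n. (g k)\<^sup>2)) \<longlonglongrightarrow> (\<Sum>k. (f k)\<^sup>2) * (\<Sum>k. (g k)\<^sup>2)"
    by (intro tendsto_mult summable_LIMSEQ f g)
  show "\<exists>N. \<forall>n\<ge>N. (\<Sum>k<n. f k * g k)\<^sup>2 \<le> (\<Sum>k<n. (f k)\<^sup>2) * (\<Sum>k<n. (g k)\<^sup>2)"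
    using Cauchy_Schwarz_ineq_sum by blast
qed

lemma square_summable_diff:
  assumes "square_summable f" "square_summable g"
  shows "square_summable (\<lambda>k. f k - g k)"
proof -
  have "summable (\<lambda>k. (f k)\<^sup>2 - 2 * (f k * g k) + (g k)\<^sup>2)"
    by (intro summable_add summable_diff summable_mult square_summable_mult assms)
  then show ?thesis by (simp add: power2_diff algebra_simps)
qed

definition mat_apply :: "(nat \<Rightarrow> nat \<Rightarrow> real) \<Rightarrow> (nat \<Rightarrow> real) \<Rightarrow> nat \<Rightarrow> real" where
  "mat_apply A u m = (\<Sum>k. A m k * u k)"

text \<open>Orthonormal rows mean A A^T = 1; symmetry turns this into A^2 = 1, which also supplies
  completeness. \<open>A\<close> is thus a self-adjoint isometric involution of l2.\<close>

locale symmetric_orthonormal =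
  fixes A :: "nat \<Rightarrow> nat \<Rightarrow> real"
  assumes symmetric: "A m n = A n m"
    and square_summable_row: "square_summable (A m)"
    and orthonormal: "(\<Sum>k. A m k * A n k) = of_bool (m = n)"
begin

lemma summable_row_mult: "square_summable u \<Longrightarrow> summable (\<lambda>k. A m k * u k)"
  by (intro square_summable_mult square_summable_row)

text \<open>With \<open>u\<close> cut off after N entries, only finite sums are interchanged with
  the series over rows, and orthonormality of the columns (by symmetry) evaluates it. Then N tends
  to infinity while the number M of rows stays fixed.\<close>

lemma partial_sum_apply_le:
  assumes u: "square_summable u"
  shows "(\<Sum>m<M. (mat_apply A u m)\<^sup>2) \<le> (\<Sum>k. (u k)\<^sup>2)"
proof (rule LIMSEQ_le_const2)
  show "(\<lambda>N. \<Sum>m<M. (\<Sum>k<N. A m k * u k)\<^sup>2) \<longlonglongrightarrow> (\<Sum>m<M. (mat_apply A u m)\<^sup>2)"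
    unfolding mat_apply_def
    by (intro tendsto_sum tendsto_power summable_LIMSEQ summable_row_mult u)
  have "(\<Sum>m<M. (\<Sum>k<N. A m k * u k)\<^sup>2) \<le> (\<Sum>k. (u k)\<^sup>2)" for N
  proof -
    have summ: "summable (\<lambda>m. A m k * A m l)" for k l
      using square_summable_mult[OF square_summable_row square_summable_row, of k l]
      by (simp add: symmetric)
    have sq: "(\<Sum>k<N. A m k * u k)\<^sup>2 = (\<Sum>k<N. \<Sum>l<N. u k * u l * (A m k * A m l))" for m
      by (simp add: power2_eq_square sum_product mult_ac)
    have summ2: "summable (\<lambda>m. (\<Sum>k<N. A m k * u k)\<^sup>2)"
      unfolding sq by (intro summable_sum summable_mult summ)
    have "(\<Sum>m<M. (\<Sum>k<N. A m k * u k)\<^sup>2) \<le> (\<Sum>m. (\<Sum>k<N. A m k * u k)\<^sup>2)"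
      by (rule sum_le_suminf[OF summ2]) auto
    also have "\<dots> = (\<Sum>k<N. \<Sum>l<N. u k * u l * (\<Sum>m. A m k * A m l))"
      unfolding sq
      by (simp add: suminf_sum summ suminf_mult summable_mult summable_sum)
    also have "\<dots> = (\<Sum>k<N. \<Sum>l<N. if l = k then u k * u l else 0)"
      using orthonormal by (intro sum.cong refl) (simp add: symmetric[of _ "_::nat"])
    also have "\<dots> = (\<Sum>k<N. (u k)\<^sup>2)"
      by (simp add: sum.delta power2_eq_square)
    also have "\<dots> \<le> (\<Sum>k. (u k)\<^sup>2)"
      by (rule sum_le_suminf[OF u]) auto
    finally show ?thesis .
  qed
  then show "\<exists>N0. \<forall>N\<ge>N0. (\<Sum>m<M. (\<Sum>k<N. A m k * u k)\<^sup>2) \<le> (\<Sum>k. (u k)\<^sup>2)" by blast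
qed

lemma square_summable_apply: "square_summable u \<Longrightarrow> square_summable (mat_apply A u)"
  using partial_sum_apply_le[of u]
  by (intro bounded_imp_summable[where B="\<Sum>k. (u k)\<^sup>2"])
     (auto simp flip: lessThan_Suc_atMost simp del: sum.lessThan_Suc)

lemma suminf_apply_le:
  "square_summable u \<Longrightarrow> (\<Sum>m. (mat_apply A u m)\<^sup>2) \<le> (\<Sum>k. (u k)\<^sup>2)"
  using partial_sum_apply_le[of u] square_summable_apply[of u] by (intro suminf_le_const) auto

text \<open>The double series need not converge absolutely, so the summations cannot simply be
  swapped. The identity is finite for the truncations \<open>t N\<close> of \<open>u\<close>;
  Cauchy-Schwarz and the contraction bound \<open>suminf_apply_le\<close> make the remainder
  vanish.\<close>

lemma self_adjoint:
  assumes u: "square_summable u" and f: "square_summable f"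
  shows "(\<Sum>m. mat_apply A u m * f m) = (\<Sum>k. u k * mat_apply A f k)"
proof -
  define t where "t N k = (if k < N then u k else 0)" for N k
  have t: "square_summable (t N)" for N
    unfolding t_def by (rule summable_finite[of "{..<N}"]) auto
  have diff: "mat_apply A u m - mat_apply A (t N) m = mat_apply A (\<lambda>k. u k - t N k) m" for N m
    unfolding mat_apply_def
    by (subst suminf_diff) (auto intro!: summable_row_mult u t simp: right_diff_distrib)
  have tsum: "(\<Sum>k. t N k * h k) = (\<Sum>k<N. u k * h k)" for N h
    by (subst suminf_finite[of "{..<N}"]) (auto simp: t_def)
  have fin: "(\<Sum>m. mat_apply A (t N) m * f m) = (\<Sum>k<N. u k * mat_apply A f k)" for N
  proof -
    have "(\<Sum>m. mat_apply A (t N) m * f m) = (\<Sum>m. (\<Sum>k<N. u k * (A k m * f m)))"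
      unfolding mat_apply_def using tsum[of N]
      by (intro suminf_cong) (simp add: sum_distrib_right sum_distrib_left mult_ac symmetric[of _ "_::nat"])
    also have "\<dots> = (\<Sum>k<N. u k * mat_apply A f k)"
      unfolding mat_apply_def
      by (simp add: suminf_sum summable_mult summable_row_mult f suminf_mult)
    finally show ?thesis .
  qed
  have tail: "(\<lambda>N. \<Sum>k. (u k - t N k)\<^sup>2) \<longlonglongrightarrow> 0"
  proof -
    have "(\<Sum>k. (u k - t N k)\<^sup>2) = (\<Sum>k. (u k)\<^sup>2) - (\<Sum>k<N. (u k)\<^sup>2)" for N
    proof -
      have "(\<Sum>k. (u k - t N k)\<^sup>2) = (\<Sum>k. (u k)\<^sup>2 - t N k * u k)"
        by (intro suminf_cong) (auto simp: t_def power2_eq_square)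
      also have "\<dots> = (\<Sum>k. (u k)\<^sup>2) - (\<Sum>k<N. (u k)\<^sup>2)"
        by (subst suminf_diff[symmetric])
           (auto simp: tsum u power2_eq_square[symmetric] intro!: square_summable_mult t)
      finally show ?thesis .
    qed
    moreover have "(\<lambda>N. (\<Sum>k. (u k)\<^sup>2) - (\<Sum>k<N. (u k)\<^sup>2)) \<longlonglongrightarrow> (\<Sum>k. (u k)\<^sup>2) - (\<Sum>k. (u k)\<^sup>2)"
      by (intro tendsto_diff tendsto_const summable_LIMSEQ u)
    ultimately show ?thesis by simp
  qed
  have "(\<lambda>N. ((\<Sum>m. mat_apply A u m * f m) - (\<Sum>k<N. u k * mat_apply A f k))\<^sup>2) \<longlonglongrightarrow> 0"
  proof (rule tendsto_sandwich[of "\<lambda>_. 0"])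
    have ut: "square_summable (\<lambda>k. u k - t N k)" for N
      by (intro square_summable_diff u t)
    have "((\<Sum>m. mat_apply A u m * f m) - (\<Sum>k<N. u k * mat_apply A f k))\<^sup>2
        \<le> (\<Sum>k. (u k - t N k)\<^sup>2) * (\<Sum>m. (f m)\<^sup>2)" for N
    proof -
      have "(\<Sum>m. mat_apply A u m * f m) - (\<Sum>k<N. u k * mat_apply A f k)
          = (\<Sum>m. mat_apply A (\<lambda>k. u k - t N k) m * f m)"
        unfolding fin[symmetric] diff[symmetric]
        by (subst suminf_diff) (auto intro!: square_summable_mult square_summable_apply u t f
             simp: left_diff_distrib)
      then have "((\<Sum>m. mat_apply A u m * f m) - (\<Sum>k<N. u k * mat_apply A f k))\<^sup>2
          \<le> (\<Sum>m. (mat_apply A (\<lambda>k. u k - t N k) m)\<^sup>2) * (\<Sum>m. (f m)\<^sup>2)"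
        using Cauchy_Schwarz_suminf[OF square_summable_apply[OF ut] f] by simp
      also have "\<dots> \<le> (\<Sum>k. (u k - t N k)\<^sup>2) * (\<Sum>m. (f m)\<^sup>2)"
        by (intro mult_right_mono suminf_apply_le ut suminf_nonneg f) auto
      finally show ?thesis .
    qed
    then show "\<forall>\<^sub>F N in sequentially. ((\<Sum>m. mat_apply A u m * f m) - (\<Sum>k<N. u k * mat_apply A f k))\<^sup>2
        \<le> (\<Sum>k. (u k - t N k)\<^sup>2) * (\<Sum>m. (f m)\<^sup>2)" by simp
    show "(\<lambda>N. (\<Sum>k. (u k - t N k)\<^sup>2) * (\<Sum>m. (f m)\<^sup>2)) \<longlonglongrightarrow> 0"
      using tendsto_mult_right[OF tail, of "\<Sum>m. (f m)\<^sup>2"] by simp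
  qed auto
  then have "(\<lambda>N. (\<Sum>m. mat_apply A u m * f m) - (\<Sum>k<N. u k * mat_apply A f k)) \<longlonglongrightarrow> 0"
    using tendsto_real_sqrt[of _ 0] by (auto simp: tendsto_rabs_zero_iff)
  moreover have "(\<lambda>N. \<Sum>k<N. u k * mat_apply A f k) \<longlonglongrightarrow> (\<Sum>k. u k * mat_apply A f k)"
    by (intro summable_LIMSEQ square_summable_mult square_summable_apply u f)
  ultimately have "(\<lambda>N. (\<Sum>m. mat_apply A u m * f m)) \<longlonglongrightarrow> 0 + (\<Sum>k. u k * mat_apply A f k)"
    using tendsto_add by fastforce
  then show ?thesis by (simp add: LIMSEQ_const_iff)
qed

lemma apply_row: "mat_apply A (A k) m = of_bool (m = k)"
  using orthonormal by (simp add: mat_apply_def)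

lemma apply_apply:
  assumes u: "square_summable u"
  shows "mat_apply A (mat_apply A u) k = u k"
proof -
  have "mat_apply A (mat_apply A u) k = (\<Sum>m. mat_apply A u m * A k m)"
    unfolding mat_apply_def[of A "mat_apply A u"] by (simp add: mult.commute)
  also have "\<dots> = (\<Sum>j. u j * of_bool (j = k))"
    by (subst self_adjoint[OF u square_summable_row]) (simp add: apply_row)
  also have "\<dots> = u k"
    by (subst suminf_finite[of "{k}"]) auto
  finally show ?thesis .
qed

lemma Parseval:
  assumes u: "square_summable u"
  shows "(\<Sum>m. (mat_apply A u m)\<^sup>2) = (\<Sum>k. (u k)\<^sup>2)"
  using self_adjoint[OF u square_summable_apply[OF u]]
  by (simp add: apply_apply[OF u] power2_eq_square)

end

section \<open>Inverse-square sums and the perturbation estimate\<close>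

lemma sum_inverse_squares_le: "(\<Sum>d=1..M. 1 / (real d)\<^sup>2) \<le> 2"
proof (cases M)
  case (Suc k)
  \<comment> \<open>Subtracting 1 / (k + 1) lets the induction close: 1 / d^2 is dominated by a
    telescoping difference.\<close>
  have "(\<Sum>d=1..Suc k. 1 / (real d)\<^sup>2) \<le> 2 - 1 / real (Suc k)" for k
  proof (induction k)
    case (Suc k)
    have "1 / (real (Suc (Suc k)))\<^sup>2 \<le> 1 / (real (Suc k) * real (Suc (Suc k)))"
      by (intro divide_left_mono) (auto simp: power2_eq_square)
    also have "\<dots> = 1 / real (Suc k) - 1 / real (Suc (Suc k))"
      by (simp add: field_simps)
    finally show ?case using Suc by simp
  qed simp
  from this[of k] Suc show ?thesis by (simp add: order_trans)
qed simp

lemma sum_inverse_square_distance_le: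
  fixes J :: "nat set"
  assumes "finite J" "n \<notin> J"
  shows "(\<Sum>j\<in>J. 1 / (real n - real j)\<^sup>2) \<le> 4"
proof -
  obtain M where M: "J \<subseteq> {..n + M}"
    using finite_nat_set_iff_bounded_le[of J] assms by (meson atMost_iff subsetI trans_le_add2)
  have "(\<Sum>j\<in>J. 1 / (real n - real j)\<^sup>2) \<le> (\<Sum>j\<in>{..<n} \<union> {n<..n+M}. 1 / (real n - real j)\<^sup>2)"
    using M assms by (intro sum_mono2) (auto simp: subset_eq, metis nat_neq_iff)
  also have "\<dots> = (\<Sum>j<n. 1 / (real n - real j)\<^sup>2) + (\<Sum>j\<in>{n<..n+M}. 1 / (real n - real j)\<^sup>2)"
    by (intro sum.union_disjoint) auto
  also have "(\<Sum>j<n. 1 / (real n - real j)\<^sup>2) = (\<Sum>d=1..n. 1 / (real d)\<^sup>2)"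
    by (rule sum.reindex_bij_witness[of _ "\<lambda>d. n - d" "\<lambda>j. n - j"]) (auto simp: of_nat_diff)
  also have "(\<Sum>j\<in>{n<..n+M}. 1 / (real n - real j)\<^sup>2) = (\<Sum>d=1..M. 1 / (real d)\<^sup>2)"
    by (rule sum.reindex_bij_witness[of _ "\<lambda>d. n + d" "\<lambda>j. j - n"]) (auto simp: of_nat_diff power2_commute)
  finally show ?thesis using sum_inverse_squares_le[of n] sum_inverse_squares_le[of M] by linarith
qed

lemma sum_mult_le_sqrt:
  fixes a b :: "'a \<Rightarrow> real"
  assumes "(\<Sum>i\<in>I. (a i)\<^sup>2) \<le> p" "(\<Sum>i\<in>I. (b i)\<^sup>2) \<le> q"
  shows "(\<Sum>i\<in>I. a i * b i) \<le> sqrt p * sqrt q"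
proof -
  have "(\<Sum>i\<in>I. a i * b i)\<^sup>2 \<le> p * q"
    by (rule order_trans[OF Cauchy_Schwarz_ineq_sum mult_mono[OF assms]])
       (auto intro: sum_nonneg order_trans[OF sum_nonneg assms(1)])
  then show ?thesis by (simp add: real_le_rsqrt real_sqrt_mult[symmetric])
qed

context symmetric_orthonormal
begin

text \<open>Think of \<open>c\<close> as the coefficients of a normalised perturbed eigenvector close to the
  \<open>n\<close>-th unperturbed one, and of \<open>A\<close> as the perturbation. Knowing only that \<open>A\<close> is orthogonal
  and has small entries near \<open>(n, n)\<close>, the first-order formula is recovered by bootstrapping:
  a bound \<open>\<kappa>\<close> on \<open>A c\<close> near \<open>n\<close> improves the bound on \<open>c\<close>.\<close>

lemma first_order_perturbation:
  fixes c :: "nat \<Rightarrow> real" and D \<eta> :: real and n L :: nat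
  assumes c: "square_summable c" "(\<Sum>k. (c k)\<^sup>2) = 1" and D: "D \<ge> 0" and L: "L > 0"
    and c_le: "\<And>m. m \<noteq> n \<Longrightarrow> \<bar>c m\<bar> * \<bar>real n - real m\<bar> \<le> 2 * D * \<bar>mat_apply A c m\<bar>"
    and small: "\<And>m j. m \<in> {n - L..n + L} \<Longrightarrow> j \<in> {n - L..n + L} \<Longrightarrow> \<bar>A m j\<bar> \<le> \<eta>"
  defines "\<kappa> \<equiv> \<eta> * (1 + 4 * D) + 2 * D / L"
  shows "\<bar>mat_apply A c n - A n n * c n\<bar> \<le> 8 * D * \<eta> * \<kappa> * sqrt L + 2 * D / L"
    and "1 - (c n)\<^sup>2 \<le> (4 * D * \<kappa>)\<^sup>2 + (2 * D / L)\<^sup>2"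
proof -
  define W where "W = {n - L..n + L}"
  define v where "v = mat_apply A c"
  define far where "far j = (if j \<in> W then 0 else c j)" for j
  have W: "finite W" "n \<in> W" by (auto simp: W_def)
  have \<eta>: "\<eta> \<ge> 0" using small[of n n] by (auto intro: order_trans[OF abs_ge_zero])
  have \<kappa>: "\<kappa> \<ge> 0" using \<eta> D by (simp add: \<kappa>_def)
  have v: "square_summable v" "(\<Sum>k. (v k)\<^sup>2) = 1"
    using square_summable_apply[OF c(1)] Parseval[OF c(1)] c(2) by (auto simp: v_def)
  have c_abs: "\<bar>c m\<bar> \<le> 2 * D * \<bar>v m\<bar> * (1 / \<bar>real n - real m\<bar>)" if "m \<noteq> n" for m
    using c_le[OF that] that by (simp add: v_def pos_le_divide_eq)
  have far_le: "(far j)\<^sup>2 \<le> (2 * D / L)\<^sup>2 * (v j)\<^sup>2" for j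
  proof (cases "j \<in> W")
    case False
    \<comment> \<open>Truncated subtraction is harmless: if n < L, the window starts at 0 and
      \<open>j\<close> can only lie above n + L.\<close>
    then have dist: "real L \<le> \<bar>real n - real j\<bar>" "j \<noteq> n" by (auto simp: W_def)
    then have "\<bar>c j\<bar> * real L \<le> 2 * D * \<bar>v j\<bar>"
      using c_le[of j] mult_left_mono[of "real L" "\<bar>real n - real j\<bar>" "\<bar>c j\<bar>"] by (simp add: v_def)
    then have "\<bar>c j\<bar> \<le> \<bar>2 * D / L * v j\<bar>"
      using L D by (simp add: pos_le_divide_eq abs_mult)
    then show ?thesis using False by (simp only: far_def if_False abs_le_square_iff power_mult_distrib)
  qed (simp add: far_def)
  have far: "square_summable far"
    by (rule summable_comparison_test'[OF summable_mult[OF v(1), of "(2 * D / L)\<^sup>2"]])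
       (simp add: far_le)
  have sum_far: "(\<Sum>j. (far j)\<^sup>2) \<le> (2 * D / L)\<^sup>2"
    using suminf_le[OF far_le far summable_mult[OF v(1)]] by (simp add: suminf_mult v)
  have split: "v m = (\<Sum>j\<in>W. A m j * c j) + (\<Sum>j. A m j * far j)" for m
  proof -
    have near: "(\<lambda>j. if j \<in> W then A m j * c j else 0) sums (\<Sum>j\<in>W. A m j * c j)"
      by (rule sums_If_finite_set[OF W(1)])
    have "(\<lambda>j. A m j * far j) sums (\<Sum>j. A m j * far j)"
      by (intro summable_sums summable_row_mult far)
    from sums_add[OF near this] have "(\<lambda>j. A m j * c j) sums ((\<Sum>j\<in>W. A m j * c j) + (\<Sum>j. A m j * far j))"
      by (rule sums_cong[THEN iffD1, rotated]) (simp add: far_def)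
    then show ?thesis by (simp add: v_def mat_apply_def sums_iff)
  qed
  have far_apply: "\<bar>\<Sum>j. A m j * far j\<bar> \<le> 2 * D / L" for m
  proof (rule power2_le_imp_le)
    have "(\<Sum>j. A m j * far j)\<^sup>2 \<le> (\<Sum>j. (A m j)\<^sup>2) * (\<Sum>j. (far j)\<^sup>2)"
      by (rule Cauchy_Schwarz_suminf[OF square_summable_row far])
    also have "(\<Sum>j. (A m j)\<^sup>2) = 1"
      using orthonormal[of m m] by (simp add: power2_eq_square)
    finally show "\<bar>\<Sum>j. A m j * far j\<bar>\<^sup>2 \<le> (2 * D / L)\<^sup>2" using sum_far by simp
  qed (use D in simp)
  have inv: "(\<Sum>j\<in>W - {n}. (1 / \<bar>real n - real j\<bar>)\<^sup>2) \<le> 4"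
    using sum_inverse_square_distance_le[of "W - {n}" n] W by (simp add: power_divide)
  \<comment> \<open>Off n, c is bounded by v divided by the distance to n. Cauchy-Schwarz against
    the inverse squares gives an l1 bound 2 D * 1 * 2 that does not depend on L.\<close>
  have near_c: "(\<Sum>j\<in>W. \<bar>c j\<bar>) \<le> 1 + 4 * D"
  proof -
    have "(\<Sum>j\<in>W - {n}. (v j)\<^sup>2) \<le> 1"
      using sum_le_suminf[OF v(1), of "W - {n}"] W v(2) by simp
    then have 1: "(\<Sum>j\<in>W - {n}. \<bar>v j\<bar> * (1 / \<bar>real n - real j\<bar>)) \<le> sqrt 1 * sqrt 4"
      by (intro sum_mult_le_sqrt inv) simp
    have "(\<Sum>j\<in>W - {n}. \<bar>c j\<bar>) \<le> (\<Sum>j\<in>W - {n}. 2 * D * (\<bar>v j\<bar> * (1 / \<bar>real n - real j\<bar>)))"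
      using c_abs by (intro sum_mono) (auto simp: mult.assoc)
    also have "\<dots> \<le> 2 * D * 2"
      unfolding sum_distrib_left[symmetric] using 1 D by (intro mult_left_mono) auto
    finally have "(\<Sum>j\<in>W - {n}. \<bar>c j\<bar>) \<le> 4 * D" by simp
    moreover have "(c n)\<^sup>2 \<le> 1"
      using sum_le_suminf[OF c(1), of "{n}"] c(2) by simp
    then have "\<bar>c n\<bar> \<le> 1" by (simp add: abs_square_le_1)
    ultimately show ?thesis using W by (simp add: sum.remove[of W n])
  qed
  \<comment> \<open>The bootstrap: entries at most \<open>\<eta>\<close> times the l1 norm of c in
    the window, plus the far part, make \<open>v\<close> small near n; by \<open>c_le\<close> this
    makes c small there as well.\<close>
  have v_near: "\<bar>v m\<bar> \<le> \<kappa>" if m: "m \<in> W" for m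
  proof -
    have "\<bar>\<Sum>j\<in>W. A m j * c j\<bar> \<le> (\<Sum>j\<in>W. \<eta> * \<bar>c j\<bar>)"
      using small m unfolding W_def
      by (intro order_trans[OF sum_abs] sum_mono) (auto simp: abs_mult intro: mult_right_mono)
    also have "\<dots> \<le> \<eta> * (1 + 4 * D)"
      unfolding sum_distrib_left[symmetric] by (intro mult_left_mono near_c \<eta>)
    finally show ?thesis using far_apply[of m] unfolding split[of m] \<kappa>_def by linarith
  qed
  have c_near: "\<bar>c m\<bar> \<le> 2 * D * \<kappa> * (1 / \<bar>real n - real m\<bar>)" if "m \<in> W - {n}" for m
  proof -
    have "2 * D * \<bar>v m\<bar> * (1 / \<bar>real n - real m\<bar>) \<le> 2 * D * \<kappa> * (1 / \<bar>real n - real m\<bar>)"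
      using v_near[of m] that D by (intro mult_right_mono mult_left_mono) auto
    then show ?thesis using c_abs[of m] that by auto
  qed
  show "\<bar>mat_apply A c n - A n n * c n\<bar> \<le> 8 * D * \<eta> * \<kappa> * sqrt L + 2 * D / L"
  proof -
    have card: "real (card (W - {n})) \<le> 4 * real L"
    proof -
      have "card (W - {n}) = card W - 1" using W by simp
      moreover have "card W \<le> 2 * L + 1" by (simp add: W_def)
      ultimately show ?thesis by linarith
    qed
    \<comment> \<open>The true growth is logarithmic in L, but sqrt L is affordable and follows from
      \<open>inv\<close> again.\<close>
    have "(\<Sum>j\<in>W - {n}. 1 * (1 / \<bar>real n - real j\<bar>)) \<le> sqrt (4 * real L) * sqrt 4"
      by (intro sum_mult_le_sqrt inv) (use card in simp)
    then have 1: "(\<Sum>j\<in>W - {n}. 1 / \<bar>real n - real j\<bar>) \<le> 4 * sqrt L"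
      by (simp add: real_sqrt_mult)
    have "\<bar>\<Sum>j\<in>W - {n}. A n j * c j\<bar> \<le> (\<Sum>j\<in>W - {n}. \<eta> * (2 * D * \<kappa> * (1 / \<bar>real n - real j\<bar>)))"
    proof (intro order_trans[OF sum_abs] sum_mono)
      fix j assume j: "j \<in> W - {n}"
      then have "\<bar>A n j\<bar> \<le> \<eta>" using small[of n j] W by (auto simp: W_def)
      then show "\<bar>A n j * c j\<bar> \<le> \<eta> * (2 * D * \<kappa> * (1 / \<bar>real n - real j\<bar>))"
        unfolding abs_mult using c_near[OF j] \<eta> by (intro mult_mono) auto
    qed
    also have "\<dots> = 2 * D * \<eta> * \<kappa> * (\<Sum>j\<in>W - {n}. 1 / \<bar>real n - real j\<bar>)"
      by (simp add: sum_distrib_left mult_ac)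
    also have "\<dots> \<le> 2 * D * \<eta> * \<kappa> * (4 * sqrt L)"
      using 1 D \<eta> \<kappa> by (intro mult_left_mono) auto
    finally have "\<bar>\<Sum>j\<in>W - {n}. A n j * c j\<bar> \<le> 8 * D * \<eta> * \<kappa> * sqrt L" by simp
    moreover have "v n - A n n * c n = (\<Sum>j\<in>W - {n}. A n j * c j) + (\<Sum>j. A n j * far j)"
      unfolding split[of n] using W by (simp add: sum.remove[of W n])
    ultimately show ?thesis using far_apply[of n] unfolding v_def[symmetric] by linarith
  qed
  show "1 - (c n)\<^sup>2 \<le> (4 * D * \<kappa>)\<^sup>2 + (2 * D / L)\<^sup>2"
  proof -
    have near: "(\<lambda>j. if j \<in> W then (c j)\<^sup>2 else 0) sums (\<Sum>j\<in>W. (c j)\<^sup>2)"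
      by (rule sums_If_finite_set[OF W(1)])
    from sums_add[OF near summable_sums[OF far]]
    have "(\<lambda>j. (c j)\<^sup>2) sums ((\<Sum>j\<in>W. (c j)\<^sup>2) + (\<Sum>j. (far j)\<^sup>2))"
      by (rule sums_cong[THEN iffD1, rotated]) (simp add: far_def)
    then have "1 = (\<Sum>j\<in>W. (c j)\<^sup>2) + (\<Sum>j. (far j)\<^sup>2)" using c(2) by (simp add: sums_iff)
    also have "(\<Sum>j\<in>W. (c j)\<^sup>2) = (c n)\<^sup>2 + (\<Sum>j\<in>W - {n}. (c j)\<^sup>2)"
      using W by (simp add: sum.remove[of W n])
    finally have one: "1 = (c n)\<^sup>2 + (\<Sum>j\<in>W - {n}. (c j)\<^sup>2) + (\<Sum>j. (far j)\<^sup>2)" .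
    have "(\<Sum>j\<in>W - {n}. (c j)\<^sup>2) \<le> (\<Sum>j\<in>W - {n}. (2 * D * \<kappa>)\<^sup>2 * (1 / \<bar>real n - real j\<bar>)\<^sup>2)"
    proof (intro sum_mono)
      fix j assume "j \<in> W - {n}"
      from power_mono[OF c_near[OF this], of 2]
      show "(c j)\<^sup>2 \<le> (2 * D * \<kappa>)\<^sup>2 * (1 / \<bar>real n - real j\<bar>)\<^sup>2"
        by (simp flip: power_mult_distrib)
    qed
    also have "\<dots> \<le> (2 * D * \<kappa>)\<^sup>2 * 4"
      unfolding sum_distrib_left[symmetric] by (intro mult_left_mono inv) simp
    finally have "(\<Sum>j\<in>W - {n}. (c j)\<^sup>2) \<le> (4 * D * \<kappa>)\<^sup>2" by (simp add: power_mult_distrib)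
    then show ?thesis using one sum_far by linarith
  qed
qed

end

section \<open>Charlier functions\<close>

text \<open>The coefficient of x^n y^m in exp (b x + b y - x y); the symmetry in n and m is visible
  from this generating function.\<close>

definition charlier_sum :: "real \<Rightarrow> nat \<Rightarrow> nat \<Rightarrow> real" where
  "charlier_sum b n m =
     (\<Sum>j\<le>min n m. (-1) ^ j * b ^ (n + m - 2 * j) / (fact j * fact (n - j) * fact (m - j)))"

text \<open>Up to the factor \<open>(-1) ^ m\<close>, the matrix of the displacement operator
  \<open>exp (b (a\<^sup>\<dagger> - a))\<close> in the number basis.\<close>

definition charlier :: "real \<Rightarrow> nat \<Rightarrow> nat \<Rightarrow> real" where
  "charlier b n m = exp (- (b\<^sup>2 / 2)) * sqrt (fact n * fact m) * charlier_sum b n m"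

lemma charlier_sum_commute: "charlier_sum b n m = charlier_sum b m n"
  by (simp add: charlier_sum_def min.commute add.commute mult.commute mult.left_commute mult.assoc)

lemma charlier_commute: "charlier b n m = charlier b m n"
  by (simp add: charlier_def charlier_sum_commute[of b n m] mult.commute)

text \<open>Coefficient form of the fact that differentiating exp (b x + b y - x y) in x multiplies
  it by b - y.\<close>

lemma charlier_sum_Suc:
  "real (Suc n) * charlier_sum b (Suc n) m
     = b * charlier_sum b n m - (if m = 0 then 0 else charlier_sum b n (m - 1))"
proof -
  \<comment> \<open>Summands padded by 0 beyond min n m, so that the three sums can be compared over
    common ranges.\<close>
  define d where "d n m j = (if j \<le> min n m
      then (-1) ^ j * b ^ (n + m - 2 * j) / (fact j * fact (n - j) * fact (m - j)) else 0)" for n m j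
  have sum_d: "charlier_sum b n m = (\<Sum>j\<le>N. d n m j)" if "n \<le> N" for n m N
    unfolding charlier_sum_def d_def
    by (rule sum.mono_neutral_cong_left) (use that in auto)
  have term_0: "real (Suc n) * d (Suc n) m 0 = b * d n m 0"
    by (simp add: d_def del: of_nat_Suc)
  have term_Suc: "real (Suc n) * d (Suc n) m (Suc i)
      = b * d n m (Suc i) - (if m = 0 then 0 else d n (m - 1) i)" if "i \<le> n" for i
  proof (cases "Suc i \<le> m")
    case False
    then show ?thesis by (auto simp: d_def)
  next
    case True
    obtain p where n: "n = i + p" using \<open>i \<le> n\<close> le_Suc_ex by blast
    obtain q where m: "m = Suc i + q" using True le_Suc_ex by blast
    have [simp]: "i + p + (i + q) - 2 * i = p + q"
      "Suc (i + p) + (Suc i + q) - 2 * Suc i = p + q"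
      "i + (p + (i + q)) - 2 * i = p + q"
      "Suc (Suc (i + p + (i + q))) - 2 * Suc i = p + q"
      by simp_all
    show ?thesis
    proof (cases p)
      case 0
      then show ?thesis by (simp add: d_def n m del: of_nat_Suc)
    next
      case (Suc p')
      then show ?thesis unfolding d_def n m
        by (simp add: divide_simps) (simp add: algebra_simps)
    qed
  qed
  have "real (Suc n) * charlier_sum b (Suc n) m
      = real (Suc n) * d (Suc n) m 0 + (\<Sum>i\<le>n. real (Suc n) * d (Suc n) m (Suc i))"
    by (subst sum_d[of _ "Suc n"])
       (simp_all only: sum.atMost_Suc_shift distrib_left sum_distrib_left order_refl)
  also have "(\<Sum>i\<le>n. real (Suc n) * d (Suc n) m (Suc i))
      = (\<Sum>i\<le>n. b * d n m (Suc i)) - (if m = 0 then 0 else \<Sum>i\<le>n. d n (m - 1) i)"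
    using sum.cong[OF refl term_Suc, of "{..n}"] by (simp add: sum_subtractf del: of_nat_Suc)
  also have "real (Suc n) * d (Suc n) m 0 + \<dots> = b * (\<Sum>j\<le>Suc n. d n m j)
      - (if m = 0 then 0 else \<Sum>i\<le>n. d n (m - 1) i)"
    unfolding term_0 sum.atMost_Suc_shift by (simp add: distrib_left sum_distrib_left)
  finally show ?thesis
    using sum_d[of n "Suc n" m] sum_d[of n n "m - 1"] by (simp del: sum.atMost_Suc of_nat_Suc)
qed

text \<open>For \<open>m = 0\<close> the junk value \<open>charlier b n (0 - 1)\<close> is multiplied by \<open>sqrt 0 = 0\<close>.\<close>

lemma charlier_Suc_left:
  "sqrt (real (Suc n)) * charlier b (Suc n) m
     = b * charlier b n m - sqrt (real m) * charlier b n (m - 1)"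
proof -
  have "sqrt (real (Suc n)) * charlier b (Suc n) m
      = exp (- (b\<^sup>2 / 2)) * sqrt (fact n * fact m) * (real (Suc n) * charlier_sum b (Suc n) m)"
    by (simp add: charlier_def real_sqrt_mult mult_ac del: of_nat_Suc)
  also have "\<dots> = b * charlier b n m - sqrt (real m) * charlier b n (m - 1)"
  proof (cases m)
    case (Suc k)
    have "sqrt (fact m) = sqrt (real m) * sqrt (fact k)"
      by (simp add: Suc real_sqrt_mult del: of_nat_Suc)
    moreover have "sqrt (real m) * sqrt (real m) = real m" by simp
    ultimately show ?thesis
      unfolding charlier_sum_Suc using Suc
      by (simp add: charlier_def real_sqrt_mult algebra_simps del: of_nat_Suc)
  qed (unfold charlier_sum_Suc, simp add: charlier_def)
  finally show ?thesis .
qed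

lemma charlier_Suc_right:
  "sqrt (real (Suc m)) * charlier b n (Suc m)
     = b * charlier b n m - sqrt (real n) * charlier b (n - 1) m"
  using charlier_Suc_left[of m b n] by (simp add: charlier_commute[of b n m] charlier_commute[of b n "Suc m"]
      charlier_commute[of b "n - Suc 0" m])

lemma charlier_0_left: "charlier b 0 m = exp (- (b\<^sup>2 / 2)) * b ^ m / sqrt (fact m)"
  using real_sqrt_mult_self[of "fact m :: real"]
  by (simp add: charlier_def charlier_sum_def field_simps)

text \<open>Number operator conjugated by a displacement: the column recurrence leads from row m to
  row m - 1 and the row recurrence leads back. Row 0 has no predecessor and is treated apart. The
  off-diagonal entries are -b sqrt k; a twist by (-1)^k restores the sign of the Rabi
  matrix.\<close>

lemma charlier_eigen:
  "real k * charlier b m k - b * sqrt (real k) * charlier b m (k - 1)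
     - b * sqrt (real (Suc k)) * charlier b m (Suc k) = (real m - b\<^sup>2) * charlier b m k"
proof (cases m)
  case 0
  have "real k * charlier b 0 k - b * sqrt (real k) * charlier b 0 (k - 1)
      = sqrt (real k) * (sqrt (real k) * charlier b 0 k - b * charlier b 0 (k - 1))"
    by (simp add: algebra_simps)
  also have "\<dots> = 0"
    using charlier_Suc_right[of "k - 1" b 0] by (cases k) auto
  finally show ?thesis
    using charlier_Suc_right[of k b 0] 0 by (simp add: power2_eq_square)
next
  case (Suc n)
  have "real k * charlier b m k - b * sqrt (real k) * charlier b m (k - 1)
      = sqrt (real k) * (sqrt (real k) * charlier b m k - b * charlier b m (k - 1))"
    by (simp add: algebra_simps)
  also have "\<dots> = - (sqrt (real k) * (sqrt (real m) * charlier b n (k - 1)))"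
    using charlier_Suc_right[of "k - 1" b m] Suc by (cases k) auto
  finally have "real k * charlier b m k - b * sqrt (real k) * charlier b m (k - 1)
     - b * sqrt (real (Suc k)) * charlier b m (Suc k)
     = - (sqrt (real k) * (sqrt (real m) * charlier b n (k - 1)))
       - b * (b * charlier b m k - sqrt (real m) * charlier b n k)"
    using charlier_Suc_right[of k b m] Suc by (simp add: mult.assoc)
  also have "\<dots> = sqrt (real m) * (sqrt (real m) * charlier b m k) - b\<^sup>2 * charlier b m k"
    using arg_cong[OF charlier_Suc_left[of n b k], of "\<lambda>x. sqrt (real m) * x"] Suc
    by (simp add: algebra_simps power2_eq_square del: of_nat_Suc)
  finally show ?thesis by (simp add: algebra_simps)
qed

lemma sqrt_le_two_power: "sqrt (real m) \<le> 2 ^ m"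
proof -
  have "real m < 2 ^ m" by (rule of_nat_less_two_power)
  moreover have "sqrt (real m) \<le> real m \<or> m = 0"
    by (cases "m = 0") (auto intro!: real_le_lsqrt simp: power2_eq_square)
  ultimately show ?thesis by (elim disjE) (linarith, simp)
qed

text \<open>Row 0 decays like b^m / sqrt (m!). Each step in n costs a factor sqrt m <= 2^m, paid for
  by using the induction hypothesis with ratio r / 2; hence r is generalised in the
  induction.\<close>

lemma charlier_decay:
  assumes "0 < r" "r < 1"
  shows "\<exists>K\<ge>0. \<forall>m. \<bar>charlier b n m\<bar> \<le> K * r ^ m"
  using assms
proof (induction n arbitrary: r)
  case 0
  have "(\<lambda>m. ((b / r)\<^sup>2) ^ m / fact m) \<longlonglongrightarrow> 0"
    using summable_LIMSEQ_zero[OF summable_exp[of "(b / r)\<^sup>2"]] by (simp add: divide_inverse mult.commute)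
  then have "Bseq (\<lambda>m. ((b / r)\<^sup>2) ^ m / fact m)"
    by (intro convergent_imp_Bseq convergentI)
  then obtain K where K: "K > 0" "\<And>m. ((b / r)\<^sup>2) ^ m / fact m \<le> K"
    by (auto simp: Bseq_def)
  have "\<bar>charlier b 0 m\<bar> \<le> sqrt K * r ^ m" for m
  proof -
    have "(\<bar>b\<bar> ^ m / sqrt (fact m) / r ^ m)\<^sup>2 \<le> K"
      using K(2)[of m] by (simp add: power_divide power_mult_distrib power_mult[symmetric] mult.commute power_even_abs)
    then have "\<bar>b\<bar> ^ m / sqrt (fact m) / r ^ m \<le> sqrt K"
      by (rule real_le_rsqrt)
    then have "\<bar>b\<bar> ^ m / sqrt (fact m) \<le> sqrt K * r ^ m"
      using 0 by (simp add: pos_divide_le_eq mult_ac)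
    moreover have "\<bar>charlier b 0 m\<bar> = exp (- (b\<^sup>2 / 2)) * (\<bar>b\<bar> ^ m / sqrt (fact m))"
      by (simp add: charlier_0_left abs_mult power_abs)
    moreover have "exp (- (b\<^sup>2 / 2)) * (\<bar>b\<bar> ^ m / sqrt (fact m)) \<le> 1 * (\<bar>b\<bar> ^ m / sqrt (fact m))"
      by (intro mult_right_mono) auto
    ultimately show ?thesis by linarith
  qed
  then show ?case using K(1) by (intro exI[of _ "sqrt K"]) auto
next
  case (Suc n)
  obtain K where K: "K \<ge> 0" "\<And>m. \<bar>charlier b n m\<bar> \<le> K * (r / 2) ^ m"
    using Suc.IH[of "r / 2"] Suc.prems by auto
  have "\<bar>charlier b (Suc n) m\<bar> \<le> (\<bar>b\<bar> * K + 2 * K / r) * r ^ m" for m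
  proof -
    have 1: "\<bar>b * charlier b n m\<bar> \<le> \<bar>b\<bar> * K * r ^ m"
    proof -
      have "(r / 2) ^ m \<le> r ^ m" using Suc.prems by (intro power_mono) auto
      with K have "\<bar>charlier b n m\<bar> \<le> K * r ^ m"
        by (meson mult_left_mono order_trans)
      then show ?thesis by (simp add: abs_mult mult_left_mono mult.assoc)
    qed
    have 2: "\<bar>sqrt (real m) * charlier b n (m - 1)\<bar> \<le> 2 * K / r * r ^ m"
    proof (cases m)
      case (Suc k)
      have "\<bar>sqrt (real m) * charlier b n (m - 1)\<bar> \<le> 2 ^ m * (K * (r / 2) ^ k)"
        unfolding abs_mult using K(2)[of k] K(1) sqrt_le_two_power[of m] Suc
        by (intro mult_mono) auto
      also have "\<dots> = 2 * K / r * r ^ m"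
        using Suc.prems Suc by (simp add: power_divide field_simps)
      finally show ?thesis .
    qed (use K Suc.prems in simp)
    have "\<bar>charlier b (Suc n) m\<bar> \<le> sqrt (real (Suc n)) * \<bar>charlier b (Suc n) m\<bar>"
      by (intro mult_le_cancel_right1[THEN iffD2]) auto
    also have "\<dots> = \<bar>b * charlier b n m - sqrt (real m) * charlier b n (m - 1)\<bar>"
      unfolding charlier_Suc_left[symmetric] abs_mult by simp
    also have "\<dots> \<le> (\<bar>b\<bar> * K + 2 * K / r) * r ^ m"
      using 1 2 by (simp only: distrib_right)
    finally show ?thesis .
  qed
  then show ?case using K(1) Suc.prems
    by (intro exI[of _ "\<bar>b\<bar> * K + 2 * K / r"]) auto
qed

text \<open>Linear growth covers the unbounded factors k and sqrt k of the Jacobi matrix, so that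
  its terms can be summed separately against a Charlier row.\<close>

lemma charlier_summable_mult:
  assumes "\<And>k. \<bar>h k\<bar> \<le> M * real (Suc k)"
  shows "summable (\<lambda>k. charlier b n k * h k)"
proof -
  obtain K where K: "K \<ge> 0" "\<And>m. \<bar>charlier b n m\<bar> \<le> K * (1/4) ^ m"
    using charlier_decay[of "1/4" b n] by auto
  show ?thesis
  proof (rule summable_comparison_test')
    show "summable (\<lambda>k. 2 * K * M * (1/2) ^ k)"
      by (intro summable_mult summable_geometric) simp
    fix k :: nat
    have M: "M \<ge> 0" using assms[of 0] by simp
    have "real (Suc k) \<le> 2 * 2 ^ k"
      using of_nat_less_two_power[of k, where 'a=real] one_le_power[of "2::real" k]
      by (simp only: of_nat_Suc) linarith
    then have h: "\<bar>h k\<bar> \<le> M * (2 * 2 ^ k)"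
      using assms[of k] M by (meson mult_left_mono order_trans)
    have "norm (charlier b n k * h k) \<le> (K * (1/4) ^ k) * (M * (2 * 2 ^ k))"
      unfolding real_norm_def abs_mult using K h by (intro mult_mono) auto
    also have "(1/4) ^ k * 2 ^ k = (1/2 :: real) ^ k"
      by (simp flip: power_mult_distrib)
    then have "(K * (1/4) ^ k) * (M * (2 * 2 ^ k)) = 2 * K * M * (1/2) ^ k"
      by (simp add: mult_ac)
    finally show "norm (charlier b n k * h k) \<le> 2 * K * M * (1/2) ^ k" .
  qed
qed

lemma charlier_linear_bound: "\<exists>K. \<forall>m. \<bar>charlier b n m\<bar> \<le> K * real (Suc m)"
proof -
  obtain K where K: "K \<ge> 0" "\<And>m. \<bar>charlier b n m\<bar> \<le> K * (1/2) ^ m"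
    using charlier_decay[of "1/2" b n] by auto
  have "\<bar>charlier b n m\<bar> \<le> K * real (Suc m)" for m
  proof -
    have "K * (1/2) ^ m \<le> K * 1" "K * 1 \<le> K * real (Suc m)"
      using K(1) by (intro mult_left_mono power_le_one; simp)+
    then show ?thesis using K(2)[of m] by linarith
  qed
  then show ?thesis by blast
qed

lemma square_summable_charlier: "square_summable (charlier b n)"
proof -
  obtain K where "\<And>m. \<bar>charlier b n m\<bar> \<le> K * real (Suc m)"
    using charlier_linear_bound[of b n] by blast
  then show ?thesis
    unfolding power2_eq_square by (rule charlier_summable_mult)
qed

section \<open>Orthogonality and parity kernel of the Charlier functions\<close>

lemma symmetric_recurrence_unique:
  fixes F G :: "nat \<Rightarrow> nat \<Rightarrow> real"
  assumes "\<And>n m. F n m = F m n" "\<And>n m. G n m = G m n"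
    and "\<And>n m. sqrt (real (Suc n)) * F (Suc n) m = p * F n m + q * sqrt (real m) * F n (m - 1)"
    and "\<And>n m. sqrt (real (Suc n)) * G (Suc n) m = p * G n m + q * sqrt (real m) * G n (m - 1)"
    and "F 0 0 = G 0 0"
  shows "F n m = G n m"
proof (induction n arbitrary: m)
  case 0
  have "F m 0 = G m 0" for m
  proof (induction m)
    case (Suc m)
    have "sqrt (real (Suc m)) * F (Suc m) 0 = sqrt (real (Suc m)) * G (Suc m) 0"
      unfolding assms(3,4) Suc by simp
    then show ?case by simp
  qed (rule assms)
  then show ?case using assms(1,2) by metis
next
  case (Suc n)
  have "sqrt (real (Suc n)) * F (Suc n) m = sqrt (real (Suc n)) * G (Suc n) m"
    unfolding assms(3,4) Suc by simp
  then show ?case by simp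
qed

text \<open>One computation for two products: sigma = 1 gives orthonormality, sigma = -1 the matrix
  of the parity. The row recurrence acts on the first factor, an index shift costs a factor
  \<open>\<sigma>\<close>, and the column recurrence then acts on the second factor.\<close>

lemma charlier_signed_product_Suc:
  fixes \<sigma> b :: real
  assumes \<sigma>: "\<sigma> = 1 \<or> \<sigma> = -1"
  defines "S \<equiv> \<lambda>n m. \<Sum>k. \<sigma> ^ k * charlier b n k * charlier b m k"
  shows "sqrt (real (Suc n)) * S (Suc n) m = (1 - \<sigma>) * b * S n m + \<sigma> * sqrt (real m) * S n (m - 1)"
proof -
  have S: "(\<lambda>k. \<sigma> ^ k * charlier b n k * charlier b m k) sums S n m" for n m
  proof -
    obtain K where K: "\<And>k. \<bar>charlier b m k\<bar> \<le> K * real (Suc k)"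
      using charlier_linear_bound[of b m] by blast
    have "\<bar>\<sigma> ^ k * charlier b m k\<bar> \<le> K * real (Suc k)" for k
      using K[of k] \<sigma> by (auto simp: abs_mult power_abs)
    then have "summable (\<lambda>k. charlier b n k * (\<sigma> ^ k * charlier b m k))"
      by (rule charlier_summable_mult)
    then have "summable (\<lambda>k. \<sigma> ^ k * charlier b n k * charlier b m k)"
      by (simp add: mult.left_commute mult.assoc)
    then show ?thesis unfolding S_def by (rule summable_sums)
  qed
  \<comment> \<open>\<open>w 0\<close> vanishes through sqrt 0, so the shifted series has the same
    sum.\<close>
  define w where "w k = \<sigma> ^ k * (sqrt (real k) * charlier b n (k - 1)) * charlier b m k" for k
  have w_Suc: "w (Suc k) = \<sigma> * (b * (\<sigma> ^ k * charlier b n k * charlier b m k)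
      - sqrt (real m) * (\<sigma> ^ k * charlier b n k * charlier b (m - 1) k))" for k
  proof -
    have "w (Suc k) = \<sigma> * (\<sigma> ^ k * charlier b n k * (sqrt (real (Suc k)) * charlier b m (Suc k)))"
      by (simp add: w_def del: of_nat_Suc)
    then show ?thesis
      unfolding charlier_Suc_right by (simp add: algebra_simps)
  qed
  have "(\<lambda>k. w (Suc k)) sums (\<sigma> * (b * S n m - sqrt (real m) * S n (m - 1)))"
    unfolding w_Suc by (intro sums_mult sums_diff S)
  then have "w sums (\<sigma> * (b * S n m - sqrt (real m) * S n (m - 1)))"
    using sums_Suc[of w] by (simp add: w_def)
  then have "(\<lambda>k. b * (\<sigma> ^ k * charlier b n k * charlier b m k) - w k)
      sums (b * S n m - \<sigma> * (b * S n m - sqrt (real m) * S n (m - 1)))"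
    by (intro sums_mult sums_diff S)
  moreover have "b * (\<sigma> ^ k * charlier b n k * charlier b m k) - w k
      = sqrt (real (Suc n)) * (\<sigma> ^ k * charlier b (Suc n) k * charlier b m k)" for k
  proof -
    have "b * (\<sigma> ^ k * charlier b n k * charlier b m k) - w k
      = \<sigma> ^ k * (b * charlier b n k - sqrt (real k) * charlier b n (k - 1)) * charlier b m k"
      unfolding w_def by (simp add: algebra_simps)
    also have "\<dots> = sqrt (real (Suc n)) * (\<sigma> ^ k * charlier b (Suc n) k * charlier b m k)"
      unfolding charlier_Suc_left[symmetric] by (simp del: of_nat_Suc)
    finally show ?thesis .
  qed
  ultimately have "(\<lambda>k. sqrt (real (Suc n)) * (\<sigma> ^ k * charlier b (Suc n) k * charlier b m k))
      sums (b * S n m - \<sigma> * (b * S n m - sqrt (real m) * S n (m - 1)))"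
    by simp
  from sums_unique2[OF sums_mult[OF S] this] show ?thesis
    by (simp add: algebra_simps del: of_nat_Suc)
qed

lemma charlier_signed_product_00:
  fixes \<sigma> b :: real
  shows "(\<Sum>k. \<sigma> ^ k * charlier b 0 k * charlier b 0 k) = exp (\<sigma> * b\<^sup>2 - b\<^sup>2)"
proof -
  have "\<sigma> ^ k * charlier b 0 k * charlier b 0 k = exp (- b\<^sup>2) * ((\<sigma> * b\<^sup>2) ^ k /\<^sub>R fact k)" for k
  proof -
    have "\<sigma> ^ k * charlier b 0 k * charlier b 0 k
        = (exp (- (b\<^sup>2 / 2)) * exp (- (b\<^sup>2 / 2))) * \<sigma> ^ k * (b ^ k * b ^ k) / (sqrt (fact k) * sqrt (fact k))"
      by (simp add: charlier_0_left mult_ac)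
    also have "exp (- (b\<^sup>2 / 2)) * exp (- (b\<^sup>2 / 2)) = exp (- b\<^sup>2)"
      by (simp flip: exp_add)
    finally show ?thesis
      by (simp add: power_mult_distrib power2_eq_square divide_inverse mult_ac)
  qed
  moreover have "(\<lambda>k. (\<sigma> * b\<^sup>2) ^ k /\<^sub>R fact k) sums exp (\<sigma> * b\<^sup>2)"
    by (rule exp_converges)
  ultimately have "(\<lambda>k. \<sigma> ^ k * charlier b 0 k * charlier b 0 k) sums (exp (- b\<^sup>2) * exp (\<sigma> * b\<^sup>2))"
    by (simp add: sums_mult)
  then show ?thesis by (simp add: sums_iff exp_add[symmetric])
qed

lemma charlier_orthonormal: "(\<Sum>k. charlier b n k * charlier b m k) = of_bool (n = m)"
proof -
  have "(\<Sum>k. 1 ^ k * charlier b n k * charlier b m k) = of_bool (n = m)"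
  proof (rule symmetric_recurrence_unique[where p = 0 and q = 1])
    show "sqrt (real (Suc n)) * (\<Sum>k. 1 ^ k * charlier b (Suc n) k * charlier b m k)
        = 0 * (\<Sum>k. 1 ^ k * charlier b n k * charlier b m k)
          + 1 * sqrt (real m) * (\<Sum>k. 1 ^ k * charlier b n k * charlier b (m - 1) k)" for n m
      using charlier_signed_product_Suc[of 1 n b m] by simp
    show "(\<Sum>k. 1 ^ k * charlier b 0 k * charlier b 0 k) = of_bool ((0::nat) = 0)"
      by (subst charlier_signed_product_00) simp
  qed (auto simp: mult.commute)
  then show ?thesis by simp
qed

text \<open>This is C P C = D(2b) P in terms of displacement and parity. It is proved by uniqueness:
  both sides are symmetric, obey the same recurrence in n and equal exp (-2 b^2) at (0, 0).\<close>

lemma charlier_alternating_product: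
  "(\<Sum>k. (-1) ^ k * charlier b n k * charlier b m k) = charlier (2 * b) n m"
proof (rule symmetric_recurrence_unique[where p = "2 * b" and q = "-1"])
  show "sqrt (real (Suc n)) * (\<Sum>k. (-1) ^ k * charlier b (Suc n) k * charlier b m k)
      = 2 * b * (\<Sum>k. (-1) ^ k * charlier b n k * charlier b m k)
        + (-1) * sqrt (real m) * (\<Sum>k. (-1) ^ k * charlier b n k * charlier b (m - 1) k)" for n m
    using charlier_signed_product_Suc[of "-1" n b m] by simp
  show "sqrt (real (Suc n)) * charlier (2 * b) (Suc n) m
      = 2 * b * charlier (2 * b) n m + (-1) * sqrt (real m) * charlier (2 * b) n (m - 1)" for n m
    by (simp add: charlier_Suc_left del: of_nat_Suc)
  show "(\<Sum>k. (-1) ^ k * charlier b 0 k * charlier b 0 k) = charlier (2 * b) 0 0"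
    by (subst charlier_signed_product_00) (simp add: charlier_0_left power2_eq_square)
  show "charlier (2 * b) n m = charlier (2 * b) m n" for n m
    by (rule charlier_commute)
qed (simp add: mult.commute mult.left_commute)

interpretation charlier: symmetric_orthonormal "charlier b" for b
  by unfold_locales (rule charlier_commute square_summable_charlier charlier_orthonormal)+

text \<open>Reversing the order of summation produces the Laguerre polynomial at b^2; the reversal
  is the source of the sign (-1)^n.\<close>

lemma charlier_diagonal:
  "charlier b n n = (-1) ^ n * exp (- (b\<^sup>2 / 2)) * (\<Sum>i\<le>n. (-1) ^ i * real (n choose i) * (b\<^sup>2) ^ i / fact i)"
proof -
  have "fact n * charlier_sum b n n = fact n * (\<Sum>i\<le>n. (-1) ^ (n - i) * b ^ (n + n - 2 * (n - i))
      / (fact (n - i) * fact (n - (n - i)) * fact (n - (n - i))))"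
    unfolding charlier_sum_def min.idem
    by (intro arg_cong[where f = "\<lambda>x. fact n * x"], rule sum.reindex_bij_witness[of _ "\<lambda>i. n - i" "\<lambda>i. n - i"]) auto
  also have "\<dots> = (-1) ^ n * (\<Sum>i\<le>n. (-1) ^ i * real (n choose i) * (b\<^sup>2) ^ i / fact i)"
    unfolding sum_distrib_left
  proof (intro sum.cong refl)
    fix i assume i: "i \<in> {..n}"
    then have diff: "n - (n - i) = i" "n + n - 2 * (n - i) = 2 * i" by auto
    have "(-1) ^ n = (-1) ^ (n - i) * (-1 :: real) ^ i"
      using i by (simp flip: power_add)
    then have "(-1) ^ (n - i) = (-1) ^ n * (-1 :: real) ^ i"
      by (simp flip: power_mult_distrib)
    then show "fact n * ((-1) ^ (n - i) * b ^ (n + n - 2 * (n - i))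
        / (fact (n - i) * fact (n - (n - i)) * fact (n - (n - i))))
        = (-1) ^ n * ((-1) ^ i * real (n choose i) * (b\<^sup>2) ^ i / fact i)"
      unfolding diff power_mult[of b 2 i] using i by (simp add: binomial_fact mult_ac)
  qed
  finally have "fact n * charlier_sum b n n = (-1) ^ n * (\<Sum>i\<le>n. (-1) ^ i * real (n choose i) * (b\<^sup>2) ^ i / fact i)" .
  moreover have "charlier b n n = exp (- (b\<^sup>2 / 2)) * (fact n * charlier_sum b n n)"
    by (simp add: charlier_def)
  ultimately show ?thesis by simp
qed

text \<open>The hypothesis says |lam k| <= sqrt k, half the threshold 2 sqrt k below which the form
  \<open>Q\<close> is positive definite, so k is well inside the oscillatory region and Q k >= sqrt
  k / 2 * (f k)^2. On the other side \<open>Q\<close> has bounded total variation, because the row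
  has norm 1 and the coefficients sqrt k and lam k change by at most 1 and 1 / B per step.\<close>

lemma charlier_offdiag_bound:
  assumes B: "B > 0" and near: "\<bar>real k - real n + B\<^sup>2\<bar> \<le> B * sqrt (real k)"
  shows "(charlier B n k)\<^sup>2 * sqrt (real k) \<le> 2 * (2 + 1 / B)"
proof -
  define f where "f = charlier B n"
  define b where "b k = sqrt (real k)" for k
  define lam where "lam k = (real k - real n + B\<^sup>2) / B" for k
  define h where "h k = (if k = 0 then 0 else f (k - 1))" for k
  text \<open>The quadratic form \<open>Q\<close> is almost conserved by the three-term recurrence of a row.\<close>
  define Q where "Q k = b k * ((f k)\<^sup>2 + (h k)\<^sup>2) - lam k * f k * h k" for k
  have rec: "lam k * f k = b k * h k + b (Suc k) * f (Suc k)" for k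
    using charlier_eigen[of k B n] B unfolding lam_def f_def b_def h_def
    by (cases "k = 0") (simp_all add: field_simps power2_eq_square del: of_nat_Suc)
  have h_Suc: "h (Suc k) = f k" for k by (simp add: h_def)
  have lam_Suc: "lam (Suc k) = lam k + 1 / B" for k
    by (simp add: lam_def add_divide_distrib diff_divide_distrib)
  have ff: "square_summable f" "(\<Sum>k. (f k)\<^sup>2) = 1"
    using square_summable_charlier charlier_orthonormal[of B n n]
    by (auto simp: f_def power2_eq_square)
  have sq2: "(\<Sum>j<k. (f j)\<^sup>2) \<le> 1" for k
    using sum_le_suminf[OF ff(1), of "{..<k}"] ff(2) by simp
  have Q_Suc: "Q (Suc k) - Q k = (b (Suc k) - b k) * ((f k)\<^sup>2 + h k * f (Suc k))
      - (1 / B) * f k * f (Suc k)" for k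
  proof -
    have "Q (Suc k) - Q k = b (Suc k) * ((f (Suc k))\<^sup>2 + (f k)\<^sup>2)
       - (lam k * f k) * f (Suc k) - (1 / B) * f k * f (Suc k)
       - b k * ((f k)\<^sup>2 + (h k)\<^sup>2) + (lam k * f k) * h k"
      by (simp add: Q_def lam_Suc h_Suc algebra_simps)
    also have "\<dots> = (b (Suc k) - b k) * ((f k)\<^sup>2 + h k * f (Suc k))
      - (1 / B) * f k * f (Suc k)"
      unfolding rec by (simp add: algebra_simps power2_eq_square)
    finally show ?thesis .
  qed
  have b_diff: "0 \<le> b (Suc k) - b k" "b (Suc k) - b k \<le> 1" for k
  proof -
    show "0 \<le> b (Suc k) - b k" by (simp add: b_def)
    have "sqrt (real k + 1) \<le> sqrt (real k) + sqrt 1" by (rule sqrt_add_le_add_sqrt) auto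
    then show "b (Suc k) - b k \<le> 1" by (simp add: b_def add.commute)
  qed
  have prod: "\<bar>x * y\<bar> \<le> (x\<^sup>2 + y\<^sup>2) / 2" for x y :: real
    using sum_squares_bound[of x y] sum_squares_bound[of x "-y"] by (auto simp: abs_if)
  have step: "\<bar>Q (Suc k) - Q k\<bar> \<le> (f k)\<^sup>2 + ((h k)\<^sup>2 + (f (Suc k))\<^sup>2) / 2
       + (1 / B) * (((f k)\<^sup>2 + (f (Suc k))\<^sup>2) / 2)" for k
  proof -
    have "\<bar>Q (Suc k) - Q k\<bar> \<le> \<bar>(b (Suc k) - b k) * ((f k)\<^sup>2 + h k * f (Suc k))\<bar>
        + \<bar>(1 / B) * f k * f (Suc k)\<bar>"
      unfolding Q_Suc by (rule abs_triangle_ineq4)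
    moreover have "\<bar>(b (Suc k) - b k) * ((f k)\<^sup>2 + h k * f (Suc k))\<bar>
        \<le> 1 * ((f k)\<^sup>2 + ((h k)\<^sup>2 + (f (Suc k))\<^sup>2) / 2)"
    proof -
      have "\<bar>(f k)\<^sup>2 + h k * f (Suc k)\<bar> \<le> (f k)\<^sup>2 + ((h k)\<^sup>2 + (f (Suc k))\<^sup>2) / 2"
        using prod[of "h k" "f (Suc k)"] abs_triangle_ineq[of "(f k)\<^sup>2" "h k * f (Suc k)"]
          abs_of_nonneg[OF zero_le_power2[of "f k"]] by linarith
      then show ?thesis unfolding abs_mult using b_diff[of k] by (intro mult_mono) auto
    qed
    moreover have "\<bar>(1 / B) * f k * f (Suc k)\<bar> \<le> (1 / B) * (((f k)\<^sup>2 + (f (Suc k))\<^sup>2) / 2)"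
      using mult_left_mono[OF prod[of "f k" "f (Suc k)"], of "1 / B"] B by (simp add: abs_mult)
    ultimately show ?thesis by (simp only: mult_1)
  qed
  have sum_h: "(\<Sum>j<k. (h j)\<^sup>2) \<le> 1" for k
  proof (cases k)
    case (Suc l)
    have "(\<Sum>j<k. (h j)\<^sup>2) = (\<Sum>j<l. (f j)\<^sup>2)"
      unfolding Suc by (subst sum.lessThan_Suc_shift) (simp add: h_def)
    then show ?thesis using sq2[of l] by simp
  qed simp
  have sum_f_Suc: "(\<Sum>j<k. (f (Suc j))\<^sup>2) \<le> 1" for k
    using sum.lessThan_Suc_shift[of "\<lambda>j. (f j)\<^sup>2" k] sq2[of "Suc k"] zero_le_power2[of "f 0"] by linarith
  have Q_bound: "\<bar>Q k\<bar> \<le> 2 + 1 / B"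
  proof -
    \<comment> \<open>Telescoping starts at Q 0 = 0, as sqrt 0 and h 0 vanish. Each square sum below
      is at most 1, which gives 1 + 1 + 1 / B.\<close>
    have "Q k = (\<Sum>j<k. Q (Suc j) - Q j)"
      by (subst sum_lessThan_telescope) (simp add: Q_def b_def h_def)
    also have "\<bar>\<dots>\<bar> \<le> (\<Sum>j<k. (f j)\<^sup>2 + ((h j)\<^sup>2 + (f (Suc j))\<^sup>2) / 2
       + (1 / B) * (((f j)\<^sup>2 + (f (Suc j))\<^sup>2) / 2))"
      by (rule order_trans[OF sum_abs sum_mono[OF step]])
    also have "\<dots> = (\<Sum>j<k. (f j)\<^sup>2) + ((\<Sum>j<k. (h j)\<^sup>2) + (\<Sum>j<k. (f (Suc j))\<^sup>2)) / 2
       + (1 / B) * (((\<Sum>j<k. (f j)\<^sup>2) + (\<Sum>j<k. (f (Suc j))\<^sup>2)) / 2)"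
      by (simp only: sum.distrib sum_divide_distrib[symmetric] sum_distrib_left[symmetric])
    also have "\<dots> \<le> 1 + (1 + 1) / 2 + (1 / B) * ((1 + 1) / 2)"
      using B by (intro add_mono divide_right_mono mult_left_mono sum_h sum_f_Suc sq2) auto
    finally show ?thesis by simp
  qed
  have "\<bar>lam k\<bar> \<le> b k"
    using near B by (simp add: lam_def b_def pos_divide_le_eq mult.commute)
  then have "\<bar>lam k * (f k * h k)\<bar> \<le> b k * (((f k)\<^sup>2 + (h k)\<^sup>2) / 2)"
    unfolding abs_mult[of "lam k"] by (intro mult_mono prod) (auto simp: b_def)
  moreover have "b k * (f k)\<^sup>2 \<le> b k * ((f k)\<^sup>2 + (h k)\<^sup>2)"
    by (intro mult_left_mono) (auto simp: b_def)
  moreover have "b k * ((f k)\<^sup>2 + (h k)\<^sup>2) = Q k + lam k * (f k * h k)"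
    by (simp add: Q_def)
  ultimately have "b k * (f k)\<^sup>2 \<le> 2 * (2 + 1 / B)"
    using abs_le_D1[OF Q_bound] by (simp only: abs_le_iff) argo
  then show ?thesis by (simp add: f_def b_def mult.commute)
qed

section \<open>Laguerre polynomials and the WKB approximation\<close>

text \<open>Variation of constants: \<open>a\<close> and \<open>b\<close> are the amplitudes of cos
  and sin in q, and the term y^2 q, seen as a perturbation of q'' = - mu^2 q, makes them drift by at
  most Y^3 sup |q| / mu.\<close>

lemma wkb_bound:
  fixes q q' :: "real \<Rightarrow> real"
  assumes q: "\<And>y. (q has_real_derivative q' y) (at y)"
    and q': "\<And>y. (q' has_real_derivative (y\<^sup>2 - \<mu>\<^sup>2) * q y) (at y)"
    and init: "q 0 = 1" "q' 0 = 0"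
    and \<mu>: "\<mu> > 0" "4 * Y ^ 3 \<le> \<mu>" and y: "y \<in> {0..Y}"
  shows "\<bar>q y - cos (\<mu> * y)\<bar> \<le> 4 * Y ^ 3 / \<mu>"
proof -
  define a where "a y = q y * cos (\<mu> * y) - q' y * sin (\<mu> * y) / \<mu>" for y
  define b where "b y = q y * sin (\<mu> * y) + q' y * cos (\<mu> * y) / \<mu>" for y
  have Y: "Y \<ge> 0" using y by simp
  have a': "(a has_real_derivative - (sin (\<mu> * y) * y\<^sup>2 * q y / \<mu>)) (at y)" for y
    unfolding a_def using \<mu>
    by (auto intro!: derivative_eq_intros q q' simp: field_simps power2_eq_square)
  have b': "(b has_real_derivative cos (\<mu> * y) * y\<^sup>2 * q y / \<mu>) (at y)" for y
    unfolding b_def using \<mu>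
    by (auto intro!: derivative_eq_intros q q' simp: field_simps power2_eq_square)
  have q_eq: "q y = a y * cos (\<mu> * y) + b y * sin (\<mu> * y)" for y
    by (simp add: a_def b_def algebra_simps) (simp flip: distrib_left)
  have "continuous_on {0..Y} (\<lambda>y. \<bar>q y\<bar>)"
    by (intro continuous_on_rabs DERIV_continuous_on[OF DERIV_subset[OF q]]) auto
  then obtain y0 where y0: "y0 \<in> {0..Y}" "\<And>y. y \<in> {0..Y} \<Longrightarrow> \<bar>q y\<bar> \<le> \<bar>q y0\<bar>"
    using continuous_attains_sup[of "{0..Y}" "\<lambda>y. \<bar>q y\<bar>"] Y by auto
  define K where "K = \<bar>q y0\<bar>"
  have bound: "\<bar>f y - f 0\<bar> \<le> Y ^ 3 * K / \<mu>"
    if f: "\<And>y. (f has_real_derivative r y * y\<^sup>2 * q y / \<mu>) (at y)" and r: "\<And>y. \<bar>r y\<bar> \<le> 1"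
      and y: "y \<in> {0..Y}" for f r y
  proof (cases "y = 0")
    case True
    then show ?thesis using Y \<mu> by (simp add: K_def)
  next
    case False
    then have "0 < y" using y by simp
    then obtain z where z: "0 < z" "z < y" "f y - f 0 = (y - 0) * (r z * z\<^sup>2 * q z / \<mu>)"
      using MVT2[OF \<open>0 < y\<close>, of f "\<lambda>z. r z * z\<^sup>2 * q z / \<mu>"] f by auto
    have "\<bar>f y - f 0\<bar> = y * (\<bar>r z\<bar> * z\<^sup>2 * \<bar>q z\<bar>) / \<mu>"
      using z(3) \<open>0 < y\<close> \<mu> by (simp add: abs_mult)
    also have "\<dots> \<le> Y * (1 * Y\<^sup>2 * K) / \<mu>"
      using z y y0(2)[of z] r[of z] \<mu> unfolding K_def
      by (intro divide_right_mono mult_mono power_mono) auto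
    also have "\<dots> = Y ^ 3 * K / \<mu>" by (simp add: power3_eq_cube power2_eq_square)
    finally show ?thesis .
  qed
  define e where "e = Y ^ 3 * K / \<mu>"
  have a_b: "\<bar>a y - 1\<bar> \<le> e" "\<bar>b y\<bar> \<le> e" if "y \<in> {0..Y}" for y
    using bound[of a "\<lambda>y. - sin (\<mu> * y)" y] bound[of b "\<lambda>y. cos (\<mu> * y)" y] a' b' that
    by (auto simp: a_def b_def init e_def)
  have diff: "\<bar>q y - cos (\<mu> * y)\<bar> \<le> 2 * e" if "y \<in> {0..Y}" for y
  proof -
    have "q y - cos (\<mu> * y) = (a y - 1) * cos (\<mu> * y) + b y * sin (\<mu> * y)"
      by (subst q_eq) (simp add: algebra_simps)
    also have "\<bar>\<dots>\<bar> \<le> \<bar>a y - 1\<bar> * 1 + \<bar>b y\<bar> * 1"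
      by (rule order_trans[OF abs_triangle_ineq]) (auto simp: abs_mult intro!: add_mono mult_left_mono mult_left_le)
    finally show ?thesis using a_b[OF that] by simp
  qed
  \<comment> \<open>The supremum K bounds itself: the deviation from the cosine is at most 2 e <= K
    / 2, so K <= 1 + K / 2 and K <= 2.\<close>
  have Y3: "e \<le> K / 4"
    using \<mu> mult_right_mono[OF \<mu>(2), of K] by (simp add: K_def e_def field_simps)
  have "K \<le> 2"
    using diff[OF y0(1)] Y3 abs_cos_le_one[of "\<mu> * y0"] unfolding K_def by linarith
  then have "2 * e \<le> 2 * (Y ^ 3 * 2 / \<mu>)"
    unfolding e_def using \<mu> Y by (intro mult_left_mono divide_right_mono) auto
  then show ?thesis using diff[OF y] by simp
qed

text \<open>The even Hermite polynomial of degree \<open>2 * n\<close>, normalised by the value 1 at 0.\<close>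

definition even_hermite_coeff :: "nat \<Rightarrow> nat \<Rightarrow> real" where
  "even_hermite_coeff n i = (-1) ^ i * real (n choose i) * 4 ^ i * fact i / fact (2 * i)"

definition even_hermite :: "nat \<Rightarrow> real \<Rightarrow> real" where
  "even_hermite n y = (\<Sum>i\<le>n. even_hermite_coeff n i * y ^ (2 * i))"

text \<open>Coefficient form of Hermite's equation f'' = 2 y f' - 4 n f.\<close>

lemma even_hermite_coeff_Suc:
  assumes "i < n"
  shows "real (2 * i + 2) * real (2 * i + 1) * even_hermite_coeff n (Suc i)
     = (4 * real i - 4 * real n) * even_hermite_coeff n i"
proof -
  have "real (Suc i * (n choose Suc i)) = real ((n - i) * (n choose i))"
    using binomial_absorb_comp[of n i] binomial_absorption[of i "n - 1"] assms
    by (metis binomial_absorption binomial_absorb_comp mult.commute Suc_pred' gr_implies_not0 not_gr_zero)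
  then have choose: "real (Suc i) * real (n choose Suc i) = (real n - real i) * real (n choose i)"
    using assms by (simp only: of_nat_mult of_nat_diff less_imp_le)
  have fact2: "fact (2 * Suc i) = real (2 * i + 2) * real (2 * i + 1) * fact (2 * i)"
    by (simp add: algebra_simps)
  have "real (2 * i + 2) * real (2 * i + 1) * even_hermite_coeff n (Suc i)
      = (-1) ^ Suc i * 4 ^ Suc i * (real (Suc i) * real (n choose Suc i)) * fact i / fact (2 * i)"
    unfolding even_hermite_coeff_def fact2 fact_Suc by (simp del: of_nat_Suc of_nat_add of_nat_mult)
  also have "\<dots> = (4 * real i - 4 * real n) * even_hermite_coeff n i"
    unfolding choose even_hermite_coeff_def by (simp add: algebra_simps)
  finally show ?thesis .
qed

text \<open>At i = 0 the truncated exponent is harmless, since the factor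
  \<open>real (2 * i)\<close> vanishes.\<close>

definition even_hermite' :: "nat \<Rightarrow> real \<Rightarrow> real" where
  "even_hermite' n y = (\<Sum>i\<le>n. even_hermite_coeff n i * (real (2 * i) * y ^ (2 * i - 1)))"

lemma has_derivative_even_hermite:
  "(even_hermite n has_real_derivative even_hermite' n y) (at y)"
  unfolding even_hermite_def even_hermite'_def
  by (auto intro!: derivative_eq_intros sum.cong)

lemma has_derivative_even_hermite':
  "(even_hermite' n has_real_derivative 2 * y * even_hermite' n y - 4 * real n * even_hermite n y) (at y)"
proof -
  define c where "c = even_hermite_coeff n"
  have "(even_hermite' n has_real_derivative
      (\<Sum>i\<le>n. c i * (real (2 * i) * (real (2 * i - 1) * y ^ (2 * i - 1 - 1))))) (at y)"
    unfolding even_hermite'_def c_def by (auto intro!: derivative_eq_intros sum.cong)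
  moreover have "(\<Sum>i\<le>n. c i * (real (2 * i) * (real (2 * i - 1) * y ^ (2 * i - 1 - 1))))
      = (\<Sum>i<n. (4 * real i - 4 * real n) * c i * y ^ (2 * i))"
  proof -
    have "(\<Sum>i\<le>n. c i * (real (2 * i) * (real (2 * i - 1) * y ^ (2 * i - 1 - 1))))
        = (\<Sum>i<n. c (Suc i) * (real (2 * Suc i) * (real (2 * Suc i - 1) * y ^ (2 * Suc i - 1 - 1))))"
      by (subst lessThan_Suc_atMost[symmetric], subst sum.lessThan_Suc_shift) simp
    also have "\<dots> = (\<Sum>i<n. (4 * real i - 4 * real n) * c i * y ^ (2 * i))"
      unfolding c_def
      by (intro sum.cong refl, subst even_hermite_coeff_Suc[symmetric]) (auto simp: algebra_simps)
    finally show ?thesis .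
  qed
  moreover have "\<dots> = (\<Sum>i\<le>n. (4 * real i - 4 * real n) * c i * y ^ (2 * i))"
    by (simp flip: lessThan_Suc_atMost)
  moreover have "\<dots> = 2 * y * even_hermite' n y - 4 * real n * even_hermite n y"
    unfolding even_hermite_def even_hermite'_def c_def[symmetric] sum_distrib_left sum_subtractf[symmetric]
  proof (intro sum.cong refl)
    fix i
    show "(4 * real i - 4 * real n) * c i * y ^ (2 * i)
        = 2 * y * (c i * (real (2 * i) * y ^ (2 * i - 1))) - 4 * real n * (c i * y ^ (2 * i))"
      by (cases i) (simp_all add: algebra_simps)
  qed
  ultimately show ?thesis by simp
qed

text \<open>The factor exp (-y^2 / 2) removes the first-order term of Hermite's equation and leaves
  the oscillator equation with mu^2 = 4 n + 1; evenness and the normalisation give the initial data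
  1 and 0.\<close>

lemma even_hermite_wkb:
  assumes "4 * Y ^ 3 \<le> sqrt (4 * real n + 1)" "y \<in> {0..Y}"
  shows "\<bar>even_hermite n y - exp (y\<^sup>2 / 2) * cos (sqrt (4 * real n + 1) * y)\<bar>
     \<le> exp (Y\<^sup>2 / 2) * (4 * Y ^ 3 / sqrt (4 * real n + 1))"
proof -
  define q where "q y = exp (- (y\<^sup>2 / 2)) * even_hermite n y" for y
  define q' where "q' y = exp (- (y\<^sup>2 / 2)) * (even_hermite' n y - y * even_hermite n y)" for y
  have q: "(q has_real_derivative q' y) (at y)" for y
    unfolding q_def q'_def
    by (auto intro!: derivative_eq_intros has_derivative_even_hermite simp: algebra_simps)
  have q': "(q' has_real_derivative (y\<^sup>2 - (sqrt (4 * real n + 1))\<^sup>2) * q y) (at y)" for y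
    unfolding q_def q'_def
    by (auto intro!: derivative_eq_intros has_derivative_even_hermite has_derivative_even_hermite'
        simp: algebra_simps power2_eq_square)
  have "even_hermite n 0 = 1"
    unfolding even_hermite_def by (subst sum.remove[of _ 0]) (auto simp: even_hermite_coeff_def power_0_left)
  moreover have "even_hermite' n 0 = 0"
    unfolding even_hermite'_def by (intro sum.neutral) (auto simp: power_0_left)
  ultimately have "\<bar>q y - cos (sqrt (4 * real n + 1) * y)\<bar> \<le> 4 * Y ^ 3 / sqrt (4 * real n + 1)"
    using assms by (intro wkb_bound[OF q q']) (auto simp: q_def q'_def)
  then have "exp (y\<^sup>2 / 2) * \<bar>q y - cos (sqrt (4 * real n + 1) * y)\<bar>
      \<le> exp (Y\<^sup>2 / 2) * (4 * Y ^ 3 / sqrt (4 * real n + 1))"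
    using assms(2) by (intro mult_mono) (auto intro: power_mono)
  moreover have "exp (y\<^sup>2 / 2) * \<bar>q y - cos (sqrt (4 * real n + 1) * y)\<bar>
     = \<bar>exp (y\<^sup>2 / 2) * q y - exp (y\<^sup>2 / 2) * cos (sqrt (4 * real n + 1) * y)\<bar>"
    by (simp add: abs_mult flip: right_diff_distrib)
  moreover have "exp (y\<^sup>2 / 2) * q y = even_hermite n y"
    by (simp add: q_def exp_minus)
  ultimately show ?thesis by simp
qed

text \<open>With \<open>cos \<theta> = 1 - v\<^sup>2\<close> one has \<open>d\<theta> = 2 / sqrt (2 - v\<^sup>2) dv\<close>, so this is the Wallis
  integral of \<open>cos \<theta> ^ (2 * i)\<close> over \<open>[0, \<pi> / 2]\<close>. The variable \<open>v\<close> turns the stationary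
  point at \<open>\<theta> = 0\<close> of the phase \<open>cos \<theta>\<close> into a purely quadratic one.\<close>

lemma wallis_integral:
  "((\<lambda>v. (1 - v\<^sup>2) ^ (2 * i) * (2 / sqrt (2 - v\<^sup>2))) has_integral
     (pi / 2 * fact (2 * i) / (4 ^ i * (fact i)\<^sup>2))) {0..1::real}"
proof (induction i)
  have pos: "2 - v\<^sup>2 > 0" if "v \<in> {0..1}" for v :: real
    using power_le_one[of v 2] that by auto
  {
    case 0
    \<comment> \<open>From v^2 = 1 - cos theta = 2 sin^2 (theta / 2), the primitive 2 arcsin (v /
      sqrt 2) is theta itself.\<close>
    have "((\<lambda>v. 2 / sqrt (2 - v\<^sup>2)) has_integral (2 * arcsin (1 / sqrt 2) - 2 * arcsin (0 / sqrt 2))) {0..1::real}"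
    proof (rule fundamental_theorem_of_calculus)
      fix v :: real assume v: "v \<in> {0..1}"
      have lt: "-1 < v / sqrt 2" "v / sqrt 2 < 1"
        using v by (auto simp: divide_simps intro: le_less_trans[of v 1] less_le_trans[of _ 0])
      have "sqrt (1 - (v / sqrt 2)\<^sup>2) * sqrt 2 = sqrt (2 - v\<^sup>2)"
        by (simp add: real_sqrt_mult[symmetric] power_divide field_simps)
      then have eq: "inverse (sqrt (1 - (v / sqrt 2)\<^sup>2)) * (1 / sqrt 2) = 1 / sqrt (2 - v\<^sup>2)"
        by (simp add: divide_inverse flip: inverse_mult_distrib)
      have "((\<lambda>v. 2 * arcsin (v / sqrt 2)) has_real_derivative
          2 * (inverse (sqrt (1 - (v / sqrt 2)\<^sup>2)) * (1 / sqrt 2))) (at v within {0..1})"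
        by (intro DERIV_cmult DERIV_chain2[where g = "\<lambda>v. v / sqrt 2", OF DERIV_arcsin[OF lt]] DERIV_cdivide DERIV_ident)
      then show "((\<lambda>v. 2 * arcsin (v / sqrt 2)) has_vector_derivative 2 / sqrt (2 - v\<^sup>2)) (at v within {0..1})"
        unfolding eq has_real_derivative_iff_has_vector_derivative by simp
    qed simp
    moreover have "1 / sqrt 2 = sqrt 2 / (2::real)" by (simp add: field_simps)
    then have "arcsin (1 / sqrt 2) = pi / 4"
      using arcsin_sin[of "pi/4"] by (simp only: sin_45) simp
    ultimately show ?case by simp
  next
    case (Suc i)
    define w where "w j v = (1 - v\<^sup>2) ^ (2 * j) * (2 / sqrt (2 - v\<^sup>2))" for j and v :: real
    \<comment> \<open>The primitive is sin theta * cos theta ^ (2 i + 1), written with sin theta = v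
      sqrt (2 - v^2). It vanishes at both ends, which is Wallis' recursion.\<close>
    have "((\<lambda>v. real (2 * i + 2) * w (Suc i) v - real (2 * i + 1) * w i v) has_integral
        ((1 - 1\<^sup>2) ^ (2 * i + 1) * (1 * sqrt (2 - 1\<^sup>2)) - (1 - 0\<^sup>2) ^ (2 * i + 1) * (0 * sqrt (2 - 0\<^sup>2)))) {0..1::real}"
    proof (rule fundamental_theorem_of_calculus)
      fix v :: real assume v: "v \<in> {0..1}"
      define s where "s = sqrt (2 - v\<^sup>2)"
      define c where "c = 1 - v\<^sup>2"
      have s: "s > 0" "s\<^sup>2 = 1 + c" "v\<^sup>2 = 1 - c" using pos[OF v] by (auto simp: s_def c_def)
      have 1: "((\<lambda>v. (1 - v\<^sup>2) ^ (2 * i + 1)) has_real_derivative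
          real (2 * i + 1) * (c ^ (2 * i) * (- (2 * v)))) (at v within {0..1})"
      proof -
        have "((\<lambda>v. 1 - v\<^sup>2) has_real_derivative - (2 * v)) (at v within {0..1})"
          by (auto intro!: derivative_eq_intros)
        from DERIV_power[OF this, of "2 * i + 1"] show ?thesis
          unfolding c_def by (simp only: add_diff_cancel_right' One_nat_def[symmetric] mult.commute[of "- (2 * v)"])
      qed
      have 2: "((\<lambda>v. v * sqrt (2 - v\<^sup>2)) has_real_derivative s - v * (v / s)) (at v within {0..1})"
        unfolding s_def using pos[OF v]
        by (auto intro!: derivative_eq_intros simp: field_simps)
      have "((\<lambda>v. (1 - v\<^sup>2) ^ (2 * i + 1) * (v * sqrt (2 - v\<^sup>2))) has_real_derivative
          real (2 * i + 1) * (c ^ (2 * i) * (- (2 * v))) * (v * s) + (s - v * (v / s)) * c ^ (2 * i + 1))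
          (at v within {0..1})"
        using DERIV_mult[OF 1 2] unfolding s_def[symmetric] c_def[symmetric] .
      also have "real (2 * i + 1) * (c ^ (2 * i) * (- (2 * v))) * (v * s) + (s - v * (v / s)) * c ^ (2 * i + 1)
          = c ^ (2 * i) / s * (c * s\<^sup>2 - c * v\<^sup>2 - 2 * real (2 * i + 1) * v\<^sup>2 * s\<^sup>2)"
      proof -
        have "s * s = s\<^sup>2" "v * v = v\<^sup>2" by (simp_all add: power2_eq_square)
        then have "real (2 * i + 1) * (c ^ (2 * i) * (- (2 * v))) * (v * s)
            = c ^ (2 * i) / s * (- (2 * real (2 * i + 1) * v\<^sup>2 * s\<^sup>2))"
          using s(1) by (simp add: power2_eq_square)
        moreover have "(s - v * (v / s)) * c ^ (2 * i + 1) = c ^ (2 * i) / s * (c * s\<^sup>2 - c * v\<^sup>2)"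
          using s(1) by (simp add: power2_eq_square algebra_simps)
        ultimately show ?thesis by (simp only: right_diff_distrib)
      qed
      also have "c * s\<^sup>2 - c * v\<^sup>2 - 2 * real (2 * i + 1) * v\<^sup>2 * s\<^sup>2
          = 2 * (real (2 * i + 2) * c\<^sup>2 - real (2 * i + 1))"
        unfolding s(2,3) by (simp add: algebra_simps power2_eq_square)
      also have "c ^ (2 * i) / s * (2 * (real (2 * i + 2) * c\<^sup>2 - real (2 * i + 1)))
          = real (2 * i + 2) * w (Suc i) v - real (2 * i + 1) * w i v"
      proof -
        have w: "w (Suc i) v = c ^ (2 * i) * c\<^sup>2 * (2 / s)" "w i v = c ^ (2 * i) * (2 / s)"
          unfolding w_def s_def c_def by (simp_all add: power2_eq_square)
        show ?thesis unfolding w by (simp add: algebra_simps add_divide_distrib)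
      qed
      finally show "((\<lambda>v. (1 - v\<^sup>2) ^ (2 * i + 1) * (v * sqrt (2 - v\<^sup>2))) has_vector_derivative
          real (2 * i + 2) * w (Suc i) v - real (2 * i + 1) * w i v) (at v within {0..1})"
        unfolding has_real_derivative_iff_has_vector_derivative .
    qed simp
    from has_integral_add[OF this has_integral_mult_right[OF Suc.IH, of "real (2 * i + 1)"]]
    have "((\<lambda>v. real (2 * i + 2) * w (Suc i) v) has_integral
        real (2 * i + 1) * (pi / 2 * fact (2 * i) / (4 ^ i * (fact i)\<^sup>2))) {0..1}"
      unfolding w_def[symmetric] by (simp del: of_nat_add of_nat_mult of_nat_Suc)
    from has_integral_mult_right[OF this, of "1 / real (2 * i + 2)"]
    have "(w (Suc i) has_integral real (2 * i + 1) / real (2 * i + 2) * (pi / 2 * fact (2 * i) / (4 ^ i * (fact i)\<^sup>2))) {0..1}"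
      by (simp del: of_nat_add of_nat_mult of_nat_Suc)
    moreover have "real (2 * i + 1) / real (2 * i + 2) * (pi / 2 * fact (2 * i) / (4 ^ i * (fact i)\<^sup>2))
        = pi / 2 * fact (2 * Suc i) / (4 ^ Suc i * (fact (Suc i))\<^sup>2)"
    proof -
      define k where "k = real (Suc i)"
      have f: "fact (2 * Suc i) = 2 * k * real (2 * i + 1) * fact (2 * i)" "fact (Suc i) = k * fact i"
        "real (2 * i + 2) = 2 * k" "k > 0"
        by (simp_all add: k_def algebra_simps)
      show ?thesis unfolding f(1-3) power_Suc
        using f(4) by (simp add: power2_eq_square mult_ac del: of_nat_add of_nat_mult of_nat_Suc)
    qed
    ultimately show ?case unfolding w_def by simp
  }
qed

section \<open>Laguerre polynomials as averages of even Hermite polynomials\<close>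

definition laguerre :: "nat \<Rightarrow> real \<Rightarrow> real" where
  "laguerre n x = (\<Sum>i\<le>n. (-1) ^ i * real (n choose i) * x ^ i / fact i)"

text \<open>The Wallis values (2i)! / (4^i i!^2) cancel the factors 4^i i! / (2i)! of the Hermite
  coefficients and leave 1 / i!. In the angle this is the average of the Hermite polynomial at b cos
  theta over [0, pi / 2].\<close>

lemma laguerre_integral:
  "((\<lambda>v. even_hermite n (b * (1 - v\<^sup>2)) * (2 / sqrt (2 - v\<^sup>2))) has_integral
     (pi / 2 * laguerre n (b\<^sup>2))) {0..1::real}"
proof -
  have "((\<lambda>v. \<Sum>i\<le>n. even_hermite_coeff n i * b ^ (2 * i) * ((1 - v\<^sup>2) ^ (2 * i) * (2 / sqrt (2 - v\<^sup>2)))) has_integral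
     (\<Sum>i\<le>n. even_hermite_coeff n i * b ^ (2 * i) * (pi / 2 * fact (2 * i) / (4 ^ i * (fact i)\<^sup>2)))) {0..1::real}"
    by (intro has_integral_sum has_integral_mult_right wallis_integral) auto
  also have "(\<lambda>v. \<Sum>i\<le>n. even_hermite_coeff n i * b ^ (2 * i) * ((1 - v\<^sup>2) ^ (2 * i) * (2 / sqrt (2 - v\<^sup>2))))
      = (\<lambda>v. even_hermite n (b * (1 - v\<^sup>2)) * (2 / sqrt (2 - v\<^sup>2)))"
    by (simp add: even_hermite_def sum_distrib_right power_mult_distrib sum_divide_distrib mult.assoc)
  also have "(\<Sum>i\<le>n. even_hermite_coeff n i * b ^ (2 * i) * (pi / 2 * fact (2 * i) / (4 ^ i * (fact i)\<^sup>2)))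
      = pi / 2 * laguerre n (b\<^sup>2)"
    unfolding laguerre_def sum_distrib_left even_hermite_coeff_def
    by (intro sum.cong refl) (simp add: field_simps power2_eq_square power_mult)
  finally show ?thesis .
qed

section \<open>Fresnel integral and stationary phase\<close>

lemma gauss_integral_tendsto:
  "((\<lambda>R. integral {0..R} (\<lambda>x. exp (- x\<^sup>2))) \<longlongrightarrow> sqrt pi / 2) at_top"
proof -
  let ?f = "\<lambda>x :: real. indicator {0..} x *\<^sub>R exp (- x\<^sup>2)"
  have int: "integrable lborel ?f" and val: "integral\<^sup>L lborel ?f = sqrt pi / 2"
    using gaussian_moment_0 by (auto simp: has_bochner_integral_iff)
  have "((\<lambda>R. \<integral>x. indicator {..R} x *\<^sub>R ?f x \<partial>lborel) \<longlongrightarrow> integral\<^sup>L lborel ?f) at_top"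
    by (rule tendsto_integral_at_top[OF _ int]) simp
  moreover have "(\<integral>x. indicator {..R} x *\<^sub>R ?f x \<partial>lborel) = integral {0..R} (\<lambda>x. exp (- x\<^sup>2))" for R
  proof -
    have "(\<integral>x. indicator {..R} x *\<^sub>R ?f x \<partial>lborel) = (LINT x:{0..R}|lborel. exp (- x\<^sup>2))"
      unfolding set_lebesgue_integral_def
      by (intro Bochner_Integration.integral_cong refl) (auto split: split_indicator)
    also have "\<dots> = integral {0..R} (\<lambda>x. exp (- x\<^sup>2))"
      by (intro set_borel_integral_eq_integral(2) borel_integrable_atLeastAtMost')
         (auto intro!: continuous_intros)
    finally show ?thesis .
  qed
  ultimately show ?thesis unfolding val by simp
qed

text \<open>Rotating the contour of the Gaussian integral by \<open>\<pi> / 4\<close>; the two contours are joined by the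
  segment from \<open>R\<close> to \<open>R + \<i> R\<close>.\<close>

lemma fresnel_integral:
  obtains F :: "real \<Rightarrow> complex" where "F 0 = 0"
    and "\<And>s. (F has_vector_derivative cis (- s\<^sup>2)) (at s)"
    and "(F \<longlongrightarrow> complex_of_real (sqrt pi / 2) * cis (- (pi / 4))) at_top"
proof -
  \<comment> \<open>An entire primitive encodes path independence: real ray and rotated ray are
    compared through values of \<open>H\<close> alone.\<close>
  have "\<exists>H0. \<forall>z. (H0 has_field_derivative exp (- z\<^sup>2)) (at z :: complex filter)"
  proof (rule holomorphic_convex_primitive'[of UNIV "\<lambda>z :: complex. exp (- z\<^sup>2)"])
    show "(\<lambda>z :: complex. exp (- z\<^sup>2)) holomorphic_on UNIV" by (intro holomorphic_intros)
  qed auto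
  then obtain H0 where H0: "\<And>z :: complex. (H0 has_field_derivative exp (- z\<^sup>2)) (at z)"
    by blast
  define H where "H z = H0 z - H0 0" for z
  have H: "(H has_field_derivative exp (- z\<^sup>2)) (at z)" for z
    unfolding H_def by (auto intro!: derivative_eq_intros H0)
  have vec: "((\<lambda>t. H (a + of_real t * b)) has_vector_derivative exp (- (a + of_real t * b)\<^sup>2) * b) (at t)"
    for a b and t :: real
    by (rule has_vector_derivative_real_field[where f = "\<lambda>z. H (a + z * b)"])
       (rule DERIV_chain2[OF H, of "\<lambda>z. a + z * b"], auto intro!: derivative_eq_intros)
  define w where "w = cis (pi / 4)"
  have w2: "w\<^sup>2 = \<i>" by (simp add: w_def power2_eq_square cis_mult)
  have w_ne: "w \<noteq> 0" by (simp add: w_def)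
  define F where "F s = H (of_real s * w) / w" for s
  have real_H: "H (of_real R) = of_real (integral {0..R} (\<lambda>x. exp (- x\<^sup>2)))" if "R \<ge> 0" for R
  proof -
    have "((\<lambda>x. exp (- (of_real x)\<^sup>2) :: complex) has_integral (H (of_real R) - H (of_real 0))) {0..R}"
      using vec[of 0 1] that
      by (intro fundamental_theorem_of_calculus) (auto intro: has_vector_derivative_at_within)
    moreover have "((\<lambda>x. exp (- x\<^sup>2)) has_integral integral {0..R} (\<lambda>x. exp (- x\<^sup>2))) {0..R}"
      by (intro integrable_integral integrable_continuous_interval continuous_intros)
    then have "((\<lambda>x. complex_of_real (exp (- x\<^sup>2))) has_integral of_real (integral {0..R} (\<lambda>x. exp (- x\<^sup>2)))) {0..R}"
      by (rule has_integral_of_real)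
    moreover have "(\<lambda>x. complex_of_real (exp (- x\<^sup>2))) = (\<lambda>x. exp (- (of_real x)\<^sup>2))"
      by (simp add: fun_eq_iff exp_of_real[symmetric])
    ultimately show ?thesis
      using has_integral_unique by (simp add: H_def) blast
  qed
  have H_lim: "((\<lambda>R. H (of_real R)) \<longlongrightarrow> complex_of_real (sqrt pi / 2)) at_top"
  proof (rule Lim_transform_eventually)
    show "((\<lambda>R. complex_of_real (integral {0..R} (\<lambda>x. exp (- x\<^sup>2)))) \<longlongrightarrow> complex_of_real (sqrt pi / 2)) at_top"
      by (intro tendsto_of_real gauss_integral_tendsto)
    show "\<forall>\<^sub>F R in at_top. complex_of_real (integral {0..R} (\<lambda>x. exp (- x\<^sup>2))) = H (of_real R)"
      using eventually_ge_at_top[of 0] by eventually_elim (simp add: real_H)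
  qed
  have segment: "norm (H (of_real R + of_real R * \<i>) - H (of_real R)) \<le> 1 / R" if "R > 0" for R
  proof -
    define g where "g t = H (of_real R + of_real t * \<i>)" for t
    \<comment> \<open>The modulus of the derivative is exp (t^2 - R^2). Replacing t^2 by R t gives a
      majorant with an explicit primitive, whose increment is at most 1 / R.\<close>
    have "norm (g R - g 0) \<le> exp (- R\<^sup>2 + R * R) / R - exp (- R\<^sup>2 + R * 0) / R"
    proof (rule differentiable_bound_general[OF that])
      show "continuous_on {0..R} g" unfolding g_def
        by (intro continuous_at_imp_continuous_on ballI has_vector_derivative_continuous[OF vec])
      show "continuous_on {0..R} (\<lambda>t. exp (- R\<^sup>2 + R * t) / R)"
        using that by (intro continuous_intros) auto
      fix t assume t: "0 < t" "t < R"
      show "(g has_vector_derivative exp (- (of_real R + of_real t * \<i>)\<^sup>2) * \<i>) (at t)"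
        unfolding g_def by (rule vec)
      show "((\<lambda>t. exp (- R\<^sup>2 + R * t) / R) has_vector_derivative exp (- R\<^sup>2 + R * t)) (at t)"
        unfolding has_real_derivative_iff_has_vector_derivative[symmetric]
        using that by (auto intro!: derivative_eq_intros)
      have "Re (- (of_real R + of_real t * \<i>)\<^sup>2) = - R\<^sup>2 + t * t"
        by (simp add: power2_eq_square)
      moreover have "t * t \<le> R * t" using t by (intro mult_right_mono) auto
      ultimately show "norm (exp (- (of_real R + of_real t * \<i>)\<^sup>2) * \<i>) \<le> exp (- R\<^sup>2 + R * t)"
        by (simp add: norm_mult)
    qed
    also have "\<dots> \<le> 1 / R" using that by (simp add: power2_eq_square)
    finally show ?thesis by (simp add: g_def)
  qed
  have "((\<lambda>R. H (of_real R + of_real R * \<i>) - H (of_real R)) \<longlongrightarrow> 0) at_top"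
  proof (rule Lim_null_comparison)
    show "\<forall>\<^sub>F R in at_top. norm (H (of_real R + of_real R * \<i>) - H (of_real R)) \<le> 1 / R"
      using eventually_gt_at_top[of 0] by eventually_elim (rule segment)
    show "((\<lambda>R. 1 / R) \<longlongrightarrow> 0) (at_top :: real filter)"
      by real_asymp
  qed
  from tendsto_add[OF this H_lim]
  have diag: "((\<lambda>R. H (of_real R + of_real R * \<i>)) \<longlongrightarrow> complex_of_real (sqrt pi / 2)) at_top"
    by simp
  have "((\<lambda>s. H (of_real (s / sqrt 2) + of_real (s / sqrt 2) * \<i>)) \<longlongrightarrow> complex_of_real (sqrt pi / 2)) at_top"
    by (rule filterlim_compose[OF diag]) real_asymp
  moreover have "of_real (s / sqrt 2) + of_real (s / sqrt 2) * \<i> = of_real s * w" for s :: real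
    by (simp add: w_def complex_eq_iff cos_45 sin_45 field_simps)
  ultimately have "((\<lambda>s. H (of_real s * w)) \<longlongrightarrow> complex_of_real (sqrt pi / 2)) at_top"
    by simp
  from tendsto_divide[OF this tendsto_const w_ne]
  have "(F \<longlongrightarrow> complex_of_real (sqrt pi / 2) / w) at_top"
    by (simp only: F_def[abs_def])
  then have "(F \<longlongrightarrow> complex_of_real (sqrt pi / 2) * cis (- (pi / 4))) at_top"
    by (simp only: w_def divide_inverse[of "complex_of_real (sqrt pi / 2)"] cis_inverse)
  moreover have "(F has_vector_derivative cis (- s\<^sup>2)) (at s)" for s
  proof -
    have sq: "(0 + of_real s * w)\<^sup>2 = \<i> * of_real (s\<^sup>2)"
      by (simp add: power_mult_distrib w2)
    have "exp (- (0 + of_real s * w)\<^sup>2) * w / w = exp (- (\<i> * of_real (s\<^sup>2)))"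
      unfolding sq using w_ne by simp
    also have "\<dots> = cis (- s\<^sup>2)"
      unfolding cis_conv_exp by simp
    finally have "exp (- (0 + of_real s * w)\<^sup>2) * w / w = cis (- s\<^sup>2)" .
    moreover have "F = (\<lambda>s. H (0 + of_real s * w) / w)"
      by (simp add: F_def fun_eq_iff)
    ultimately show ?thesis
      using has_vector_derivative_divide[OF vec[of 0 w s], of w] by (simp only:)
  qed
  moreover have "F 0 = 0" by (simp add: F_def H_def)
  ultimately show thesis using that[of F] by blast
qed

lemma bounded_of_tendsto_at_top:
  fixes F :: "real \<Rightarrow> 'a :: real_normed_vector"
  assumes cont: "continuous_on {a..} F" and lim: "(F \<longlongrightarrow> L) at_top"
  shows "\<exists>B. \<forall>s\<ge>a. norm (F s) \<le> B"
proof -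
  from lim have "\<forall>\<^sub>F s in at_top. dist (F s) L < 1" by (rule tendstoD) simp
  then obtain s0 where s0: "\<And>s. s \<ge> s0 \<Longrightarrow> dist (F s) L < 1"
    by (auto simp: eventually_at_top_linorder)
  have "compact (F ` {a..s0})"
    by (intro compact_continuous_image continuous_on_subset[OF cont]) auto
  then obtain B where B: "\<And>s. s \<in> {a..s0} \<Longrightarrow> norm (F s) \<le> B"
    by (meson bounded_iff compact_imp_bounded imageI)
  have "norm (F s) \<le> max B (norm L + 1)" if "s \<ge> a" for s
  proof (cases "s \<le> s0")
    case True
    then show ?thesis using B[of s] that by auto
  next
    case False
    then have "norm (F s - L) < 1" using s0[of s] by (simp add: dist_norm)
    then show ?thesis using norm_triangle_ineq2[of "F s" L] by linarith
  qed
  then show ?thesis by blast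
qed

text \<open>Integration by parts against a Fresnel primitive \<open>\<phi>\<close> of the
  oscillating factor. For every v > 0 the value \<open>\<phi> n v\<close> approaches the same
  \<open>\<psi> n\<close>, so boundary term and remaining integral combine to G 1 - (G 1 - G 0) = G
  0 times \<open>\<psi> n\<close>.\<close>

lemma stationary_phase:
  fixes G G' :: "real \<Rightarrow> real" and M :: "nat \<Rightarrow> real"
  assumes G: "\<And>v. v \<in> {0..1} \<Longrightarrow> (G has_real_derivative G' v) (at v within {0..1})"
    and G': "continuous_on {0..1} G'" "G' 0 = 0"
    and M: "\<And>n. M n > 0" "filterlim M at_top sequentially"
  shows "(\<lambda>n. sqrt (M n) * integral {0..1} (\<lambda>v. G v * cos (M n * (1 - v\<^sup>2)))
     - G 0 * (sqrt pi / 2 * cos (M n - pi / 4))) \<longlonglongrightarrow> 0"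
proof -
  obtain F :: "real \<Rightarrow> complex" where F: "F 0 = 0"
    "\<And>s. (F has_vector_derivative cis (- s\<^sup>2)) (at s)"
    "(F \<longlongrightarrow> complex_of_real (sqrt pi / 2) * cis (- (pi / 4))) at_top"
    using fresnel_integral by blast
  define L where "L = complex_of_real (sqrt pi / 2) * cis (- (pi / 4))"
  have contF: "continuous_on S F" for S
    by (intro continuous_at_imp_continuous_on ballI has_vector_derivative_continuous[OF F(2)])
  obtain B where B: "\<And>s. s \<ge> 0 \<Longrightarrow> norm (F s) \<le> B"
    using bounded_of_tendsto_at_top[OF contF F(3)] by blast
  have "\<exists>K. \<forall>v\<in>{0..1}. \<bar>G' v\<bar> \<le> K"
    using compact_imp_bounded[OF compact_continuous_image[OF G'(1)]]
    by (auto simp: bounded_iff)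
  then obtain K where K: "\<And>v. v \<in> {0..1} \<Longrightarrow> \<bar>G' v\<bar> \<le> K" by blast
  have contG: "continuous_on {0..1} G" using G by (rule DERIV_continuous_on)
  \<comment> \<open>Splits cos (M - M v^2) as the real part of cis M times cis (-(sqrt M v)^2), the
    second factor being a rescaled Fresnel integrand.\<close>
  define \<phi> where "\<phi> n v = Re (cis (M n) * F (sqrt (M n) * v))" for n v
  define \<psi> where "\<psi> n = sqrt pi / 2 * cos (M n - pi / 4)" for n
  have \<psi>: "\<psi> n = Re (cis (M n) * L)" for n
  proof -
    have "cis (M n) * L = of_real (sqrt pi / 2) * cis (M n - pi / 4)"
      by (simp only: L_def mult.left_commute[of "cis (M n)"] cis_mult) simp
    then show ?thesis by (simp only: \<psi>_def Re_complex_of_real times_complex.sel Im_complex_of_real cis.sel)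
  qed
  have \<phi>_\<psi>: "\<bar>\<phi> n v - \<psi> n\<bar> \<le> norm (F (sqrt (M n) * v) - L)" for n v
  proof -
    have "\<phi> n v - \<psi> n = Re (cis (M n) * (F (sqrt (M n) * v) - L))"
      by (simp add: \<phi>_def \<psi> right_diff_distrib)
    also have "\<bar>\<dots>\<bar> \<le> norm (cis (M n) * (F (sqrt (M n) * v) - L))" by (rule abs_Re_le_cmod)
    finally show ?thesis by (simp add: norm_mult)
  qed
  have \<phi>': "(\<phi> n has_real_derivative sqrt (M n) * cos (M n * (1 - v\<^sup>2))) (at v within {0..1})" for n v
  proof -
    have "((\<lambda>v. F (sqrt (M n) * v)) has_vector_derivative sqrt (M n) *\<^sub>R cis (- (sqrt (M n) * v)\<^sup>2)) (at v)"
      by (rule vector_diff_chain_at[of "\<lambda>v. sqrt (M n) * v" "sqrt (M n)" v F, unfolded o_def])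
         (auto intro!: F(2) derivative_eq_intros)
    from bounded_linear.has_vector_derivative[OF bounded_linear_Re
        has_vector_derivative_mult_right[OF this, of "cis (M n)"]]
    have "(\<phi> n has_vector_derivative Re (cis (M n) * (sqrt (M n) *\<^sub>R cis (- (sqrt (M n) * v)\<^sup>2)))) (at v)"
      unfolding \<phi>_def .
    moreover have "cis (M n) * (sqrt (M n) *\<^sub>R cis (- (sqrt (M n) * v)\<^sup>2))
        = sqrt (M n) *\<^sub>R cis (M n * (1 - v\<^sup>2))"
      using M(1)[of n] by (simp add: cis_mult power_mult_distrib algebra_simps)
    ultimately have "(\<phi> n has_vector_derivative Re (sqrt (M n) *\<^sub>R cis (M n * (1 - v\<^sup>2)))) (at v)"
      by (simp only:)
    then show ?thesis
      by (simp add: has_real_derivative_iff_has_vector_derivative has_vector_derivative_at_within)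
  qed
  have cont\<phi>: "continuous_on {0..1} (\<phi> n)" for n
    using \<phi>' by (rule DERIV_continuous_on)
  have parts: "sqrt (M n) * integral {0..1} (\<lambda>v. G v * cos (M n * (1 - v\<^sup>2)))
      = G 1 * \<phi> n 1 - integral {0..1} (\<lambda>v. G' v * \<phi> n v)" for n
  proof -
    have total: "((\<lambda>v. G' v * \<phi> n v + sqrt (M n) * (G v * cos (M n * (1 - v\<^sup>2)))) has_integral
        (G 1 * \<phi> n 1 - G 0 * \<phi> n 0)) {0..1}"
    proof (rule fundamental_theorem_of_calculus)
      fix v :: real assume v: "v \<in> {0..1}"
      from DERIV_mult[OF G[OF v] \<phi>'[of n v]]
      show "((\<lambda>v. G v * \<phi> n v) has_vector_derivative
          G' v * \<phi> n v + sqrt (M n) * (G v * cos (M n * (1 - v\<^sup>2)))) (at v within {0..1})"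
        unfolding has_real_derivative_iff_has_vector_derivative by (simp add: mult_ac)
    qed simp
    have \<phi>_0: "\<phi> n 0 = 0" by (simp add: \<phi>_def F(1))
    have 1: "((\<lambda>v. G' v * \<phi> n v) has_integral integral {0..1} (\<lambda>v. G' v * \<phi> n v)) {0..1}"
      by (intro integrable_integral integrable_continuous_interval continuous_intros G'(1) cont\<phi>)
    have 2: "((\<lambda>v. sqrt (M n) * (G v * cos (M n * (1 - v\<^sup>2)))) has_integral
        sqrt (M n) * integral {0..1} (\<lambda>v. G v * cos (M n * (1 - v\<^sup>2)))) {0..1}"
      by (intro has_integral_mult_right integrable_integral integrable_continuous_interval
          continuous_intros contG)
    show ?thesis
      using has_integral_unique[OF total has_integral_add[OF 1 2]] by (simp add: \<phi>_0)
  qed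
  have intG': "(G' has_integral (G 1 - G 0)) {0..1}"
    using G by (intro fundamental_theorem_of_calculus)
      (auto simp: has_real_derivative_iff_has_vector_derivative)
  \<comment> \<open>Since G' integrates to G 1 - G 0, the oscillating \<open>\<psi> n\<close>, which
    has no limit itself, can be subtracted under the integral.\<close>
  have split: "sqrt (M n) * integral {0..1} (\<lambda>v. G v * cos (M n * (1 - v\<^sup>2))) - G 0 * \<psi> n
      = G 1 * (\<phi> n 1 - \<psi> n) - integral {0..1} (\<lambda>v. G' v * (\<phi> n v - \<psi> n))" for n
  proof -
    have "((\<lambda>v. G' v * \<phi> n v - G' v * \<psi> n) has_integral
        (integral {0..1} (\<lambda>v. G' v * \<phi> n v) - (G 1 - G 0) * \<psi> n)) {0..1}"
      by (intro has_integral_diff has_integral_mult_left intG' integrable_integral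
          integrable_continuous_interval continuous_intros G'(1) cont\<phi>)
    then have "integral {0..1} (\<lambda>v. G' v * (\<phi> n v - \<psi> n))
        = integral {0..1} (\<lambda>v. G' v * \<phi> n v) - (G 1 - G 0) * \<psi> n"
      by (simp add: integral_unique right_diff_distrib)
    then show ?thesis unfolding parts by (simp add: algebra_simps)
  qed
  have F_lim: "(\<lambda>n. F (sqrt (M n) * v) - L) \<longlonglongrightarrow> 0" if "v > 0" for v
  proof -
    have "filterlim (\<lambda>n. sqrt (M n) * v) at_top sequentially"
      using that by (intro filterlim_at_top_mult_tendsto_pos[OF tendsto_const]
          filterlim_compose[OF sqrt_at_top M(2)])
    from filterlim_compose[OF F(3) this] show ?thesis
      unfolding L_def by (simp add: LIM_zero_iff)
  qed
  have lim: "(\<lambda>n. \<phi> n v - \<psi> n) \<longlonglongrightarrow> 0" if "v > 0" for v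
    by (rule Lim_null_comparison[OF _ tendsto_norm_zero[OF F_lim[OF that]]]) (simp add: \<phi>_\<psi>)
  have bound: "\<bar>\<phi> n v - \<psi> n\<bar> \<le> B + norm L" if "v \<ge> 0" for n v
  proof -
    have "norm (F (sqrt (M n) * v)) \<le> B" using M(1)[of n] that by (intro B) simp
    then show ?thesis
      using \<phi>_\<psi>[of n v] norm_triangle_ineq4[of "F (sqrt (M n) * v)" L] by linarith
  qed
  have "(\<lambda>n. integral {0..1} (\<lambda>v. G' v * (\<phi> n v - \<psi> n))) \<longlonglongrightarrow> integral {0..1} (\<lambda>v::real. 0 :: real)"
  proof (rule dominated_convergence(2))
    show "(\<lambda>v. G' v * (\<phi> n v - \<psi> n)) integrable_on {0..1}" for n
      by (intro integrable_continuous_interval continuous_intros G'(1) cont\<phi>)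
    show "(\<lambda>v. K * (B + norm L)) integrable_on {0..1::real}"
      by (intro integrable_continuous_interval continuous_intros)
    show "norm (G' v * (\<phi> n v - \<psi> n)) \<le> K * (B + norm L)" if "v \<in> {0..1}" for n v
    proof -
      have "\<bar>G' v\<bar> * \<bar>\<phi> n v - \<psi> n\<bar> \<le> K * (B + norm L)"
        using K[OF that] bound[of v n] that by (intro mult_mono) auto
      then show ?thesis by (simp add: abs_mult)
    qed
    show "(\<lambda>n. G' v * (\<phi> n v - \<psi> n)) \<longlonglongrightarrow> 0" if "v \<in> {0..1}" for v
    \<comment> \<open>At v = 0 the primitive is 0 and does not approach \<open>\<psi> n\<close>;
      there the factor G' 0 = 0 gives the pointwise limit.\<close>
    proof (cases "v = 0")
      case False
      then show ?thesis using tendsto_mult_right_zero[OF lim[of v]] that by auto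
    qed (simp add: G'(2))
  qed
  then have "(\<lambda>n. G 1 * (\<phi> n 1 - \<psi> n) - integral {0..1} (\<lambda>v. G' v * (\<phi> n v - \<psi> n))) \<longlonglongrightarrow> G 1 * 0 - 0"
    by (intro tendsto_diff tendsto_mult tendsto_const lim) auto
  then show ?thesis unfolding split[symmetric] by (simp add: \<psi>_def)
qed

section \<open>Fejer's formula\<close>

lemma abs_cos_diff_le: "\<bar>cos x - cos y\<bar> \<le> \<bar>x - y\<bar>" for x y :: real
proof -
  have "\<bar>cos x - cos y\<bar> = 2 * (\<bar>sin ((x + y) / 2)\<bar> * \<bar>sin ((y - x) / 2)\<bar>)"
    by (simp add: cos_diff_cos abs_mult)
  also have "\<dots> \<le> 2 * (1 * \<bar>(y - x) / 2\<bar>)"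
    by (intro mult_left_mono mult_mono abs_sin_x_le_abs_x) auto
  finally show ?thesis by (simp add: abs_minus_commute)
qed

lemma laguerre_integral_approx:
  assumes "4 * b ^ 3 \<le> sqrt (4 * real n + 1)" "b \<ge> 0"
  shows "\<bar>pi / 2 * laguerre n (b\<^sup>2) - integral {0..1} (\<lambda>v. 2 * exp ((b * (1 - v\<^sup>2))\<^sup>2 / 2) / sqrt (2 - v\<^sup>2)
      * cos (b * sqrt (4 * real n + 1) * (1 - v\<^sup>2)))\<bar> \<le> 8 * b ^ 3 * exp (b\<^sup>2 / 2) / sqrt (4 * real n + 1)"
proof -
  define \<mu> where "\<mu> = sqrt (4 * real n + 1)"
  have pos: "1 \<le> 2 - v\<^sup>2" if "v \<in> {0..1}" for v :: real
    using power_le_one[of v 2] that by auto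
  have nz: "\<forall>v\<in>{0..1}. sqrt (2 - v\<^sup>2) \<noteq> 0"
  proof
    fix v :: real assume "v \<in> {0..1}"
    from pos[OF this] show "sqrt (2 - v\<^sup>2) \<noteq> 0" by simp
  qed
  define r where "r v = 2 * exp ((b * (1 - v\<^sup>2))\<^sup>2 / 2) / sqrt (2 - v\<^sup>2) * cos (b * \<mu> * (1 - v\<^sup>2))" for v
  have cont: "continuous_on {0..1} r"
    unfolding r_def by (intro continuous_intros nz) auto
  then have "(r has_integral integral {0..1} r) {0..1}"
    by (intro integrable_integral integrable_continuous_interval)
  from has_integral_diff[OF laguerre_integral this]
  have int: "((\<lambda>v. even_hermite n (b * (1 - v\<^sup>2)) * (2 / sqrt (2 - v\<^sup>2)) - r v) has_integral
      (pi / 2 * laguerre n (b\<^sup>2) - integral {0..1} r)) (cbox 0 1)" by simp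
  have "norm (pi / 2 * laguerre n (b\<^sup>2) - integral {0..1} r)
      \<le> (exp (b\<^sup>2 / 2) * (4 * b ^ 3 / \<mu>) * 2) * measure lborel (cbox 0 (1::real))"
  proof (rule has_integral_bound[OF _ int])
    show "0 \<le> exp (b\<^sup>2 / 2) * (4 * b ^ 3 / \<mu>) * 2" using assms by (simp add: \<mu>_def)
    fix v :: real assume "v \<in> cbox 0 1"
    then have v: "v \<in> {0..1}" by simp
    define y where "y = b * (1 - v\<^sup>2)"
    have y: "y \<in> {0..b}"
      using pos[OF v] assms(2) mult_left_mono[of "1 - v\<^sup>2" 1 b] by (auto simp: y_def)
    have "even_hermite n y * (2 / sqrt (2 - v\<^sup>2)) - r v
        = (even_hermite n y - exp (y\<^sup>2 / 2) * cos (\<mu> * y)) * (2 / sqrt (2 - v\<^sup>2))"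
      by (simp add: r_def y_def algebra_simps)
    also have "norm \<dots> \<le> exp (b\<^sup>2 / 2) * (4 * b ^ 3 / \<mu>) * 2"
      unfolding real_norm_def abs_mult
    proof (rule mult_mono)
      show "\<bar>even_hermite n y - exp (y\<^sup>2 / 2) * cos (\<mu> * y)\<bar> \<le> exp (b\<^sup>2 / 2) * (4 * b ^ 3 / \<mu>)"
        unfolding \<mu>_def by (rule even_hermite_wkb[OF assms(1) y])
      show "\<bar>2 / sqrt (2 - v\<^sup>2)\<bar> \<le> 2"
        using pos[OF v] by (simp add: divide_le_eq)
    qed (use assms in \<open>auto simp: \<mu>_def\<close>)
    finally show "norm (even_hermite n (b * (1 - v\<^sup>2)) * (2 / sqrt (2 - v\<^sup>2)) - r v)
        \<le> exp (b\<^sup>2 / 2) * (4 * b ^ 3 / \<mu>) * 2"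
      unfolding y_def .
  qed
  then show ?thesis unfolding r_def[abs_def] \<mu>_def by (simp add: mult_ac)
qed

text \<open>The stationary point v = 0 corresponds to the argument y = b, where G 0 = sqrt 2 * exp
  (b^2 / 2); this exponential cancels the prefactor. The WKB error O(n^(-1/2)) survives
  multiplication by sqrt (M n), which is of order n^(1/4).\<close>

theorem laguerre_asymptotics:
  assumes b: "b > 0"
  shows "(\<lambda>n. real n powr (1/4) * (exp (- (b\<^sup>2 / 2)) * laguerre n (b\<^sup>2))
     - cos (2 * b * sqrt (real n) - pi / 4) / sqrt (pi * b)) \<longlonglongrightarrow> 0"
proof -
  define M where "M n = b * sqrt (4 * real n + 1)" for n
  define G where "G v = 2 * exp ((b * (1 - v\<^sup>2))\<^sup>2 / 2) / sqrt (2 - v\<^sup>2)" for v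
  define G' where "G' v = v * G v * (1 / (2 - v\<^sup>2) - 2 * b\<^sup>2 * (1 - v\<^sup>2))" for v
  define J where "J n = integral {0..1} (\<lambda>v. G v * cos (M n * (1 - v\<^sup>2)))" for n
  define l where "l n = exp (- (b\<^sup>2 / 2)) * laguerre n (b\<^sup>2)" for n
  have pos: "1 \<le> 2 - v\<^sup>2" if "v \<in> {0..1}" for v :: real
    using power_le_one[of v 2] that by auto
  have nz: "\<forall>v\<in>{0..1}. sqrt (2 - v\<^sup>2) \<noteq> 0" "\<forall>v\<in>{0..1}. 2 - v\<^sup>2 \<noteq> (0 :: real)"
  proof -
    show "\<forall>v\<in>{0..1}. 2 - v\<^sup>2 \<noteq> (0 :: real)"
    proof
      fix v :: real assume "v \<in> {0..1}"
      from pos[OF this] show "2 - v\<^sup>2 \<noteq> 0" by linarith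
    qed
    then show "\<forall>v\<in>{0..1}. sqrt (2 - v\<^sup>2) \<noteq> 0" by simp
  qed
  have M: "M n > 0" for n using b by (simp add: M_def add_nonneg_pos)
  have M_lim: "filterlim M at_top sequentially"
    unfolding M_def using b by real_asymp
  have "(\<lambda>n. sqrt (M n) * J n - G 0 * (sqrt pi / 2 * cos (M n - pi / 4))) \<longlonglongrightarrow> 0"
    unfolding J_def
  proof (rule stationary_phase[OF _ _ _ M M_lim])
    fix v :: real assume v: "v \<in> {0..1}"
    have p: "2 - v\<^sup>2 > 0" using pos[OF v] by linarith
    have 1: "((\<lambda>v. 2 * exp ((b * (1 - v\<^sup>2))\<^sup>2 / 2)) has_real_derivative
        2 * exp ((b * (1 - v\<^sup>2))\<^sup>2 / 2) * (- (2 * b\<^sup>2 * v * (1 - v\<^sup>2)))) (at v within {0..1})"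
    proof -
      have "((\<lambda>v. (b * (1 - v\<^sup>2))\<^sup>2 / 2) has_real_derivative - (2 * b\<^sup>2 * v * (1 - v\<^sup>2))) (at v within {0..1})"
        by (auto intro!: derivative_eq_intros
            simp: power2_eq_square algebra_simps diff_divide_distrib add_divide_distrib)
      from DERIV_cmult[OF DERIV_chain'[OF this DERIV_exp], of 2] show ?thesis
        by (simp only: mult.assoc)
    qed
    have 2: "((\<lambda>v. inverse (sqrt (2 - v\<^sup>2))) has_real_derivative
        v / (2 - v\<^sup>2) * inverse (sqrt (2 - v\<^sup>2))) (at v within {0..1})"
    proof -
      have "((\<lambda>v. sqrt (2 - v\<^sup>2)) has_real_derivative - (v / sqrt (2 - v\<^sup>2))) (at v within {0..1})"
        using p by (auto intro!: derivative_eq_intros simp: field_simps)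
      from DERIV_inverse_fun[OF this] p show ?thesis
        by (simp add: power2_eq_square[symmetric] power_Suc2[symmetric] divide_inverse algebra_simps)
    qed
    show "(G has_real_derivative G' v) (at v within {0..1})"
      using DERIV_mult[OF 1 2] unfolding G_def[abs_def] G'_def divide_inverse[of _ "sqrt _"]
      by (simp add: algebra_simps)
  next
    show "continuous_on {0..1} G'"
      unfolding G'_def G_def by (intro continuous_intros nz) auto
    show "G' 0 = 0" by (simp add: G'_def)
  qed
  moreover have "(\<lambda>n. sqrt (M n) * (pi / 2 * laguerre n (b\<^sup>2) - J n)) \<longlonglongrightarrow> 0"
  proof (rule Lim_null_comparison)
    have "\<forall>\<^sub>F n in sequentially. 4 * b ^ 3 \<le> sqrt (4 * real n + 1)"
      by real_asymp
    then show "\<forall>\<^sub>F n in sequentially. norm (sqrt (M n) * (pi / 2 * laguerre n (b\<^sup>2) - J n))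
        \<le> sqrt (M n) * (8 * b ^ 3 * exp (b\<^sup>2 / 2) / sqrt (4 * real n + 1))"
    proof eventually_elim
      case (elim n)
      from laguerre_integral_approx[OF this] b
      have "\<bar>pi / 2 * laguerre n (b\<^sup>2) - J n\<bar> \<le> 8 * b ^ 3 * exp (b\<^sup>2 / 2) / sqrt (4 * real n + 1)"
        by (simp add: J_def G_def M_def)
      then show ?case using M[of n] unfolding real_norm_def abs_mult
        by (intro mult_mono) auto
    qed
    show "(\<lambda>n. sqrt (M n) * (8 * b ^ 3 * exp (b\<^sup>2 / 2) / sqrt (4 * real n + 1))) \<longlonglongrightarrow> 0"
      unfolding M_def using b by real_asymp
  qed
  ultimately have "(\<lambda>n. (sqrt (M n) * J n - G 0 * (sqrt pi / 2 * cos (M n - pi / 4)))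
      + sqrt (M n) * (pi / 2 * laguerre n (b\<^sup>2) - J n)) \<longlonglongrightarrow> 0 + 0"
    by (rule tendsto_add)
  then have "(\<lambda>n. exp (- (b\<^sup>2 / 2)) * 2 / pi * ((sqrt (M n) * J n - G 0 * (sqrt pi / 2 * cos (M n - pi / 4)))
      + sqrt (M n) * (pi / 2 * laguerre n (b\<^sup>2) - J n))) \<longlonglongrightarrow> exp (- (b\<^sup>2 / 2)) * 2 / pi * (0 + 0)"
    by (rule tendsto_mult_left)
  moreover have "exp (- (b\<^sup>2 / 2)) * 2 / pi * ((sqrt (M n) * J n - G 0 * (sqrt pi / 2 * cos (M n - pi / 4)))
      + sqrt (M n) * (pi / 2 * laguerre n (b\<^sup>2) - J n))
      = sqrt (M n) * l n - sqrt 2 / sqrt pi * cos (M n - pi / 4)" for n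
  proof -
    have e: "exp (- (b\<^sup>2 / 2)) * exp (b\<^sup>2 / 2) = 1" by (simp flip: exp_add)
    have "exp (- (b\<^sup>2 / 2)) * G 0 = (exp (- (b\<^sup>2 / 2)) * exp (b\<^sup>2 / 2)) * (2 / sqrt 2)"
      by (simp add: G_def)
    then have G0: "exp (- (b\<^sup>2 / 2)) * G 0 = sqrt 2"
      unfolding e by (simp add: real_div_sqrt)
    have \<pi>: "sqrt pi / pi = 1 / sqrt pi"
      by (simp add: field_simps)
    have c: "exp (- (b\<^sup>2 / 2)) * 2 / pi * (G 0 * (sqrt pi / 2 * c)) = sqrt 2 / sqrt pi * c" for c
    proof -
      have "exp (- (b\<^sup>2 / 2)) * 2 / pi * (G 0 * (sqrt pi / 2 * c))
          = (exp (- (b\<^sup>2 / 2)) * G 0) * (sqrt pi / pi) * c"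
        by simp
      then show ?thesis unfolding G0 \<pi> by simp
    qed
    have "exp (- (b\<^sup>2 / 2)) * 2 / pi * (sqrt (M n) * (pi / 2 * laguerre n (b\<^sup>2))) = sqrt (M n) * l n"
      by (simp add: l_def)
    with c[of "cos (M n - pi / 4)"] show ?thesis by (simp only: algebra_simps)
  qed
  ultimately have lim1: "(\<lambda>n. sqrt (M n) * l n - sqrt 2 / sqrt pi * cos (M n - pi / 4)) \<longlonglongrightarrow> 0"
    by (simp only: add_0_left mult_zero_right)
  \<comment> \<open>What remains is to pass from sqrt (M n) to n^(1/4) (\<open>lim2\<close>), to fix
    the amplitude (\<open>lim3\<close>), and to replace the phase b sqrt (4 n + 1) by 2 b sqrt n
    (\<open>lim4\<close>).\<close>
  define \<rho> where "\<rho> n = real n powr (1/4) / sqrt (M n)" for n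
  have \<rho>: "\<rho> \<longlonglongrightarrow> 1 / sqrt (2 * b)"
  proof -
    have "(\<lambda>n. real n powr (1/4) / sqrt (sqrt (4 * real n + 1))) \<longlonglongrightarrow> 1 / sqrt 2"
      unfolding inverse_eq_divide[symmetric] powr_half_sqrt[of 2, simplified, symmetric] by real_asymp
    then have "(\<lambda>n. real n powr (1/4) / sqrt (sqrt (4 * real n + 1)) * (1 / sqrt b)) \<longlonglongrightarrow> 1 / sqrt 2 * (1 / sqrt b)"
      by (rule tendsto_mult_right)
    then show ?thesis by (simp add: \<rho>_def[abs_def] M_def real_sqrt_mult mult.commute)
  qed
  have lim2: "(\<lambda>n. real n powr (1/4) * l n - \<rho> n * (sqrt 2 / sqrt pi * cos (M n - pi / 4))) \<longlonglongrightarrow> 0"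
  proof -
    have "\<rho> n * sqrt (M n) = real n powr (1/4)" for n
      using M[of n] by (simp add: \<rho>_def)
    then have eq: "real n powr (1/4) * l n - \<rho> n * (sqrt 2 / sqrt pi * cos (M n - pi / 4))
        = \<rho> n * (sqrt (M n) * l n - sqrt 2 / sqrt pi * cos (M n - pi / 4))" for n
      by (simp only: right_diff_distrib mult.assoc[symmetric])
    show ?thesis using tendsto_mult[OF \<rho> lim1] by (simp only: eq mult_zero_right)
  qed
  have lim3: "(\<lambda>n. (\<rho> n * (sqrt 2 / sqrt pi) - 1 / sqrt (pi * b)) * cos (M n - pi / 4)) \<longlonglongrightarrow> 0"
  proof (rule Lim_null_comparison)
    show "\<forall>\<^sub>F n in sequentially. norm ((\<rho> n * (sqrt 2 / sqrt pi) - 1 / sqrt (pi * b)) * cos (M n - pi / 4))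
        \<le> \<bar>\<rho> n * (sqrt 2 / sqrt pi) - 1 / sqrt (pi * b)\<bar>"
      by (auto simp: abs_mult intro!: mult_left_le always_eventually)
    have "(\<lambda>n. \<bar>\<rho> n * (sqrt 2 / sqrt pi) - 1 / sqrt (pi * b)\<bar>)
        \<longlonglongrightarrow> \<bar>1 / sqrt (2 * b) * (sqrt 2 / sqrt pi) - 1 / sqrt (pi * b)\<bar>"
      by (intro tendsto_intros \<rho>)
    moreover have "1 / sqrt (2 * b) * (sqrt 2 / sqrt pi) = 1 / sqrt (pi * b)"
      by (simp add: real_sqrt_mult)
    ultimately show "(\<lambda>n. \<bar>\<rho> n * (sqrt 2 / sqrt pi) - 1 / sqrt (pi * b)\<bar>) \<longlonglongrightarrow> 0" by simp
  qed
  have lim4: "(\<lambda>n. 1 / sqrt (pi * b) * (cos (M n - pi / 4) - cos (2 * b * sqrt (real n) - pi / 4))) \<longlonglongrightarrow> 0"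
  proof (rule tendsto_mult_right_zero, rule Lim_null_comparison)
    show "\<forall>\<^sub>F n in sequentially. norm (cos (M n - pi / 4) - cos (2 * b * sqrt (real n) - pi / 4))
        \<le> \<bar>M n - 2 * b * sqrt (real n)\<bar>"
      using abs_cos_diff_le[of "M _ - pi / 4" "2 * b * sqrt (real _) - pi / 4"]
      by (intro always_eventually allI) simp
    have "(\<lambda>n. M n - 2 * b * sqrt (real n)) \<longlonglongrightarrow> 0"
      unfolding M_def using b by real_asymp
    then show "(\<lambda>n. \<bar>M n - 2 * b * sqrt (real n)\<bar>) \<longlonglongrightarrow> 0"
      by (rule tendsto_rabs_zero)
  qed
  have eq: "real n powr (1/4) * l n - \<rho> n * (sqrt 2 / sqrt pi * cos (M n - pi / 4))
      + (\<rho> n * (sqrt 2 / sqrt pi) - 1 / sqrt (pi * b)) * cos (M n - pi / 4)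
      + 1 / sqrt (pi * b) * (cos (M n - pi / 4) - cos (2 * b * sqrt (real n) - pi / 4))
      = real n powr (1/4) * l n - cos (2 * b * sqrt (real n) - pi / 4) / sqrt (pi * b)" for n
    by (simp add: left_diff_distrib right_diff_distrib diff_divide_distrib)
  from tendsto_add[OF tendsto_add[OF lim2 lim3] lim4]
  have "(\<lambda>n. real n powr (1/4) * l n - cos (2 * b * sqrt (real n) - pi / 4) / sqrt (pi * b)) \<longlonglongrightarrow> 0"
    by (simp only: eq add_0_left)
  then show ?thesis by (simp only: l_def)
qed

section \<open>Equidistribution and the arcsine law\<close>

lemma cesaro_mean:
  fixes x :: "nat \<Rightarrow> real"
  assumes "x \<longlonglongrightarrow> l"
  shows "(\<lambda>N. (\<Sum>n<N. x n) / real N) \<longlonglongrightarrow> l"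
proof (rule LIMSEQ_I)
  fix e :: real assume e: "e > 0"
  then obtain n0 where n0: "\<And>n. n \<ge> n0 \<Longrightarrow> \<bar>x n - l\<bar> < e / 2"
    using LIMSEQ_D[OF assms, of "e / 2"] by auto
  define C where "C = (\<Sum>n<n0. \<bar>x n - l\<bar>)"
  obtain N0 :: nat where N0: "2 * C / e < real N0" using reals_Archimedean2 by blast
  show "\<exists>no. \<forall>N\<ge>no. norm ((\<Sum>n<N. x n) / real N - l) < e"
  proof (intro exI[of _ "max (max n0 1) N0"] allI impI)
    fix N assume N: "max (max n0 1) N0 \<le> N"
    have "C / real N < e / 2" using N N0 e by (simp add: field_simps less_le_trans)
    have "(\<Sum>n<N. x n) / real N - l = (\<Sum>n<N. x n - l) / real N"
      using N by (simp add: sum_subtractf field_simps)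
    also have "\<bar>\<dots>\<bar> \<le> (\<Sum>n<N. \<bar>x n - l\<bar>) / real N"
      by (simp add: divide_right_mono)
    also have "(\<Sum>n<N. \<bar>x n - l\<bar>) = C + (\<Sum>n=n0..<N. \<bar>x n - l\<bar>)"
      unfolding C_def using N by (metis lessThan_atLeast0 max.boundedE sum.atLeastLessThan_concat zero_le)
    also have "(\<Sum>n=n0..<N. \<bar>x n - l\<bar>) \<le> (\<Sum>n=n0..<N. e / 2)"
      using n0 by (intro sum_mono) (auto intro: less_imp_le)
    also have "\<dots> \<le> real N * (e / 2)" using e N by simp
    finally have "\<bar>(\<Sum>n<N. x n) / real N - l\<bar> \<le> (C + real N * (e / 2)) / real N"
      by (simp add: divide_right_mono)
    also have "\<dots> = C / real N + e / 2" using N by (simp add: field_simps)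
    also have "\<dots> < e" using \<open>C / real N < e / 2\<close> by linarith
    finally show "norm ((\<Sum>n<N. x n) / real N - l) < e" by simp
  qed
qed

lemma cesaro_mean_transfer:
  fixes x y :: "nat \<Rightarrow> real"
  assumes "(\<lambda>N. (\<Sum>n<N. x n) / real N) \<longlonglongrightarrow> l" "(\<lambda>n. y n - x n) \<longlonglongrightarrow> 0"
  shows "(\<lambda>N. (\<Sum>n<N. y n) / real N) \<longlonglongrightarrow> l"
  using tendsto_add[OF assms(1) cesaro_mean[OF assms(2)]]
  by (simp add: add_divide_distrib[symmetric] sum.distrib[symmetric])

text \<open>Summation by parts: neighbouring terms cancel up to an increment of y.\<close>

lemma cesaro_mean_alternating:
  fixes y :: "nat \<Rightarrow> real"
  assumes bounded: "\<And>n. \<bar>y n\<bar> \<le> B" and slow: "(\<lambda>n. y (Suc n) - y n) \<longlonglongrightarrow> 0"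
  shows "(\<lambda>N. (\<Sum>n<N. (-1) ^ n * y n) / real N) \<longlonglongrightarrow> 0"
proof -
  have tele: "2 * (\<Sum>n<N. (-1) ^ n * y n) = y 0 - (-1) ^ N * y N - (\<Sum>n<N. (-1) ^ n * (y (Suc n) - y n))" for N
    by (induction N) (auto simp: algebra_simps)
  have "(\<lambda>n. (-1) ^ n * (y (Suc n) - y n)) \<longlonglongrightarrow> 0"
    by (rule Lim_null_comparison[OF _ tendsto_rabs_zero[OF slow]]) (simp add: abs_mult power_abs)
  from cesaro_mean[OF this] have 1: "(\<lambda>N. (\<Sum>n<N. (-1) ^ n * (y (Suc n) - y n)) / real N) \<longlonglongrightarrow> 0" .
  have 2: "(\<lambda>N. (y 0 - (-1) ^ N * y N) / real N) \<longlonglongrightarrow> 0"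
  proof (rule Lim_null_comparison)
    have "norm ((y 0 - (-1) ^ N * y N) / real N) \<le> 2 * B / real N" for N
    proof -
      have "\<bar>y 0 - (-1) ^ N * y N\<bar> \<le> \<bar>y 0\<bar> + \<bar>(-1) ^ N * y N\<bar>" by (rule abs_triangle_ineq4)
      also have "\<dots> \<le> 2 * B" using bounded[of 0] bounded[of N] by (simp add: abs_mult power_abs)
      finally show ?thesis by (simp add: divide_right_mono)
    qed
    then show "\<forall>\<^sub>F N in sequentially. norm ((y 0 - (-1) ^ N * y N) / real N) \<le> 2 * B / real N" by simp
    show "(\<lambda>N. 2 * B / real N) \<longlonglongrightarrow> 0" by real_asymp
  qed
  have "(\<lambda>N. ((y 0 - (-1) ^ N * y N) / real N - (\<Sum>n<N. (-1) ^ n * (y (Suc n) - y n)) / real N) / 2) \<longlonglongrightarrow> (0 - 0) / 2"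
    by (intro tendsto_divide tendsto_diff 1 2 tendsto_const) auto
  moreover have "((y 0 - (-1) ^ N * y N) / real N - (\<Sum>n<N. (-1) ^ n * (y (Suc n) - y n)) / real N) / 2
      = (\<Sum>n<N. (-1) ^ n * y n) / real N" for N
    by (simp only: diff_divide_distrib[symmetric] tele[of N, symmetric]) simp
  ultimately show ?thesis by simp
qed

text \<open>The increments of \<open>sqrt n * \<Phi> (c * sqrt n + d)\<close> are \<open>c / 2 * \<psi> (c * sqrt n + d) + o(1)\<close>.\<close>

lemma cesaro_mean_sqrt_derivative:
  fixes \<Phi> \<psi> :: "real \<Rightarrow> real"
  assumes deriv: "\<And>t. (\<Phi> has_real_derivative \<psi> t) (at t)" and bounded: "\<And>t. \<bar>\<Phi> t\<bar> \<le> B"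
    and lipschitz: "\<And>x y. \<bar>\<psi> x - \<psi> y\<bar> \<le> L * \<bar>x - y\<bar>" and c: "c > 0"
  shows "(\<lambda>N. (\<Sum>n<N. \<psi> (c * sqrt (real n) + d)) / real N) \<longlonglongrightarrow> 0"
proof (rule cesaro_mean_transfer)
  \<comment> \<open>The weight sqrt t compensates for the spacing c / (2 sqrt t) of the sample
    points, so the increments stay of order 1 while the telescoped sum is only O(sqrt N).\<close>
  define a where "a t = sqrt t * \<Phi> (c * sqrt t + d)" for t
  have B: "B \<ge> 0" using bounded[of 0] by linarith
  have L: "L \<ge> 0" using lipschitz[of 1 0] by simp
  show "(\<lambda>N. (\<Sum>n<N. 2 / c * (a (real (Suc n)) - a (real n))) / real N) \<longlonglongrightarrow> 0"
  proof -
    have "(\<Sum>n<N. 2 / c * (a (real (Suc n)) - a (real n))) = 2 / c * a (real N)" for N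
      unfolding sum_distrib_left[symmetric] sum_lessThan_telescope[of "\<lambda>n. a (real n)"]
      by (simp add: a_def)
    moreover have "(\<lambda>N. 2 / c * a (real N) / real N) \<longlonglongrightarrow> 0"
    proof (rule Lim_null_comparison)
      have "norm (2 / c * a (real N) / real N) \<le> 2 / c * (sqrt (real N) * B) / real N" for N
        unfolding a_def using bounded[of "c * sqrt (real N) + d"] c
        by (auto simp: abs_mult intro!: divide_right_mono mult_left_mono)
      then show "\<forall>\<^sub>F N in sequentially. norm (2 / c * a (real N) / real N) \<le> 2 / c * (sqrt (real N) * B) / real N"
        by simp
      show "(\<lambda>N. 2 / c * (sqrt (real N) * B) / real N) \<longlonglongrightarrow> 0" using c by real_asymp
    qed
    ultimately show ?thesis by simp
  qed
  show "(\<lambda>n. \<psi> (c * sqrt (real n) + d) - 2 / c * (a (real (Suc n)) - a (real n))) \<longlonglongrightarrow> 0"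
  proof (rule Lim_null_comparison)
    show "\<forall>\<^sub>F n in sequentially. norm (\<psi> (c * sqrt (real n) + d) - 2 / c * (a (real (Suc n)) - a (real n)))
        \<le> B / (c * sqrt (real n)) + L * (c * (sqrt (real n + 1) - sqrt (real n)))"
      using eventually_gt_at_top[of "0 :: nat"]
    proof eventually_elim
      case (elim n)
      define u where "u t = c * sqrt t + d" for t
      have "(a has_real_derivative \<Phi> (u t) / (2 * sqrt t) + c / 2 * \<psi> (u t)) (at t)" if "t > 0" for t
      proof -
        have 1: "(sqrt has_real_derivative 1 / (2 * sqrt t)) (at t)"
        proof -
          have "inverse (sqrt t) / 2 = 1 / (2 * sqrt t)" by (simp add: field_simps)
          then show ?thesis using DERIV_real_sqrt[OF that] by (simp only:)
        qed
        have "((\<lambda>t. c * sqrt t + d) has_real_derivative c * (1 / (2 * sqrt t)) + 0) (at t)"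
          by (intro DERIV_add DERIV_cmult 1 DERIV_const)
        from DERIV_mult[OF 1 DERIV_chain'[OF this deriv]]
        have "(a has_real_derivative 1 / (2 * sqrt t) * \<Phi> (u t)
            + \<psi> (u t) * (c * (1 / (2 * sqrt t)) + 0) * sqrt t) (at t)"
          unfolding a_def[abs_def] u_def .
        moreover have "1 / (2 * sqrt t) * \<Phi> (u t) + \<psi> (u t) * (c * (1 / (2 * sqrt t)) + 0) * sqrt t
            = \<Phi> (u t) / (2 * sqrt t) + c / 2 * \<psi> (u t)"
          using that by simp
        ultimately show ?thesis by (simp only:)
      qed
      moreover have "real n < real (Suc n)" by simp
      ultimately obtain z where z: "real n < z" "z < real (Suc n)"
        "a (real (Suc n)) - a (real n) = (real (Suc n) - real n) * (\<Phi> (u z) / (2 * sqrt z) + c / 2 * \<psi> (u z))"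
        using MVT2[of "real n" "real (Suc n)" a "\<lambda>t. \<Phi> (u t) / (2 * sqrt t) + c / 2 * \<psi> (u t)"] elim
        by (auto simp: less_le_trans)
      have z0: "z > 0" using z elim by (meson of_nat_0_less_iff order.strict_trans)
      have "\<psi> (u n) - 2 / c * (a (real (Suc n)) - a (real n)) = (\<psi> (u n) - \<psi> (u z)) - \<Phi> (u z) / (c * sqrt z)"
        unfolding z(3) using c z0 by (simp add: field_simps)
      also have "\<bar>\<dots>\<bar> \<le> \<bar>\<psi> (u n) - \<psi> (u z)\<bar> + \<bar>\<Phi> (u z) / (c * sqrt z)\<bar>" by (rule abs_triangle_ineq4)
      also have "\<bar>\<Phi> (u z) / (c * sqrt z)\<bar> \<le> B / (c * sqrt (real n))"
        unfolding abs_divide using z z0 c elim bounded[of "u z"] B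
        by (intro frac_le) (auto simp: abs_mult)
      also have "\<bar>\<psi> (u n) - \<psi> (u z)\<bar> \<le> L * (c * (sqrt (real n + 1) - sqrt (real n)))"
      proof -
        have "\<bar>u n - u z\<bar> = c * (sqrt z - sqrt n)"
          using z c by (simp add: u_def abs_mult flip: right_diff_distrib)
        also have "\<dots> \<le> c * (sqrt (real n + 1) - sqrt (real n))"
          using z c by (intro mult_left_mono diff_right_mono) auto
        finally show ?thesis using lipschitz[of "u n" "u z"] L
          by (meson mult_left_mono order_trans)
      qed
      finally show ?case unfolding u_def by simp
    qed
    show "(\<lambda>n. B / (c * sqrt (real n)) + L * (c * (sqrt (real n + 1) - sqrt (real n)))) \<longlonglongrightarrow> 0"
      using c by real_asymp
  qed
qed

section \<open>Moments of the sampled cosine\<close>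

lemma cos_power_lipschitz: "\<bar>cos x ^ k - cos y ^ k\<bar> \<le> real k * \<bar>x - y\<bar>" for x y :: real
proof -
  have "\<bar>cos x ^ k - cos y ^ k\<bar> \<le> real k * \<bar>cos x - cos y\<bar>"
    using norm_power_diff[of "cos x" "cos y" k] by simp
  also have "\<dots> \<le> real k * \<bar>x - y\<bar>"
    by (intro mult_left_mono abs_cos_diff_le) simp
  finally show ?thesis .
qed

text \<open>This derivative has mean zero both over [0, pi] and along the samples c sqrt n + d, so
  the arcsine moments and the Cesaro means obey the same two-step recursion.\<close>

lemma has_derivative_sin_cos_power:
  "((\<lambda>t. sin t * cos t ^ Suc j) has_real_derivative
     real (j + 2) * cos t ^ (j + 2) - real (j + 1) * cos t ^ j) (at t within S)" for t :: real
proof -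
  have s: "sin t * sin t = 1 - cos t * cos t"
    using sin_squared_eq[of t] by (simp add: power2_eq_square)
  have "((\<lambda>t. sin t * cos t ^ Suc j) has_real_derivative
      cos t * cos t ^ Suc j + (1 + real j) * (- sin t * cos t ^ j) * sin t) (at t within S)"
    by (rule DERIV_mult[OF DERIV_sin[THEN has_field_derivative_at_within] DERIV_power_Suc[OF DERIV_cos[THEN has_field_derivative_at_within]]])
  moreover have "cos t * cos t ^ Suc j + (1 + real j) * (- sin t * cos t ^ j) * sin t
      = cos t * cos t ^ Suc j - (1 + real j) * cos t ^ j * (sin t * sin t)"
    by (simp add: algebra_simps)
  ultimately show ?thesis unfolding s by (simp add: algebra_simps)
qed

definition arcsine_moment :: "nat \<Rightarrow> real" where
  "arcsine_moment j = integral {0..pi} (\<lambda>\<theta>. cos \<theta> ^ j) / pi"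

lemma arcsine_moment_0: "arcsine_moment 0 = 1"
  by (simp add: arcsine_moment_def)

lemma arcsine_moment_1: "arcsine_moment 1 = 0"
proof -
  have "((\<lambda>\<theta>. cos \<theta>) has_integral (sin pi - sin 0)) {0..pi}"
    by (rule fundamental_theorem_of_calculus)
       (auto intro!: derivative_eq_intros simp flip: has_real_derivative_iff_has_vector_derivative)
  then show ?thesis by (simp add: arcsine_moment_def integral_unique)
qed

lemma arcsine_moment_Suc_Suc:
  "arcsine_moment (j + 2) = real (j + 1) / real (j + 2) * arcsine_moment j"
proof -
  have 1: "((\<lambda>\<theta>. real (j + 2) * cos \<theta> ^ (j + 2) - real (j + 1) * cos \<theta> ^ j) has_integral
      (sin pi * cos pi ^ Suc j - sin 0 * cos 0 ^ Suc j)) {0..pi}"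
  proof (rule fundamental_theorem_of_calculus)
    fix \<theta> :: real
    show "((\<lambda>\<theta>. sin \<theta> * cos \<theta> ^ Suc j) has_vector_derivative
        real (j + 2) * cos \<theta> ^ (j + 2) - real (j + 1) * cos \<theta> ^ j) (at \<theta> within {0..pi})"
      unfolding has_real_derivative_iff_has_vector_derivative[symmetric]
      by (rule has_derivative_sin_cos_power)
  qed simp
  have 2: "((\<lambda>\<theta>. real (j + 2) * cos \<theta> ^ (j + 2) - real (j + 1) * cos \<theta> ^ j) has_integral
      (real (j + 2) * integral {0..pi} (\<lambda>\<theta>. cos \<theta> ^ (j + 2)) - real (j + 1) * integral {0..pi} (\<lambda>\<theta>. cos \<theta> ^ j))) {0..pi}"
    by (intro has_integral_diff has_integral_mult_right integrable_integral
        integrable_continuous_interval continuous_intros)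
  have "real (j + 2) * integral {0..pi} (\<lambda>\<theta>. cos \<theta> ^ (j + 2)) = real (j + 1) * integral {0..pi} (\<lambda>\<theta>. cos \<theta> ^ j)"
    using has_integral_unique[OF 1 2] by simp
  then have "integral {0..pi} (\<lambda>\<theta>. cos \<theta> ^ (j + 2)) = real (j + 1) * integral {0..pi} (\<lambda>\<theta>. cos \<theta> ^ j) / real (j + 2)"
    by (simp only: nonzero_eq_divide_eq of_nat_eq_0_iff mult.commute)
  then show ?thesis by (simp add: arcsine_moment_def)
qed

text \<open>Even powers lose the sign and follow the shared recursion. In odd powers (-1)^n survives
  and cancels against the slowly varying power of cos, in agreement with the vanishing odd moments
  of a symmetric law.\<close>

lemma moments_cos_sqrt:
  assumes c: "c > 0" and s: "s = 1 \<or> s = (-1 :: real)"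
  shows "(\<lambda>N. (\<Sum>n<N. (s * (-1) ^ n * cos (c * sqrt (real n) + d)) ^ j) / real N) \<longlonglongrightarrow> arcsine_moment j"
proof (cases "even j")
  case True
  then obtain i where j: "j = 2 * i" by blast
  have even: "(\<lambda>N. (\<Sum>n<N. cos (c * sqrt (real n) + d) ^ (2 * i)) / real N) \<longlonglongrightarrow> arcsine_moment (2 * i)"
  proof (induction i)
    case 0
    have "(\<lambda>N. real N / real N) \<longlonglongrightarrow> 1" by real_asymp
    then show ?case using arcsine_moment_0 by simp
  next
    case (Suc i)
    define \<psi> where "\<psi> t = real (2 * i + 2) * cos t ^ (2 * i + 2) - real (2 * i + 1) * cos t ^ (2 * i)" for t :: real
    have "(\<lambda>N. (\<Sum>n<N. \<psi> (c * sqrt (real n) + d)) / real N) \<longlonglongrightarrow> 0"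
    proof (rule cesaro_mean_sqrt_derivative[OF _ _ _ c])
      show "((\<lambda>t. sin t * cos t ^ Suc (2 * i)) has_real_derivative \<psi> t) (at t)" for t
        unfolding \<psi>_def by (rule has_derivative_sin_cos_power)
      show "\<bar>sin t * cos t ^ Suc (2 * i)\<bar> \<le> 1" for t :: real
        unfolding abs_mult power_abs by (intro mult_le_one power_le_one) auto
      show "\<bar>\<psi> x - \<psi> y\<bar> \<le> (real (2 * i + 2) * real (2 * i + 2) + real (2 * i + 1) * real (2 * i)) * \<bar>x - y\<bar>" for x y
      proof -
        have "\<psi> x - \<psi> y = real (2 * i + 2) * (cos x ^ (2 * i + 2) - cos y ^ (2 * i + 2))
            - real (2 * i + 1) * (cos x ^ (2 * i) - cos y ^ (2 * i))"
          by (simp only: \<psi>_def right_diff_distrib)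
        also have "\<bar>\<dots>\<bar> \<le> real (2 * i + 2) * \<bar>cos x ^ (2 * i + 2) - cos y ^ (2 * i + 2)\<bar>
            + real (2 * i + 1) * \<bar>cos x ^ (2 * i) - cos y ^ (2 * i)\<bar>"
          by (rule order_trans[OF abs_triangle_ineq4]) (simp add: abs_mult)
        also have "\<dots> \<le> real (2 * i + 2) * (real (2 * i + 2) * \<bar>x - y\<bar>) + real (2 * i + 1) * (real (2 * i) * \<bar>x - y\<bar>)"
          by (rule add_mono[OF mult_left_mono[OF cos_power_lipschitz] mult_left_mono[OF cos_power_lipschitz]]) auto
        finally show ?thesis by (simp only: distrib_right mult.assoc)
      qed
    qed
    from tendsto_add[OF tendsto_mult_left[OF this, of "1 / real (2 * i + 2)"]
        tendsto_mult_left[OF Suc.IH, of "real (2 * i + 1) / real (2 * i + 2)"]]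
    have "(\<lambda>N. 1 / real (2 * i + 2) * ((\<Sum>n<N. \<psi> (c * sqrt (real n) + d)) / real N)
        + real (2 * i + 1) / real (2 * i + 2) * ((\<Sum>n<N. cos (c * sqrt (real n) + d) ^ (2 * i)) / real N))
        \<longlonglongrightarrow> arcsine_moment (2 * i + 2)"
      by (simp only: arcsine_moment_Suc_Suc mult_zero_right add_0_left)
    moreover have "1 / real (2 * i + 2) * ((\<Sum>n<N. \<psi> (c * sqrt (real n) + d)) / real N)
        + real (2 * i + 1) / real (2 * i + 2) * ((\<Sum>n<N. cos (c * sqrt (real n) + d) ^ (2 * i)) / real N)
        = (\<Sum>n<N. cos (c * sqrt (real n) + d) ^ (2 * i + 2)) / real N" for N
    proof -
      define p where "p = real (2 * i + 2)"
      define q where "q = real (2 * i + 1)"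
      have p: "p > 0" by (simp add: p_def)
      show ?thesis unfolding \<psi>_def p_def[symmetric] q_def[symmetric] sum_subtractf sum_distrib_left[symmetric]
        using p by (simp add: diff_divide_distrib right_diff_distrib)
    qed
    ultimately show ?case by simp
  qed
  have "(s * (-1) ^ n * t) ^ j = t ^ (2 * i)" for n t
    unfolding j power_mult using s by (auto simp: power_mult_distrib power_mult[symmetric] mult.commute)
  then show ?thesis using even by (simp add: j)
next
  case False
  have "(\<lambda>N. (\<Sum>n<N. (-1) ^ n * cos (c * sqrt (real n) + d) ^ j) / real N) \<longlonglongrightarrow> 0"
  proof (rule cesaro_mean_alternating)
    show "\<bar>cos (c * sqrt (real n) + d) ^ j\<bar> \<le> 1" for n
      unfolding power_abs by (intro power_le_one) auto
    show "(\<lambda>n. cos (c * sqrt (real (Suc n)) + d) ^ j - cos (c * sqrt (real n) + d) ^ j) \<longlonglongrightarrow> 0"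
    proof (rule Lim_null_comparison)
      have "norm (cos (c * sqrt (real (Suc n)) + d) ^ j - cos (c * sqrt (real n) + d) ^ j)
          \<le> real j * (c * (sqrt (real n + 1) - sqrt (real n)))" for n
      proof -
        have "\<bar>(c * sqrt (real (Suc n)) + d) - (c * sqrt (real n) + d)\<bar> = c * (sqrt (real n + 1) - sqrt (real n))"
          using c by (simp add: add.commute abs_mult flip: right_diff_distrib)
        then show ?thesis
          using cos_power_lipschitz[of "c * sqrt (real (Suc n)) + d" j "c * sqrt (real n) + d"] by simp
      qed
      then show "\<forall>\<^sub>F n in sequentially. norm (cos (c * sqrt (real (Suc n)) + d) ^ j - cos (c * sqrt (real n) + d) ^ j)
          \<le> real j * (c * (sqrt (real n + 1) - sqrt (real n)))" by simp
      show "(\<lambda>n. real j * (c * (sqrt (real n + 1) - sqrt (real n)))) \<longlonglongrightarrow> 0" by real_asymp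
    qed
  qed
  from tendsto_mult_left[OF this, of s]
  have "(\<lambda>N. (\<Sum>n<N. s * ((-1) ^ n * cos (c * sqrt (real n) + d) ^ j)) / real N) \<longlonglongrightarrow> 0"
    by (simp add: sum_distrib_left)
  moreover have "(s * (-1) ^ n * t) ^ j = s * ((-1) ^ n * t ^ j)" for n t
  proof -
    have "((-1) ^ n) ^ j = (-1 :: real) ^ n" using False by (simp add: power_mult[symmetric] minus_one_power_iff)
    moreover have "s ^ j = s" using s False by auto
    ultimately show ?thesis by (simp add: power_mult_distrib)
  qed
  moreover have "arcsine_moment j = 0"
  proof -
    obtain i where "j = 2 * i + 1" using False oddE by blast
    moreover have "arcsine_moment (2 * i + 1) = 0"
    proof (induction i)
      case (Suc i)
      then show ?case using arcsine_moment_Suc_Suc[of "2 * i + 1"] by simp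
    qed (use arcsine_moment_1 in simp)
    ultimately show ?thesis by simp
  qed
  ultimately show ?thesis by simp
qed

section \<open>From moments to frequencies of intervals\<close>

lemma integral_diff_bound:
  fixes f g :: "real \<Rightarrow> real"
  assumes "continuous_on {a..b} f" "continuous_on {a..b} g" "a \<le> b" "B \<ge> 0"
    and "\<And>x. x \<in> {a..b} \<Longrightarrow> \<bar>f x - g x\<bar> \<le> B"
  shows "\<bar>integral {a..b} f - integral {a..b} g\<bar> \<le> B * (b - a)"
proof -
  have "((\<lambda>x. f x - g x) has_integral (integral {a..b} f - integral {a..b} g)) (cbox a b)"
    using assms by (auto intro!: has_integral_diff integrable_integral integrable_continuous_interval)
  from has_integral_bound[OF assms(4) this] assms show ?thesis by auto
qed

text \<open>On the compact interval [-1, 1] Weierstrass approximation extends convergence from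
  monomials to continuous functions; three errors of e / 4 remain below e.\<close>

lemma cesaro_mean_of_moments:
  fixes x :: "nat \<Rightarrow> real" and f :: "real \<Rightarrow> real"
  assumes x: "\<And>n. x n \<in> {-1..1}"
    and moments: "\<And>j. (\<lambda>N. (\<Sum>n<N. x n ^ j) / real N) \<longlonglongrightarrow> arcsine_moment j"
    and f: "continuous_on {-1..1} f"
  shows "(\<lambda>N. (\<Sum>n<N. f (x n)) / real N) \<longlonglongrightarrow> integral {0..pi} (\<lambda>\<theta>. f (cos \<theta>)) / pi"
proof (rule LIMSEQ_I)
  fix e :: real assume e: "e > 0"
  obtain p where p: "real_polynomial_function p" "\<And>t. t \<in> {-1..1} \<Longrightarrow> \<bar>f t - p t\<bar> < e / 4"
    using Stone_Weierstrass_real_polynomial_function[OF _ f, of "e / 4"] e by auto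
  then obtain a k where a: "p = (\<lambda>t. \<Sum>i\<le>k. a i * t ^ i)"
    unfolding real_polynomial_function_iff_sum by blast
  have "(\<lambda>N. \<Sum>i\<le>k. a i * ((\<Sum>n<N. x n ^ i) / real N)) \<longlonglongrightarrow> (\<Sum>i\<le>k. a i * arcsine_moment i)"
    by (intro tendsto_sum tendsto_mult_left moments)
  moreover have "(\<Sum>i\<le>k. a i * ((\<Sum>n<N. x n ^ i) / real N)) = (\<Sum>n<N. p (x n)) / real N" for N
    unfolding a by (subst sum.swap) (simp add: sum_distrib_left sum_divide_distrib)
  moreover have "(\<Sum>i\<le>k. a i * arcsine_moment i) = integral {0..pi} (\<lambda>\<theta>. p (cos \<theta>)) / pi"
  proof -
    have "((\<lambda>\<theta>. \<Sum>i\<le>k. a i * cos \<theta> ^ i) has_integral (\<Sum>i\<le>k. a i * integral {0..pi} (\<lambda>\<theta>. cos \<theta> ^ i))) {0..pi}"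
      by (intro has_integral_sum has_integral_mult_right integrable_integral
          integrable_continuous_interval continuous_intros) auto
    then show ?thesis by (simp add: a integral_unique arcsine_moment_def sum_divide_distrib)
  qed
  ultimately have "(\<lambda>N. (\<Sum>n<N. p (x n)) / real N) \<longlonglongrightarrow> integral {0..pi} (\<lambda>\<theta>. p (cos \<theta>)) / pi"
    by simp
  from LIMSEQ_D[OF this, of "e / 4"] e obtain N0 where
    N0: "\<And>N. N \<ge> N0 \<Longrightarrow> \<bar>(\<Sum>n<N. p (x n)) / real N - integral {0..pi} (\<lambda>\<theta>. p (cos \<theta>)) / pi\<bar> < e / 4"
    by auto
  have contf: "continuous_on {0..pi} (\<lambda>\<theta>. f (cos \<theta>))"
    by (rule continuous_on_compose2[OF f]) (auto intro!: continuous_intros)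
  have contp: "continuous_on {0..pi} (\<lambda>\<theta>. p (cos \<theta>))"
    unfolding a by (intro continuous_intros)
  have "\<bar>integral {0..pi} (\<lambda>\<theta>. f (cos \<theta>)) - integral {0..pi} (\<lambda>\<theta>. p (cos \<theta>))\<bar> \<le> e / 4 * (pi - 0)"
    using e p(2) by (intro integral_diff_bound contf contp) (auto intro: less_imp_le)
  then have int: "\<bar>integral {0..pi} (\<lambda>\<theta>. f (cos \<theta>)) / pi - integral {0..pi} (\<lambda>\<theta>. p (cos \<theta>)) / pi\<bar> \<le> e / 4"
    by (simp add: divide_le_eq flip: diff_divide_distrib)
  show "\<exists>no. \<forall>N\<ge>no. norm ((\<Sum>n<N. f (x n)) / real N - integral {0..pi} (\<lambda>\<theta>. f (cos \<theta>)) / pi) < e"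
  proof (intro exI[of _ N0] allI impI)
    fix N assume N: "N \<ge> N0"
    have "\<bar>(\<Sum>n<N. f (x n)) - (\<Sum>n<N. p (x n))\<bar> \<le> (\<Sum>n<N. e / 4)"
      unfolding sum_subtractf[symmetric]
      using p(2)[OF x] by (intro order_trans[OF sum_abs] sum_mono) (auto intro: less_imp_le)
    then have "\<bar>(\<Sum>n<N. f (x n)) / real N - (\<Sum>n<N. p (x n)) / real N\<bar> \<le> e / 4"
      using e by (cases "N = 0") (auto simp: divide_le_eq mult.commute simp flip: diff_divide_distrib)
    then show "norm ((\<Sum>n<N. f (x n)) / real N - integral {0..pi} (\<lambda>\<theta>. f (cos \<theta>)) / pi) < e"
      using N0[OF N] int e unfolding real_norm_def by linarith
  qed
qed

text \<open>The points y n may leave the interval of x n, so uniform continuity is taken on the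
  interval widened by 1.\<close>

lemma continuous_image_diff_tendsto_0:
  fixes f :: "real \<Rightarrow> real"
  assumes f: "continuous_on UNIV f" and x: "\<And>n. x n \<in> {a..b}" and xy: "(\<lambda>n. y n - x n) \<longlonglongrightarrow> 0"
  shows "(\<lambda>n. f (y n) - f (x n)) \<longlonglongrightarrow> 0"
proof (rule LIMSEQ_I)
  fix e :: real assume e: "e > 0"
  have "uniformly_continuous_on {a-1..b+1} f"
    by (intro compact_uniformly_continuous continuous_on_subset[OF f]) auto
  then obtain d where d: "d > 0" "\<And>u v. u \<in> {a-1..b+1} \<Longrightarrow> v \<in> {a-1..b+1} \<Longrightarrow> dist v u < d \<Longrightarrow> dist (f v) (f u) < e"
    using e unfolding uniformly_continuous_on_def by blast
  obtain N where N: "\<And>n. n \<ge> N \<Longrightarrow> \<bar>y n - x n\<bar> < min d 1"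
    using LIMSEQ_D[OF xy, of "min d 1"] d(1) by auto
  show "\<exists>N. \<forall>n\<ge>N. norm (f (y n) - f (x n) - 0) < e"
  proof (intro exI[of _ N] allI impI)
    fix n assume "N \<le> n"
    have "a - 1 \<le> y n \<and> y n \<le> b + 1"
      using N[OF \<open>N \<le> n\<close>] x[of n] unfolding atLeastAtMost_iff by linarith
    then show "norm (f (y n) - f (x n) - 0) < e"
      using d(2)[of "x n" "y n"] N[OF \<open>N \<le> n\<close>] x[of n] by (auto simp: dist_real_def)
  qed
qed

text \<open>Up to the factor pi and an additive constant, the distribution function of the arcsine
  law on the whole line. Clipping is needed because the widened endpoints a - eps and b + eps can
  leave [-1, 1].\<close>

definition clipped_arcsin :: "real \<Rightarrow> real" where
  "clipped_arcsin t = arcsin (max (-1) (min 1 t))"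

lemma clipped_arcsin_eq: "t \<in> {-1..1} \<Longrightarrow> clipped_arcsin t = arcsin t"
  by (simp add: clipped_arcsin_def)

lemma clipped_arcsin_mono: "s \<le> t \<Longrightarrow> clipped_arcsin s \<le> clipped_arcsin t"
  unfolding clipped_arcsin_def by (intro arcsin_le_arcsin) auto

lemma continuous_on_clipped_arcsin: "continuous_on UNIV clipped_arcsin"
  unfolding clipped_arcsin_def[abs_def] by (intro continuous_intros) auto

text \<open>As cos decreases on [0, pi], the set is an interval with endpoints given by arccos in
  reverse order. The conditions p <= 1 and -1 <= q exclude intervals missing the range of cos, which
  clamping would turn into an endpoint that cos attains.\<close>

lemma occupation_has_integral:
  assumes "p \<le> q" "p \<le> 1" "-1 \<le> q"
  shows "((\<lambda>\<theta>. if cos \<theta> \<in> {p..q} then 1 else 0) has_integral (clipped_arcsin q - clipped_arcsin p)) {0..pi}"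
proof -
  define p' where "p' = max (-1) (min 1 p)"
  define q' where "q' = max (-1) (min 1 q)"
  have p'q': "-1 \<le> p'" "p' \<le> q'" "q' \<le> 1" using assms by (auto simp: p'_def q'_def)
  have le: "arccos q' \<le> arccos p'" using p'q' by (intro arccos_le_arccos) auto
  have bounds: "0 \<le> arccos q'" "arccos p' \<le> pi" using p'q' by (auto intro: arccos_lbound arccos_ubound)
  have iff: "cos \<theta> \<in> {p..q} \<longleftrightarrow> \<theta> \<in> {arccos q'..arccos p'}" if "\<theta> \<in> {0..pi}" for \<theta>
  proof -
    have "cos \<theta> \<in> {p..q} \<longleftrightarrow> p' \<le> cos \<theta> \<and> cos \<theta> \<le> q'"
      using assms cos_ge_minus_one[of \<theta>] cos_le_one[of \<theta>] unfolding p'_def q'_def atLeastAtMost_iff by linarith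
    also have "\<dots> \<longleftrightarrow> arccos (cos \<theta>) \<le> arccos p' \<and> arccos q' \<le> arccos (cos \<theta>)"
      using p'q' by (subst (1 2) arccos_le_mono) auto
    finally show ?thesis using that by (auto simp: arccos_cos)
  qed
  have "((\<lambda>\<theta>. 1 :: real) has_integral (arccos p' - arccos q')) {arccos q'..arccos p'}"
    using has_integral_const_real[of "1 :: real" "arccos q'" "arccos p'"] le by simp
  then have "((\<lambda>\<theta>. if \<theta> \<in> {arccos q'..arccos p'} then 1 else 0 :: real) has_integral (arccos p' - arccos q')) {0..pi}"
    using bounds by (subst has_integral_restrict) auto
  then have "((\<lambda>\<theta>. if cos \<theta> \<in> {p..q} then 1 else 0) has_integral (arccos p' - arccos q')) {0..pi}"
    by (rule has_integral_cong[THEN iffD1, rotated]) (simp only: iff)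
  moreover have "arccos p' - arccos q' = clipped_arcsin q - clipped_arcsin p"
    using p'q' unfolding clipped_arcsin_def p'_def[symmetric] q'_def[symmetric]
    by (simp add: arccos_arcsin_eq)
  ultimately show ?thesis by simp
qed

text \<open>Indicators are squeezed between continuous functions. The limiting distribution function
  is continuous, so the endpoints carry no mass and the squeeze closes.\<close>

theorem arcsine_distribution:
  fixes x y :: "nat \<Rightarrow> real"
  assumes x: "\<And>n. x n \<in> {-1..1}"
    and moments: "\<And>j. (\<lambda>N. (\<Sum>n<N. x n ^ j) / real N) \<longlonglongrightarrow> arcsine_moment j"
    and xy: "(\<lambda>n. y n - x n) \<longlonglongrightarrow> 0"
    and ab: "-1 \<le> a" "a \<le> b" "b \<le> 1"
  shows "(\<lambda>N. real (card {n. n \<le> N \<and> y n \<in> {a..b}}) / real N) \<longlonglongrightarrow> (arcsin b - arcsin a) / pi"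
proof -
  define H where "H = clipped_arcsin"
  have H_ab: "H a = arcsin a" "H b = arcsin b" using ab by (auto simp: H_def clipped_arcsin_eq)
  have count: "real (card {n. n \<le> N \<and> y n \<in> {a..b}}) = (\<Sum>n<Suc N. of_bool (y n \<in> {a..b}))" for N
  proof -
    have "(\<Sum>n<Suc N. of_bool (y n \<in> {a..b}) :: real) = real (card ({..<Suc N} \<inter> {n. y n \<in> {a..b}}))"
      by (simp del: sum.lessThan_Suc)
    also have "{..<Suc N} \<inter> {n. y n \<in> {a..b}} = {n. n \<le> N \<and> y n \<in> {a..b}}" by auto
    finally show ?thesis by simp
  qed
  \<comment> \<open>Counting n <= N involves N + 1 terms but divides by N; the factor (N + 1) / N
    repairs this.\<close>
  have mean: "(\<lambda>N. (\<Sum>n<Suc N. f (y n)) / real N) \<longlonglongrightarrow> integral {0..pi} (\<lambda>\<theta>. f (cos \<theta>)) / pi"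
    if f: "continuous_on UNIV f" for f :: "real \<Rightarrow> real"
  proof -
    have "(\<lambda>N. (\<Sum>n<N. f (y n)) / real N) \<longlonglongrightarrow> integral {0..pi} (\<lambda>\<theta>. f (cos \<theta>)) / pi"
      by (rule cesaro_mean_transfer[OF cesaro_mean_of_moments[OF x moments]
            continuous_image_diff_tendsto_0[OF f x xy]])
         (rule continuous_on_subset[OF f subset_UNIV])
    from LIMSEQ_Suc[OF this]
    have "(\<lambda>N. (\<Sum>n<Suc N. f (y n)) / real (Suc N) * (real (Suc N) / real N))
        \<longlonglongrightarrow> integral {0..pi} (\<lambda>\<theta>. f (cos \<theta>)) / pi * 1"
    proof (rule tendsto_mult)
      show "(\<lambda>N. real (Suc N) / real N) \<longlonglongrightarrow> 1" by real_asymp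
    qed
    then show ?thesis by (simp del: sum.lessThan_Suc of_nat_Suc)
  qed
  have H_lim: "((\<lambda>t. H (b + r * t) - H (a - r * t)) \<longlongrightarrow> H b - H a) (at_right 0)" for r
  proof -
    have "continuous_on UNIV (\<lambda>t. H (b + r * t) - H (a - r * t))"
      unfolding H_def
      by (intro continuous_on_diff continuous_on_compose2[OF continuous_on_clipped_arcsin] continuous_intros) auto
    then have "isCont (\<lambda>t. H (b + r * t) - H (a - r * t)) 0"
      by (simp add: continuous_on_eq_continuous_at)
    then show ?thesis by (simp add: isCont_def filterlim_at_split)
  qed
  show ?thesis
  proof (rule order_tendstoI)
    fix l assume l: "(arcsin b - arcsin a) / pi < l"
    then have "H b - H a < l * pi" by (simp add: H_ab pos_divide_less_eq)
    from order_tendstoD(2)[OF H_lim[of 1] this] eventually_at_right_less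
    have "\<forall>\<^sub>F t in at_right 0. 0 < t \<and> H (b + 1 * t) - H (a - 1 * t) < l * pi" by (rule eventually_conj[rotated])
    then have "\<exists>t. 0 < t \<and> H (b + 1 * t) - H (a - 1 * t) < l * pi"
      by (rule eventually_happens'[rotated]) simp
    then obtain \<epsilon> where \<epsilon>: "0 < \<epsilon>" "H (b + \<epsilon>) - H (a - \<epsilon>) < l * pi"
      unfolding mult_1 by blast
    \<comment> \<open>\<open>max a (min b t)\<close> is the point of [a, b] nearest to t, so f is 1
      on the interval and falls linearly to 0 at distance \<open>\<epsilon>\<close>.\<close>
    define f where "f t = max 0 (1 - \<bar>t - max a (min b t)\<bar> / \<epsilon>)" for t :: real
    have f: "continuous_on S f" for S unfolding f_def using \<epsilon>(1) by (intro continuous_intros) auto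
    have f_ge: "of_bool (t \<in> {a..b}) \<le> f t" for t by (auto simp: f_def)
    have f_le: "f t \<le> (if t \<in> {a-\<epsilon>..b+\<epsilon>} then 1 else 0)" for t
    proof (cases "t \<in> {a-\<epsilon>..b+\<epsilon>}")
      case False
      then have "\<epsilon> \<le> \<bar>t - max a (min b t)\<bar>" using \<epsilon>(1) ab by (auto simp: max_def min_def)
      then show ?thesis using \<epsilon>(1) False by (simp add: f_def pos_le_divide_eq)
    qed (use \<epsilon>(1) in \<open>simp add: f_def\<close>)
    have "integral {0..pi} (\<lambda>\<theta>. f (cos \<theta>)) \<le> H (b + \<epsilon>) - H (a - \<epsilon>)"
    proof (rule has_integral_le)
      show "((\<lambda>\<theta>. f (cos \<theta>)) has_integral integral {0..pi} (\<lambda>\<theta>. f (cos \<theta>))) {0..pi}"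
        by (intro integrable_integral integrable_continuous_interval continuous_on_compose2[OF f] continuous_intros) auto
      show "((\<lambda>\<theta>. if cos \<theta> \<in> {a-\<epsilon>..b+\<epsilon>} then 1 else 0) has_integral (H (b + \<epsilon>) - H (a - \<epsilon>))) {0..pi}"
        unfolding H_def using \<epsilon>(1) ab by (intro occupation_has_integral) auto
    qed (rule f_le)
    then have "integral {0..pi} (\<lambda>\<theta>. f (cos \<theta>)) / pi < l"
      using \<epsilon>(2) by (simp add: pos_divide_less_eq)
    from order_tendstoD(2)[OF mean[OF f] this]
    show "\<forall>\<^sub>F N in sequentially. real (card {n. n \<le> N \<and> y n \<in> {a..b}}) / real N < l"
    proof eventually_elim
      case (elim N)
      have "(\<Sum>n<Suc N. of_bool (y n \<in> {a..b})) / real N \<le> (\<Sum>n<Suc N. f (y n)) / real N"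
        by (intro divide_right_mono sum_mono f_ge) simp
      then show ?case using elim unfolding count by linarith
    qed
  next
    fix l assume l: "l < (arcsin b - arcsin a) / pi"
    then have "l * pi < H b - H a" by (simp add: H_ab pos_less_divide_eq)
    from order_tendstoD(1)[OF H_lim[of "-1"] this] eventually_at_right_less
    have "\<forall>\<^sub>F t in at_right 0. 0 < t \<and> l * pi < H (b + (-1) * t) - H (a - (-1) * t)" by (rule eventually_conj[rotated])
    then have "\<exists>t. 0 < t \<and> l * pi < H (b + (-1) * t) - H (a - (-1) * t)"
      by (rule eventually_happens'[rotated]) simp
    then obtain \<epsilon> where \<epsilon>: "0 < \<epsilon>" "l * pi < H (b - \<epsilon>) - H (a + \<epsilon>)"
      by auto
    show "\<forall>\<^sub>F N in sequentially. l < real (card {n. n \<le> N \<and> y n \<in> {a..b}}) / real N"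
    proof (cases "a + \<epsilon> \<le> b - \<epsilon>")
      \<comment> \<open>Here no inner interval remains; monotonicity forces l < 0, and frequencies
        are nonnegative.\<close>
      case False
      then have "H (b - \<epsilon>) \<le> H (a + \<epsilon>)" unfolding H_def by (intro clipped_arcsin_mono) simp
      then have "l * pi < 0" using \<epsilon>(2) by linarith
      then have "l < 0" by (simp add: mult_less_0_iff)
      then have "l < real (card {n. n \<le> N \<and> y n \<in> {a..b}}) / real N" for N
        by (rule less_le_trans) simp
      then show ?thesis by simp
    next
      case True
      \<comment> \<open>A trapezoid inside [a, b]: 0 at and beyond the endpoints, 1 from distance
        \<open>\<epsilon>\<close> inwards.\<close>
      define f where "f t = min 1 (max 0 (min (t - a) (b - t)) / \<epsilon>)" for t :: real
      have f: "continuous_on S f" for S unfolding f_def using \<epsilon>(1) by (intro continuous_intros) auto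
      have f_le: "f t \<le> of_bool (t \<in> {a..b})" for t
        using \<epsilon>(1) by (auto simp: f_def max_def min_def)
      have f_ge: "(if t \<in> {a+\<epsilon>..b-\<epsilon>} then 1 else 0) \<le> f t" for t
      proof (cases "t \<in> {a+\<epsilon>..b-\<epsilon>}")
        case True
        then have "\<epsilon> \<le> max 0 (min (t - a) (b - t))" using \<epsilon>(1) by auto
        then show ?thesis using \<epsilon>(1) True by (simp add: f_def pos_le_divide_eq)
      qed (use \<epsilon>(1) in \<open>simp add: f_def\<close>)
      have "H (b - \<epsilon>) - H (a + \<epsilon>) \<le> integral {0..pi} (\<lambda>\<theta>. f (cos \<theta>))"
      proof (rule has_integral_le)
        show "((\<lambda>\<theta>. f (cos \<theta>)) has_integral integral {0..pi} (\<lambda>\<theta>. f (cos \<theta>))) {0..pi}"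
          by (intro integrable_integral integrable_continuous_interval continuous_on_compose2[OF f] continuous_intros) auto
        show "((\<lambda>\<theta>. if cos \<theta> \<in> {a+\<epsilon>..b-\<epsilon>} then 1 else 0) has_integral (H (b - \<epsilon>) - H (a + \<epsilon>))) {0..pi}"
          unfolding H_def using True \<epsilon>(1) ab by (intro occupation_has_integral) auto
      qed (rule f_ge)
      then have "l < integral {0..pi} (\<lambda>\<theta>. f (cos \<theta>)) / pi"
        using \<epsilon>(2) by (simp add: pos_less_divide_eq)
      from order_tendstoD(1)[OF mean[OF f] this]
      show ?thesis
      proof eventually_elim
        case (elim N)
        have "(\<Sum>n<Suc N. f (y n)) / real N \<le> (\<Sum>n<Suc N. of_bool (y n \<in> {a..b})) / real N"
          by (intro divide_right_mono sum_mono f_le) simp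
        then show ?case using elim unfolding count by linarith
      qed
    qed
  qed
qed

text \<open>The density blows up at -R and R, which [alpha, beta] may contain, so the fundamental
  theorem is applied with derivatives in the interior and a primitive continuous up to the
  boundary.\<close>

lemma arcsine_density_integral:
  assumes R: "R > 0" and ab: "- R \<le> \<alpha>" "\<alpha> \<le> \<beta>" "\<beta> \<le> R"
  shows "integral {\<alpha>..\<beta>} (\<lambda>y. 1 / (pi * sqrt (R\<^sup>2 - y\<^sup>2))) = (arcsin (\<beta> / R) - arcsin (\<alpha> / R)) / pi"
proof -
  have "((\<lambda>y. 1 / (pi * sqrt (R\<^sup>2 - y\<^sup>2))) has_integral (arcsin (\<beta> / R) / pi - arcsin (\<alpha> / R) / pi)) {\<alpha>..\<beta>}"
  proof (rule fundamental_theorem_of_calculus_interior)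
    show "continuous_on {\<alpha>..\<beta>} (\<lambda>y. arcsin (y / R) / pi)"
      using R ab by (intro continuous_intros) (auto simp: field_simps)
    fix y assume y: "y \<in> {\<alpha><..<\<beta>}"
    have lt: "-1 < y / R" "y / R < 1" using y R ab by (auto simp: field_simps)
    have "sqrt (1 - (y / R)\<^sup>2) * R = sqrt ((1 - (y / R)\<^sup>2) * R\<^sup>2)"
      using R by (simp add: real_sqrt_mult)
    also have "(1 - (y / R)\<^sup>2) * R\<^sup>2 = R\<^sup>2 - y\<^sup>2"
      using R by (simp add: power_divide left_diff_distrib)
    finally have "inverse (sqrt (1 - (y / R)\<^sup>2)) * (1 / R) = inverse (sqrt (R\<^sup>2 - y\<^sup>2))"
      by (metis inverse_eq_divide inverse_mult_distrib)
    moreover have "((\<lambda>y. arcsin (y / R) / pi) has_real_derivative inverse (sqrt (1 - (y / R)\<^sup>2)) * (1 / R) / pi) (at y)"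
      by (intro DERIV_cdivide DERIV_chain2[where g = "\<lambda>y. y / R", OF DERIV_arcsin[OF lt]] DERIV_ident)
    ultimately show "((\<lambda>y. arcsin (y / R) / pi) has_vector_derivative 1 / (pi * sqrt (R\<^sup>2 - y\<^sup>2))) (at y)"
      by (simp add: has_real_derivative_iff_has_vector_derivative[symmetric] field_simps)
  qed (use ab in simp)
  then show ?thesis by (simp add: integral_unique diff_divide_distrib)
qed

section \<open>Eigenvalues of the quantum Rabi model\<close>

lemma rabi_eigenvalue_normalized:
  assumes "ev \<in> rabi_eigenvalues s \<Delta> g"
  obtains u where "square_summable u" "(\<Sum>k. (u k)\<^sup>2) = 1" "\<And>k. rabi_jacobi s \<Delta> g u k = ev * u k"
proof -
  from assms obtain w j where w: "square_summable w" "w j \<noteq> 0" "\<And>k. rabi_jacobi s \<Delta> g w k = ev * w k"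
    unfolding rabi_eigenvalues_def by blast
  define S where "S = (\<Sum>k. (w k)\<^sup>2)"
  have S: "S > 0" unfolding S_def by (rule suminf_pos2[OF w(1), of j]) (use w(2) in auto)
  define u where "u k = w k / sqrt S" for k
  have usq: "(u k)\<^sup>2 = (w k)\<^sup>2 / S" for k using S by (simp add: u_def power_divide)
  have "square_summable u" unfolding usq by (rule summable_divide[OF w(1)])
  moreover have "(\<Sum>k. (u k)\<^sup>2) = 1"
    unfolding usq using S by (simp add: suminf_divide[OF w(1)] S_def[symmetric])
  moreover have "rabi_jacobi s \<Delta> g u k = ev * u k" for k
  proof -
    have "rabi_jacobi s \<Delta> g u k = rabi_jacobi s \<Delta> g w k / sqrt S"
      by (simp add: rabi_jacobi_def u_def add_divide_distrib)
    then show ?thesis by (simp add: w(3) u_def)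
  qed
  ultimately show thesis by (rule that)
qed

text \<open>The twist (-1)^k flips the off-diagonal sign to match \<open>charlier_eigen\<close> and
  cancels the alternating sign of the perturbation. Pairing the eigenvalue equation with a twisted
  Charlier row and shifting the off-diagonal terms onto that row gives the equation in the
  unperturbed eigenbasis.\<close>

lemma rabi_eigenvector_expansion:
  fixes u :: "nat \<Rightarrow> real"
  assumes u: "square_summable u" and eigen: "\<And>k. rabi_jacobi s \<Delta> g u k = ev * u k"
  defines "c \<equiv> mat_apply (charlier g) (\<lambda>k. (-1) ^ k * u k)"
  shows "square_summable c" "(\<Sum>m. (c m)\<^sup>2) = (\<Sum>k. (u k)\<^sup>2)"
    and "(ev - real m + g\<^sup>2) * c m = s * \<Delta> * mat_apply (charlier (2 * g)) c m"
proof -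
  define u' where "u' k = (-1) ^ k * u k" for k
  have sgn: "((-1 :: real) ^ k)\<^sup>2 = 1" for k by (cases "even k") simp_all
  have u'_sq: "(u' k)\<^sup>2 = (u k)\<^sup>2" for k by (simp add: u'_def power_mult_distrib sgn)
  have u': "square_summable u'" unfolding u'_sq by (rule u)
  have c: "c = mat_apply (charlier g) u'" by (simp add: c_def u'_def[abs_def])
  show sq: "square_summable c" unfolding c by (rule charlier.square_summable_apply[OF u'])
  show "(\<Sum>m. (c m)\<^sup>2) = (\<Sum>k. (u k)\<^sup>2)" unfolding c charlier.Parseval[OF u'] u'_sq ..
  \<comment> \<open>Here u = P u' and u' = C c because C is an involution, so v = C u = C P C c is
    the perturbation matrix applied to c.\<close>
  define v where "v = mat_apply (charlier g) u"
  have v: "v m = mat_apply (charlier (2 * g)) c m"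
  proof -
    define f where "f k = (-1) ^ k * charlier g m k" for k
    have f: "square_summable f"
      using square_summable_charlier[of g m] by (simp add: f_def power_mult_distrib sgn)
    have f_apply: "mat_apply (charlier g) f k = charlier (2 * g) m k" for k
      unfolding mat_apply_def charlier_alternating_product[symmetric] f_def
      by (rule suminf_cong) simp
    have "v m = (\<Sum>k. mat_apply (charlier g) c k * f k)"
      unfolding v_def mat_apply_def[of "charlier g" u] c charlier.apply_apply[OF u']
      by (rule suminf_cong) (simp add: u'_def f_def)
    also have "\<dots> = (\<Sum>k. c k * mat_apply (charlier g) f k)"
      by (rule charlier.self_adjoint[OF sq f])
    finally show ?thesis unfolding f_apply by (simp add: mat_apply_def mult.commute)
  qed
  \<comment> \<open>Boundedness of u is enough for the series below, because Charlier rows decay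
    geometrically; no decay of k * u k has to be known.\<close>
  obtain U where U: "\<And>k. \<bar>u k\<bar> \<le> U"
  proof -
    have "\<bar>u k\<bar> \<le> sqrt (\<Sum>k. (u k)\<^sup>2)" for k
      using sum_le_suminf[OF u, of "{k}"] by (intro real_le_rsqrt) simp
    then show thesis using that by blast
  qed
  have U0: "U \<ge> 0" using U[of 0] by linarith
  have bound: "\<bar>a * t\<bar> \<le> b * U * real (Suc k)" if "\<bar>a\<bar> \<le> b * real (Suc k)" "\<bar>t\<bar> \<le> U" for a b t k
  proof -
    have "\<bar>a\<bar> * \<bar>t\<bar> \<le> (b * real (Suc k)) * U" using that by (intro mult_mono) auto
    then show ?thesis by (simp add: abs_mult mult_ac)
  qed
  have summ: "summable (\<lambda>k. (-1) ^ k * charlier g m k * (a k * t k))"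
    if "\<And>k. \<bar>a k\<bar> \<le> b * real (Suc k)" "\<And>k. \<bar>t k\<bar> \<le> U" for a b t
  proof -
    have "\<bar>((-1) ^ k * a k) * t k\<bar> \<le> b * U * real (Suc k)" for k
      using that by (intro bound) (auto simp: abs_mult power_abs)
    then have "summable (\<lambda>k. charlier g m k * (((-1) ^ k * a k) * t k))" by (rule charlier_summable_mult)
    then show ?thesis by (simp add: mult_ac)
  qed
  \<comment> \<open>\<open>A\<close>, \<open>P\<close> and \<open>Q\<close> are the diagonal, lower
    and upper terms of the matrix acting on u. \<open>R\<close> is \<open>Q\<close> shifted by one
    index, and the shifted \<open>P\<close> is the other half of the transposed action on the row;
    both shifts are free since P 0 = R 0 = 0.\<close>
  define \<phi> where "\<phi> k = (-1) ^ k * charlier g m k" for k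
  define A where "A k = \<phi> k * (real k * u k)" for k
  define P where "P k = \<phi> k * (g * sqrt (real k) * u (k - 1))" for k
  define Q where "Q k = \<phi> k * (g * sqrt (real (Suc k)) * u (Suc k))" for k
  define R where "R k = \<phi> (k - 1) * (g * sqrt (real k) * u k)" for k
  have A: "A sums suminf A"
    unfolding A_def \<phi>_def by (intro summable_sums summ[where b = 1] U) simp
  have sq_bound: "\<bar>g * sqrt (real k)\<bar> \<le> \<bar>g\<bar> * real (Suc k)" "\<bar>g * sqrt (real (Suc k))\<bar> \<le> \<bar>g\<bar> * real (Suc k)" for k
  proof -
    have "sqrt (real k) \<le> real (Suc k)" "sqrt (real (Suc k)) \<le> real (Suc k)"
      by (auto intro!: real_le_lsqrt simp: power2_eq_square algebra_simps)
    then show "\<bar>g * sqrt (real k)\<bar> \<le> \<bar>g\<bar> * real (Suc k)" "\<bar>g * sqrt (real (Suc k))\<bar> \<le> \<bar>g\<bar> * real (Suc k)"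
      by (simp_all add: abs_mult mult_left_mono del: of_nat_Suc)
  qed
  have P: "P sums suminf P"
    unfolding P_def \<phi>_def by (intro summable_sums summ[where b = "\<bar>g\<bar>"] U sq_bound)
  have Q: "Q sums suminf Q"
    unfolding Q_def \<phi>_def by (intro summable_sums summ[where b = "\<bar>g\<bar>"] U sq_bound)
  have P_Suc: "(\<lambda>k. P (Suc k)) sums suminf P"
    using P sums_Suc_iff[of P "suminf P"] by (simp add: P_def)
  have "(\<lambda>k. R (Suc k)) sums suminf Q"
    using Q by (simp add: R_def Q_def[abs_def])
  then have R: "R sums suminf Q"
    using sums_Suc[of R] by (simp add: R_def)
  have c_sums: "(\<lambda>k. charlier g m k * u' k) sums c m"
    unfolding c mat_apply_def by (intro summable_sums charlier.summable_row_mult u')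
  have v_sums: "(\<lambda>k. charlier g m k * u k) sums v m"
    unfolding v_def mat_apply_def by (intro summable_sums charlier.summable_row_mult u)
  have "A k + P k + Q k + s * \<Delta> * (charlier g m k * u k) = ev * (charlier g m k * u' k)" for k
  proof -
    have "(-1) ^ k * (-1) ^ k = (1 :: real)" by (simp flip: power_mult_distrib)
    then have "A k + P k + Q k + s * \<Delta> * (charlier g m k * u k) = \<phi> k * rabi_jacobi s \<Delta> g u k"
      by (simp add: A_def P_def Q_def \<phi>_def rabi_jacobi_def rabi_diag_def rabi_offdiag_def algebra_simps
          del: of_nat_Suc)
    then show ?thesis by (simp add: eigen \<phi>_def u'_def)
  qed
  with sums_add[OF sums_add[OF sums_add[OF A P] Q] sums_mult[OF v_sums, of "s * \<Delta>"]]
  have "(\<lambda>k. ev * (charlier g m k * u' k)) sums (suminf A + suminf P + suminf Q + s * \<Delta> * v m)" by simp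
  from sums_unique2[OF this sums_mult[OF c_sums]]
  have 1: "suminf A + suminf P + suminf Q + s * \<Delta> * v m = ev * c m" .
  have "A k + P (Suc k) + R k = (real m - g\<^sup>2) * (charlier g m k * u' k)" for k
  proof -
    have sign: "(-1) ^ (k - 1) * sqrt (real k) = - ((-1) ^ k * sqrt (real k))" by (cases k) auto
    have "R k = ((-1) ^ (k - 1) * sqrt (real k)) * (g * charlier g m (k - 1) * u k)"
      by (simp only: R_def \<phi>_def mult_ac)
    then have R_eq: "R k = - ((-1) ^ k * g * sqrt (real k) * charlier g m (k - 1) * u k)"
      unfolding sign by (simp only: mult_ac mult_minus_left mult_minus_right)
    have "A k + P (Suc k) + R k = u' k * (real k * charlier g m k - g * sqrt (real k) * charlier g m (k - 1)
        - g * sqrt (real (Suc k)) * charlier g m (Suc k))"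
      unfolding R_eq by (simp add: A_def P_def \<phi>_def u'_def algebra_simps del: of_nat_Suc)
    then show ?thesis unfolding charlier_eigen by simp
  qed
  with sums_add[OF sums_add[OF A P_Suc] R]
  have "(\<lambda>k. (real m - g\<^sup>2) * (charlier g m k * u' k)) sums (suminf A + suminf P + suminf Q)" by simp
  from sums_unique2[OF this sums_mult[OF c_sums]]
  have 2: "suminf A + suminf P + suminf Q = (real m - g\<^sup>2) * c m" .
  show "(ev - real m + g\<^sup>2) * c m = s * \<Delta> * mat_apply (charlier (2 * g)) c m"
    using 1 2 unfolding v[symmetric] by (simp add: algebra_simps)
qed

text \<open>The bound 4 L <= 3 n keeps j >= n / 4, so sqrt j >= sqrt n / 2; the second bound then
  places every pair of the window in the range of \<open>charlier_offdiag_bound\<close>,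
  uniformly.\<close>

lemma charlier_near_diagonal_small:
  assumes B: "B > 0" and mj: "m \<in> {n - L..n + L}" "j \<in> {n - L..n + L}"
    and L: "4 * real L \<le> 3 * real n" "2 * real L + B\<^sup>2 \<le> B * (sqrt (real n) / 2)" and n: "n > 0"
  shows "\<bar>charlier B m j\<bar> \<le> sqrt (4 * (2 + 1 / B)) * real n powr (- (1/4))"
proof -
  have mj': "\<bar>real j - real m\<bar> \<le> 2 * real L" "real n - real L \<le> real j"
    using mj by auto
  have "sqrt (real n / 4) \<le> sqrt (real j)" using mj' L(1) by simp
  then have sq: "sqrt (real n) / 2 \<le> sqrt (real j)" by (simp add: real_sqrt_divide)
  have "\<bar>real j - real m + B\<^sup>2\<bar> \<le> 2 * real L + B\<^sup>2" using mj'(1) zero_le_power2[of B] by linarith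
  also have "\<dots> \<le> B * sqrt (real j)" using L(2) mult_left_mono[OF sq, of B] B by linarith
  finally have *: "(charlier B m j)\<^sup>2 * sqrt (real j) \<le> 2 * (2 + 1 / B)"
    by (rule charlier_offdiag_bound[OF B])
  have "(charlier B m j)\<^sup>2 * (sqrt (real n) / 2) \<le> 2 * (2 + 1 / B)"
    using * mult_left_mono[OF sq, of "(charlier B m j)\<^sup>2"] by simp
  then have le: "(charlier B m j)\<^sup>2 \<le> 4 * (2 + 1 / B) / sqrt (real n)"
    using n by (simp add: pos_le_divide_eq)
  have "(sqrt (4 * (2 + 1 / B)) * real n powr (- (1/4)))\<^sup>2 = 4 * (2 + 1 / B) * (real n powr (- (1/4)))\<^sup>2"
    using B by (simp add: power_mult_distrib)
  also have "(real n powr (- (1/4)))\<^sup>2 = real n powr (- (1/2))"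
    by (simp add: power2_eq_square powr_add[symmetric])
  also have "\<dots> = 1 / sqrt (real n)" using n by (simp add: powr_minus_divide powr_half_sqrt)
  finally have "(charlier B m j)\<^sup>2 \<le> (sqrt (4 * (2 + 1 / B)) * real n powr (- (1/4)))\<^sup>2"
    using le by simp
  then show ?thesis using B by (simp add: abs_le_square_iff[symmetric] abs_mult)
qed

text \<open>The n-th component of the eigenvalue equation reads (E_n - n + g^2) c_n = s \<Delta> (T
  c)_n, and (T c)_n is T(n, n) c_n up to a small error. Dividing by c_n is safe once |c_n| >=
  1/2.\<close>

lemma rabi_first_order:
  assumes g: "g > 0" and \<Delta>: "\<Delta> > 0" and s: "s = 1 \<or> s = -1"
    and E: "\<And>n. E n \<in> rabi_eigenvalues s \<Delta> g" and lim: "(\<lambda>n. E n - (real n - g\<^sup>2)) \<longlonglongrightarrow> 0"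
  shows "(\<lambda>n. real n powr (1/4) * (E n - (real n - g\<^sup>2) - s * \<Delta> * charlier (2 * g) n n)) \<longlonglongrightarrow> 0"
proof -
  define K where "K = sqrt (4 * (2 + 1 / (2 * g)))"
  have K: "K > 0" using g by (simp add: K_def add_pos_pos)
  \<comment> \<open>The exponent 1/3 balances the errors n^(-1/2) sqrt L and 1 / L; both become
    n^(-1/3).\<close>
  define l where "l n = real n powr (1/3)" for n :: nat
  define L where "L n = nat \<lceil>l n\<rceil>" for n
  define \<eta> where "\<eta> n = K * real n powr (- (1/4))" for n :: nat
  define \<kappa> where "\<kappa> n = \<eta> n * (1 + 4 * \<Delta>) + 2 * \<Delta> / l n" for n
  define \<rho> where "\<rho> n = 8 * \<Delta> * \<eta> n * \<kappa> n * sqrt (2 * l n) + 2 * \<Delta> / l n" for n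
  have ev_L: "\<forall>\<^sub>F n in sequentially. l n \<ge> 1 \<and> 8 * l n \<le> 3 * real n
      \<and> 4 * l n + (2 * g)\<^sup>2 \<le> 2 * g * (sqrt (real n) / 2)"
    unfolding l_def using g by (intro eventually_conj; real_asymp)
  \<comment> \<open>The bound 3/4 on 1 - (c n)^2 is what yields |c n| >= 1/2.\<close>
  have ev_\<kappa>: "\<forall>\<^sub>F n in sequentially. (4 * \<Delta> * \<kappa> n)\<^sup>2 + (2 * \<Delta> / l n)\<^sup>2 \<le> 3 / 4"
  proof -
    have "(\<lambda>n. (4 * \<Delta> * \<kappa> n)\<^sup>2 + (2 * \<Delta> / l n)\<^sup>2) \<longlonglongrightarrow> 0"
      unfolding \<kappa>_def \<eta>_def l_def using \<Delta> K by real_asymp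
    from order_tendstoD(2)[OF this, of "3/4"] show ?thesis
      by (auto elim: eventually_mono)
  qed
  have ev_\<epsilon>: "\<forall>\<^sub>F n in sequentially. \<bar>E n - (real n - g\<^sup>2)\<bar> < 1 / 2"
    using tendstoD[OF lim, of "1/2"] by (simp add: dist_real_def)
  have "(\<lambda>n. real n powr (1/4) * (2 * \<Delta> * \<rho> n)) \<longlonglongrightarrow> 0"
    unfolding \<rho>_def \<kappa>_def \<eta>_def l_def using \<Delta> K by real_asymp
  moreover have "\<forall>\<^sub>F n in sequentially. norm (real n powr (1/4) * (E n - (real n - g\<^sup>2) - s * \<Delta> * charlier (2 * g) n n))
      \<le> real n powr (1/4) * (2 * \<Delta> * \<rho> n)"
    using ev_L ev_\<kappa> ev_\<epsilon> eventually_gt_at_top[of "0 :: nat"]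
  proof eventually_elim
    case (elim n)
    define \<epsilon> where "\<epsilon> = E n - (real n - g\<^sup>2)"
    have l: "l n \<ge> 1" using elim by simp
    have L: "l n \<le> real (L n)" "real (L n) \<le> 2 * l n" using l unfolding L_def by linarith+
    have "real (L n) > 0" using l L by linarith
    then have L0: "L n > 0" by simp
    obtain u where u: "square_summable u" "(\<Sum>k. (u k)\<^sup>2) = 1" "\<And>k. rabi_jacobi s \<Delta> g u k = E n * u k"
      using rabi_eigenvalue_normalized[OF E[of n]] by blast
    define c where "c = mat_apply (charlier g) (\<lambda>k. (-1) ^ k * u k)"
    define v where "v = mat_apply (charlier (2 * g)) c"
    have c: "square_summable c" "(\<Sum>m. (c m)\<^sup>2) = 1"
      and cv: "\<And>m. (E n - real m + g\<^sup>2) * c m = s * \<Delta> * v m"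
      using rabi_eigenvector_expansion[OF u(1,3)] u(2) by (simp_all add: c_def v_def)
    have abs_s: "\<bar>s\<bar> = 1" using s by auto
    \<comment> \<open>A shift of less than 1/2 is at most half of the distance |n - m| >= 1; this is
      the origin of the factor 2.\<close>
    have c_le: "\<bar>c m\<bar> * \<bar>real n - real m\<bar> \<le> 2 * \<Delta> * \<bar>v m\<bar>" if "m \<noteq> n" for m
    proof -
      have "\<bar>real n - real m\<bar> \<ge> 1" using that by (cases "m < n") (auto simp: abs_if)
      moreover have "E n - real m + g\<^sup>2 = (real n - real m) + \<epsilon>" by (simp add: \<epsilon>_def)
      moreover have "\<bar>d\<bar> \<le> 2 * \<bar>d + e\<bar>" if "1 \<le> \<bar>d\<bar>" "\<bar>e\<bar> < 1/2" for d e :: real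
        using that by (auto simp: abs_if split: if_splits)
      ultimately have "\<bar>real n - real m\<bar> \<le> 2 * \<bar>E n - real m + g\<^sup>2\<bar>"
        using elim(3) unfolding \<epsilon>_def[symmetric] by (simp only:)
      then have "\<bar>c m\<bar> * \<bar>real n - real m\<bar> \<le> \<bar>c m\<bar> * (2 * \<bar>E n - real m + g\<^sup>2\<bar>)"
        by (intro mult_left_mono) auto
      also have "\<dots> = 2 * \<bar>(E n - real m + g\<^sup>2) * c m\<bar>" by (simp add: abs_mult)
      also have "\<dots> = 2 * \<Delta> * \<bar>v m\<bar>" unfolding cv using \<Delta> abs_s by (simp add: abs_mult)
      finally show ?thesis .
    qed
    have small: "\<bar>charlier (2 * g) m j\<bar> \<le> \<eta> n" if "m \<in> {n - L n..n + L n}" "j \<in> {n - L n..n + L n}" for m j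
      unfolding \<eta>_def K_def
      using elim L g by (intro charlier_near_diagonal_small[OF _ that]) auto
    have pert: "\<bar>v n - charlier (2 * g) n n * c n\<bar>
        \<le> 8 * \<Delta> * \<eta> n * (\<eta> n * (1 + 4 * \<Delta>) + 2 * \<Delta> / L n) * sqrt (L n) + 2 * \<Delta> / L n"
      "1 - (c n)\<^sup>2 \<le> (4 * \<Delta> * (\<eta> n * (1 + 4 * \<Delta>) + 2 * \<Delta> / L n))\<^sup>2 + (2 * \<Delta> / L n)\<^sup>2"
      using charlier.first_order_perturbation[OF c _ L0 c_le[unfolded v_def] small] \<Delta>
      unfolding v_def by simp_all
    have \<eta>: "\<eta> n \<ge> 0" using K by (simp add: \<eta>_def)
    have inv_L: "2 * \<Delta> / real (L n) \<le> 2 * \<Delta> / l n" using L l \<Delta> by (intro divide_left_mono) auto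
    have inv_L0: "0 \<le> 2 * \<Delta> / real (L n)" using \<Delta> by simp
    have \<kappa>_le: "\<eta> n * (1 + 4 * \<Delta>) + 2 * \<Delta> / L n \<le> \<kappa> n" "0 \<le> \<eta> n * (1 + 4 * \<Delta>) + 2 * \<Delta> / L n"
      using inv_L inv_L0 \<eta> \<Delta> by (auto simp: \<kappa>_def)
    then have \<kappa>: "0 \<le> \<kappa> n" by linarith
    have "8 * \<Delta> * \<eta> n * (\<eta> n * (1 + 4 * \<Delta>) + 2 * \<Delta> / L n) * sqrt (L n) \<le> 8 * \<Delta> * \<eta> n * \<kappa> n * sqrt (2 * l n)"
      using \<kappa>_le \<kappa> L \<eta> \<Delta> by (intro mult_mono mult_left_mono) auto
    then have \<rho>_ge: "\<bar>v n - charlier (2 * g) n n * c n\<bar> \<le> \<rho> n"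
      using pert(1) inv_L unfolding \<rho>_def by linarith
    have "(4 * \<Delta> * (\<eta> n * (1 + 4 * \<Delta>) + 2 * \<Delta> / L n))\<^sup>2 \<le> (4 * \<Delta> * \<kappa> n)\<^sup>2"
      using \<kappa>_le \<Delta> by (intro power_mono mult_left_mono) auto
    moreover have "(2 * \<Delta> / L n)\<^sup>2 \<le> (2 * \<Delta> / l n)\<^sup>2" by (rule power_mono[OF inv_L inv_L0])
    ultimately have "(1/2)\<^sup>2 \<le> (c n)\<^sup>2"
      using pert(2) elim(2) by (simp add: power2_eq_square)
    then have c_n: "1/2 \<le> \<bar>c n\<bar>" by (subst (asm) abs_le_square_iff[symmetric]) simp
    have "(\<epsilon> - s * \<Delta> * charlier (2 * g) n n) * c n = s * \<Delta> * (v n - charlier (2 * g) n n * c n)"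
      using cv[of n] by (simp add: \<epsilon>_def algebra_simps)
    then have "\<bar>\<epsilon> - s * \<Delta> * charlier (2 * g) n n\<bar> * \<bar>c n\<bar> = \<bar>s * \<Delta> * (v n - charlier (2 * g) n n * c n)\<bar>"
      by (simp only: abs_mult[symmetric])
    also have "\<dots> = \<Delta> * \<bar>v n - charlier (2 * g) n n * c n\<bar>"
      using \<Delta> abs_s by (simp add: abs_mult)
    also have "\<dots> \<le> \<Delta> * \<rho> n" using \<rho>_ge \<Delta> by simp
    finally have "\<bar>\<epsilon> - s * \<Delta> * charlier (2 * g) n n\<bar> * \<bar>c n\<bar> \<le> \<Delta> * \<rho> n" .
    moreover have "\<bar>\<epsilon> - s * \<Delta> * charlier (2 * g) n n\<bar> * (1/2) \<le> \<bar>\<epsilon> - s * \<Delta> * charlier (2 * g) n n\<bar> * \<bar>c n\<bar>"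
      by (rule mult_left_mono[OF c_n]) simp
    ultimately have "\<bar>\<epsilon> - s * \<Delta> * charlier (2 * g) n n\<bar> * (1/2) \<le> \<Delta> * \<rho> n"
      by (rule order_trans[rotated])
    then have "\<bar>\<epsilon> - s * \<Delta> * charlier (2 * g) n n\<bar> \<le> 2 * \<Delta> * \<rho> n" by simp
    then show ?case unfolding \<epsilon>_def[symmetric] by (simp add: abs_mult mult_left_mono)
  qed
  ultimately show ?thesis by (rule Lim_null_comparison[rotated])
qed

text \<open>Fejer's formula is used with b = 2 g: the phase 2 b sqrt n becomes 4 g sqrt n and the
  amplitude 1 / sqrt (pi b) becomes 1 / sqrt (2 pi g).\<close>

theorem rabi_asymptotics:
  assumes g: "g > 0" and \<Delta>: "\<Delta> > 0" and s: "s = 1 \<or> s = -1"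
    and E: "\<And>n. E n \<in> rabi_eigenvalues s \<Delta> g" and lim: "(\<lambda>n. E n - (real n - g\<^sup>2)) \<longlonglongrightarrow> 0"
  shows "(\<lambda>n. real n powr (1/4) * (E n - (real n - g\<^sup>2))
     - \<Delta> / sqrt (2 * pi * g) * (s * (-1) ^ n * cos (4 * g * sqrt (real n) + - (pi / 4)))) \<longlonglongrightarrow> 0"
proof -
  define T where "T n = charlier (2 * g) n n" for n
  define l where "l n = exp (- ((2 * g)\<^sup>2 / 2)) * laguerre n ((2 * g)\<^sup>2)" for n
  define C where "C n = cos (2 * (2 * g) * sqrt (real n) - pi / 4) / sqrt (pi * (2 * g))" for n
  have T: "T n = (-1) ^ n * l n" for n
    unfolding T_def l_def laguerre_def charlier_diagonal by simp
  have "(\<lambda>n. real n powr (1/4) * l n - C n) \<longlonglongrightarrow> 0"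
    unfolding l_def C_def using g by (intro laguerre_asymptotics) simp
  then have "(\<lambda>n. s * \<Delta> * (-1) ^ n * (real n powr (1/4) * l n - C n)) \<longlonglongrightarrow> 0"
  proof (rule Lim_null_comparison[rotated, OF tendsto_mult_right_zero[OF tendsto_rabs_zero]])
    show "\<forall>\<^sub>F n in sequentially. norm (s * \<Delta> * (-1) ^ n * (real n powr (1/4) * l n - C n))
        \<le> \<Delta> * \<bar>real n powr (1/4) * l n - C n\<bar>"
      using s \<Delta> by (auto simp: abs_mult power_abs)
  qed
  from tendsto_add[OF rabi_first_order[OF assms] this]
  have "(\<lambda>n. real n powr (1/4) * (E n - (real n - g\<^sup>2) - s * \<Delta> * T n)
      + s * \<Delta> * (-1) ^ n * (real n powr (1/4) * l n - C n)) \<longlonglongrightarrow> 0"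
    by (simp only: add_0_left T_def)
  moreover have "real n powr (1/4) * (E n - (real n - g\<^sup>2) - s * \<Delta> * T n)
      + s * \<Delta> * (-1) ^ n * (real n powr (1/4) * l n - C n)
      = real n powr (1/4) * (E n - (real n - g\<^sup>2)) - s * \<Delta> * (-1) ^ n * C n" for n
    unfolding T by (simp add: right_diff_distrib)
  moreover have "s * \<Delta> * (-1) ^ n * C n
      = \<Delta> / sqrt (2 * pi * g) * (s * (-1) ^ n * cos (4 * g * sqrt (real n) + - (pi / 4)))" for n
    by (simp add: C_def mult_ac)
  ultimately show ?thesis by simp
qed

text \<open>Rescaling by R = \<Delta> / sqrt (2 pi g) reduces the claim to the arcsine law on
  [-1, 1]. The density 1 / (pi sqrt (R^2 - y^2)) has mass 1 on [-R, R], so the constant under the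
  root is R^2 = \<Delta>^2 / (2 pi g) and not the reciprocal shown in the English statement.\<close>

theorem theorem1p2:
  fixes \<Delta> g s \<alpha> \<beta> :: real and E :: "nat \<Rightarrow> real"
  assumes "\<Delta> > 0" and "g > 0"
    and "s = 1 \<or> s = -1"
    and "strict_mono E"
    and "range E = rabi_eigenvalues s \<Delta> g"
    and "(\<lambda>n. E n - (real n - g\<^sup>2)) \<longlonglongrightarrow> 0"
    and "\<alpha> \<le> \<beta>"
    and "- (\<Delta> / sqrt (2 * pi * g)) \<le> \<alpha>" and "\<beta> \<le> \<Delta> / sqrt (2 * pi * g)"
  shows "(\<lambda>N. real (card {n. n \<le> N \<and>
                  real n powr (1/4) * (E n - (real n - g\<^sup>2)) \<in> {\<alpha>..\<beta>}}) / real N)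
         \<longlonglongrightarrow> integral {\<alpha>..\<beta>} (\<lambda>y. 1 / (pi * sqrt (\<Delta>\<^sup>2 / (2 * pi * g) - y\<^sup>2)))"
proof -
  define R where "R = \<Delta> / sqrt (2 * pi * g)"
  have R: "R > 0" using assms(1,2) by (simp add: R_def)
  have R2: "R\<^sup>2 = \<Delta>\<^sup>2 / (2 * pi * g)" using assms(2) by (simp add: R_def power_divide)
  define \<delta> where "\<delta> n = real n powr (1/4) * (E n - (real n - g\<^sup>2))" for n
  define x where "x n = s * (-1) ^ n * cos (4 * g * sqrt (real n) + - (pi / 4))" for n
  have E: "E n \<in> rabi_eigenvalues s \<Delta> g" for n using assms(5) by blast
  have "(\<lambda>n. (\<delta> n - R * x n) / R) \<longlonglongrightarrow> 0 / R"
    using rabi_asymptotics[OF assms(2,1,3) E assms(6)] R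
    unfolding \<delta>_def x_def R_def[symmetric] by (intro tendsto_divide tendsto_const) auto
  then have diff: "(\<lambda>n. \<delta> n / R - x n) \<longlonglongrightarrow> 0" using R by (simp add: diff_divide_distrib)
  have x: "x n \<in> {-1..1}" for n
  proof -
    have "\<bar>x n\<bar> \<le> 1" using assms(3) by (auto simp: x_def abs_mult power_abs)
    then show ?thesis by (simp add: abs_le_iff)
  qed
  have moments: "(\<lambda>N. (\<Sum>n<N. x n ^ j) / real N) \<longlonglongrightarrow> arcsine_moment j" for j
    unfolding x_def using assms(2,3) by (intro moments_cos_sqrt) auto
  have "(\<lambda>N. real (card {n. n \<le> N \<and> \<delta> n / R \<in> {\<alpha> / R..\<beta> / R}}) / real N)
      \<longlonglongrightarrow> (arcsin (\<beta> / R) - arcsin (\<alpha> / R)) / pi"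
    using assms(7-9) R unfolding R_def[symmetric]
    by (intro arcsine_distribution[OF x moments diff]) (auto simp: field_simps)
  moreover have "\<delta> n / R \<in> {\<alpha> / R..\<beta> / R} \<longleftrightarrow> \<delta> n \<in> {\<alpha>..\<beta>}" for n
    using R by (simp add: divide_le_cancel)
  moreover have "integral {\<alpha>..\<beta>} (\<lambda>y. 1 / (pi * sqrt (\<Delta>\<^sup>2 / (2 * pi * g) - y\<^sup>2)))
      = (arcsin (\<beta> / R) - arcsin (\<alpha> / R)) / pi"
    unfolding R2[symmetric] using assms(7-9) unfolding R_def[symmetric]
    by (intro arcsine_density_integral[OF R]) auto
  ultimately show ?thesis unfolding \<delta>_def by simp
qed


end
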